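(* Let $W$ and $G$ be as in the context and let $\hat c=d-2\sum_{j=1}^dq_j$. Then the function $$Ell(W/G,z,\tau)=\frac1{|G|}\sum_{n,n_1\in G}\ \prod_{j=1}^d e^{-2\pi i z\,\theta_j(n)}\,\frac{\Theta\big((1-q_j)z-\theta_j(n)\tau-\theta_j(n_1),\tau\big)}{\Theta\big(q_jz+\theta_j(n)\tau+\theta_j(n_1),\tau\big)}$$ is a weak Jacobi form of weight $0$ and index $\frac{\hat c}{2}$ (with the character described in the context when $\hat c$ is odd).
   Context: Let $W(x_1,\dots,x_d)=\sum_{i=1}^d\prod_{j=1}^d x_j^{a_{ij}}$ be a polynomial with non-negative integer exponents such that $A=(a_{ij})$ is invertible, there are positive rational $q_1,\dots,q_d$ with $\sum_j a_{ij}q_j=1$ for all $i$, and $W$ is non-degenerate: the hypersurface $W=0$ in $\mathbb C^d$ is smooth away from the origin. Assume $\sum_j q_j\in\mathbb Z_{>0}$. Let $\mathrm{Aut}(W)$ be the group of diagonal automorphisms $x_j\mapsto \gamma_jx_j$ preserving $W$ (i.e. $\prod_j\gamma_j^{a_{ij}}=1$ for all $i$), $J_W=(e^{2\pi i q_j})_j\in \mathrm{Aut}(W)$, $SL_W=\{\gamma\in\mathrm{Aut}(W):\prod_j\gamma_j=1\}$, and let $G$ be a subgroup with $\langle J_W\rangle\subset G\subset SL_W$. For $n\in G$, choose rational numbers $\theta_1(n),\dots,\theta_d(n)$ such that $n$ is the automorphism $x_j\mapsto e^{2\pi i\theta_j(n)}x_j$. (Equivalently, with $G=N/N_0$, where $N_0=\bigoplus_j\mathbb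 Z v_j$ and $N\supset N_0$ is a lattice in $N_0\otimes\mathbb Q$, $\theta_j(n)$ is the $v_j$-coordinate of a representative of $n$ in $N$.) The summands of $Ell$ do not depend on the choice of $\theta_j(n)$ modulo $\mathbb Z$. $Ell$ is a priori meromorphic and removable singularities are removed. Let $H$ be the upper half plane. For $\nu\in\mathbb C$, $\tau\in H$, $q=e^{2\pi i\tau}$: $$\Theta(\nu,\tau)=iq^{1/8}e^{-i\pi\nu}(1-e^{2\pi i\nu})\prod_{n=1}^\infty(1-q^n)(1-q^ne^{2\pi i\nu})(1-q^ne^{-2\pi i\nu}),\qquad q^{1/8}=e^{2\pi i\tau/8}.$$ A weak Jacobi form of weight $0$ and index $\hat c/2$ here means a holomorphic function $\varphi(z,\tau)$ on $\mathbb C\times H$ such that $$\varphi(z,\tau+1)=\varphi(z,\tau),\qquad \varphi\big(\tfrac z\tau,-\tfrac1\tau\big)=e^{i\pi\hat c z^2/\tau}\varphi(z,\tau),$$ $$\varphi(z+1,\tau)=(-1)^{\hat c}\varphi(z,\tau),\qquad \varphi(z+\tau,\tau)=(-1)^{\hat c}e^{-i\pi\hat c(\tau+2z)}\varphi(z,\tau),$$ and such that the Fourier expansion of $\varphi$ in powers of $y=e^{2\pi iz}$ and $q=e^{2\pi i\tau}$ contains only non-negative powers of $q$. (The sign $(-1)^{\hat c}$ is the character allowed when $\hat c$ is odd.) *)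

theory Defs
  imports
    "HOL-Complex_Analysis.Complex_Analysis"
    "HOL-Algebra.Generated_Groups"
begin

unbundle no fps_syntax

subsection \<open>The polynomial and its diagonal symmetries\<close>

definition W_poly :: "nat^'n^'n \<Rightarrow> complex^'n \<Rightarrow> complex" where
  "W_poly A x = (\<Sum>i\<in>UNIV. \<Prod>j\<in>UNIV. (x $ j) ^ (A $ i $ j))"

definition partial_deriv :: "'n \<Rightarrow> (complex^'n \<Rightarrow> complex) \<Rightarrow> complex^'n \<Rightarrow> complex" where
  "partial_deriv j f x = deriv (\<lambda>t. f (\<chi> k. if k = j then t else x $ k)) (x $ j)"

text \<open>Jacobian criterion: the hypersurface \<open>W = 0\<close> is smooth at each of its points
  other than the origin.\<close>
definition nondegenerate :: "nat^'n^'n \<Rightarrow> bool" where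
  "nondegenerate A \<longleftrightarrow>
    (\<forall>x. x \<noteq> 0 \<and> W_poly A x = 0 \<longrightarrow> (\<exists>j. partial_deriv j (W_poly A) x \<noteq> 0))"

text \<open>The vector \<open>\<gamma>\<close> stands for the automorphism \<open>x\<^sub>j \<mapsto> \<gamma>\<^sub>j x\<^sub>j\<close>; multiplication and unit of
  the type of vectors are componentwise.\<close>
definition Aut_W :: "nat^'n^'n \<Rightarrow> (complex^'n) monoid" where
  "Aut_W A = \<lparr>carrier = {\<gamma>. (\<forall>j. \<gamma> $ j \<noteq> 0) \<and> (\<forall>i. (\<Prod>j\<in>UNIV. (\<gamma> $ j) ^ (A $ i $ j)) = 1)},
              monoid.mult = (\<lambda>x y. x * y), one = 1\<rparr>"

definition SL_W :: "nat^'n^'n \<Rightarrow> (complex^'n) set" where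
  "SL_W A = {\<gamma> \<in> carrier (Aut_W A). (\<Prod>j\<in>UNIV. \<gamma> $ j) = 1}"

definition J_W :: "rat^'n \<Rightarrow> complex^'n" where
  "J_W q = (\<chi> j. exp (2 * of_real pi * \<i> * of_rat (q $ j)))"


subsection \<open>The elliptic genus\<close>

definition Theta :: "complex \<Rightarrow> complex \<Rightarrow> complex" where
  "Theta \<nu> \<tau> =
    (let Q = exp (2 * of_real pi * \<i> * \<tau>); y = exp (2 * of_real pi * \<i> * \<nu>) in
     \<i> * exp (2 * of_real pi * \<i> * \<tau> / 8) * exp (- \<i> * of_real pi * \<nu>) * (1 - y) *
     (\<Prod>n. (1 - Q ^ Suc n) * (1 - Q ^ Suc n * y) * (1 - Q ^ Suc n * inverse y)))"

definition Ell_formula ::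
    "rat^'n \<Rightarrow> (complex^'n \<Rightarrow> rat^'n) \<Rightarrow> (complex^'n) set \<Rightarrow> complex \<Rightarrow> complex \<Rightarrow> complex" where
  "Ell_formula q \<theta> G z \<tau> =
    1 / of_nat (card G) *
    (\<Sum>n\<in>G. \<Sum>n1\<in>G. \<Prod>j\<in>UNIV.
       exp (- 2 * of_real pi * \<i> * z * of_rat (\<theta> n $ j)) *
       (Theta ((1 - of_rat (q $ j)) * z - of_rat (\<theta> n $ j) * \<tau> - of_rat (\<theta> n1 $ j)) \<tau> /
        Theta (of_rat (q $ j) * z + of_rat (\<theta> n $ j) * \<tau> + of_rat (\<theta> n1 $ j)) \<tau>))"

text \<open>Removable singularities are removed slice by slice: as all \<open>q\<^sub>j\<close> are nonzero, for each
  \<open>\<tau>\<close> in the upper half plane the zeros in \<open>z\<close> of the denominators are isolated.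
  So \<open>Ell\<close> agrees with the formula wherever no denominator vanishes, and if the formula extends
  holomorphically in \<open>(z, \<tau>)\<close>, then \<open>Ell\<close> is that extension.  At a genuine pole
  the value is 0, so there \<open>Ell\<close> is not continuous.\<close>
definition Ell ::
    "rat^'n \<Rightarrow> (complex^'n \<Rightarrow> rat^'n) \<Rightarrow> (complex^'n) set \<Rightarrow> complex \<Rightarrow> complex \<Rightarrow> complex" where
  "Ell q \<theta> G z \<tau> = remove_sings (\<lambda>w. Ell_formula q \<theta> G w \<tau>) z"


subsection \<open>Weak Jacobi forms of weight 0\<close>

text \<open>Complex differentiability in two variables on \<open>\<complex> \<times> H\<close>: the total derivative exists and
  is complex linear.\<close>
definition holomorphic_CxH :: "(complex \<Rightarrow> complex \<Rightarrow> complex) \<Rightarrow> bool" where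
  "holomorphic_CxH \<phi> \<longleftrightarrow>
    (\<forall>z \<tau>. Im \<tau> > 0 \<longrightarrow>
      (\<exists>a b. ((\<lambda>(w, t). \<phi> w t) has_derivative (\<lambda>(h, k). a * h + b * k)) (at (z, \<tau>))))"

text \<open>The parameter \<open>c\<close> is twice the index.  For odd \<open>c\<close> the sign in \<open>z \<mapsto> z + 1\<close> makes the
  exponents of \<open>y = exp (2 \<pi> \<i> z)\<close> half-integral; in general they lie in \<open>c/2 + \<int>\<close>.  The coefficient
  of \<open>q\<^sup>n y\<^sup>l\<^sup>+\<^sup>c\<^sup>/\<^sup>2\<close> is \<open>a n l\<close>.\<close>
definition weak_jacobi_form_wt0 :: "int \<Rightarrow> (complex \<Rightarrow> complex \<Rightarrow> complex) \<Rightarrow> bool" where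
  "weak_jacobi_form_wt0 c \<phi> \<longleftrightarrow>
    holomorphic_CxH \<phi> \<and>
    (\<forall>z \<tau>. Im \<tau> > 0 \<longrightarrow>
      \<phi> z (\<tau> + 1) = \<phi> z \<tau> \<and>
      \<phi> (z / \<tau>) (- 1 / \<tau>) = exp (\<i> * of_real pi * of_int c * z\<^sup>2 / \<tau>) * \<phi> z \<tau> \<and>
      \<phi> (z + 1) \<tau> = (- 1) powi c * \<phi> z \<tau> \<and>
      \<phi> (z + \<tau>) \<tau> =
        (- 1) powi c * exp (- \<i> * of_real pi * of_int c * (\<tau> + 2 * z)) * \<phi> z \<tau>) \<and>
    (\<exists>a :: int \<Rightarrow> int \<Rightarrow> complex.
      (\<forall>n l. n < 0 \<longrightarrow> a n l = 0) \<and>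
      (\<forall>z \<tau>. Im \<tau> > 0 \<longrightarrow>
        ((\<lambda>(n, l). a n l * exp (2 * of_real pi * \<i> * of_int n * \<tau>) *
                   exp (2 * of_real pi * \<i> * (of_int l + of_int c / 2) * z))
          has_sum \<phi> z \<tau>) UNIV))"

end

theory Submission
  imports Defs
begin

text \<open>
  Write \<open>L = \<int> + \<int> \<tau>\<close> and \<open>w\<^sub>j = q\<^sub>j z + \<theta>\<^sub>j(n) \<tau> + \<theta>\<^sub>j(n\<^sub>1)\<close>, so that the \<open>j\<close>-th factor of a summand is an
  exponential times \<open>\<Theta>(z - w\<^sub>j) / \<Theta>(w\<^sub>j)\<close>, and \<open>\<Theta>(\<nu>, \<tau>)\<close> has exactly the points \<open>\<nu> \<in> L\<close> as (simple) zeros.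

  \<^emph>\<open>Holomorphy.\<close> Every single summand extends holomorphically. At a point \<open>(z, \<tau>)\<close> let \<open>S\<close> be the set
  of \<open>j\<close> with \<open>w\<^sub>j \<in> L\<close> (poles) and \<open>N\<close> the set of \<open>j\<close> with \<open>z - w\<^sub>j \<in> L\<close> (zeros); the claim is
  \<open>|S| \<le> |N|\<close> (\<open>card_poles_le_card_zeros\<close>). If \<open>z \<in> L\<close> then \<open>S = N\<close>. Otherwise, since
  \<open>\<Sum>\<^sub>j a\<^sub>i\<^sub>j w\<^sub>j - z \<in> L\<close> for each row \<open>i\<close>, no monomial of \<open>W\<close> is supported in \<open>S\<close>, and if a monomial is
  \<open>x\<^sub>k\<close> times a monomial in the variables of \<open>S\<close>, then \<open>k \<in> N\<close>. That there are at least \<open>|S|\<close> such \<open>k\<close>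
  (\<open>card_le_card_pointed\<close>) is where non-degeneracy enters: for each nonempty \<open>T \<subseteq> S\<close> some \<open>k\<close> has
  exactly one monomial \<open>x\<^sub>k m(x\<^sub>T)\<close>. Else, \<open>A\<close> being invertible, the values of the monomials can be
  prescribed on the torus so that all \<open>\<partial>W/\<partial>x\<^sub>k\<close> vanish at a point with support \<open>T\<close>. Removing from
  \<open>T\<close> a variable of that unique monomial loses \<open>k\<close>, and induction gives the inequality. (If some
  \<open>q\<^sub>j = 1\<close>, then \<open>x\<^sub>j\<close> itself is a monomial of \<open>W\<close> and the elliptic genus vanishes identically.) All
  vanishing factors at \<open>(z\<^sub>0, \<tau>\<^sub>0)\<close> vanish along one and the same complex line
  \<open>z = \<alpha> \<tau> + \<beta>\<close> with \<open>\<alpha>\<close>, \<open>\<beta>\<close> real, so dividing by powers of \<open>z - \<alpha> \<tau> - \<beta>\<close> gives an extension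
  that is holomorphic in both variables (\<open>ell_factor_prod_local\<close>).

  \<^emph>\<open>Transformation laws.\<close> They follow, factor by factor, from the quasi-periodicity of \<open>\<Theta>\<close> and from
  \<open>\<Theta>(\<nu>/\<tau>, -1/\<tau>) = C(\<tau>) exp(\<pi> \<i> \<nu>\<^sup>2/\<tau>) \<Theta>(\<nu>, \<tau>)\<close>, where only \<open>C(\<tau>) \<noteq> 0\<close> matters because \<open>C(\<tau>)\<close> cancels
  in the quotients; this form of the law is a consequence of Liouville's theorem
  (\<open>Theta_inversion\<close>). Each of the four substitutions permutes the summands: it replaces \<open>n\<^sub>1\<close> by
  \<open>n\<^sub>1 J\<close>, \<open>n\<close> by \<open>n J\<close>, \<open>n\<^sub>1\<close> by \<open>n n\<^sub>1\<close>, or \<open>(n, n\<^sub>1)\<close> by \<open>(n\<^sub>1, n\<^sup>-\<^sup>1)\<close>.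

  \<^emph>\<open>Fourier expansion.\<close> After multiplication by \<open>exp(-\<pi> \<i> c z)\<close> the genus has period 1 in \<open>z\<close> and in
  \<open>\<tau>\<close>, and so has an absolutely convergent expansion in both variables. On the line \<open>Im z = 1\<close> it
  stays bounded as \<open>Im \<tau> \<rightarrow> \<infinity>\<close>, which kills the coefficients of negative powers of \<open>exp(2\<pi>\<i>\<tau>)\<close>.
\<close>

section \<open>Complex differentiability in two variables\<close>

text \<open>The total derivative at the point exists and is complex linear.\<close>
definition holo2 :: "(complex \<times> complex \<Rightarrow> complex) \<Rightarrow> complex \<times> complex \<Rightarrow> bool" where
  "holo2 f p \<longleftrightarrow> (\<exists>a b. (f has_derivative (\<lambda>x. a * fst x + b * snd x)) (at p))"

named_theorems holo2_intros

lemma holo2I: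
  "(f has_derivative D) (at p) \<Longrightarrow> (\<And>x. D x = a * fst x + b * snd x) \<Longrightarrow> holo2 f p"
  unfolding holo2_def by (intro exI[of _ a] exI[of _ b]) (auto elim!: has_derivative_eq_rhs)

lemma holo2E:
  assumes "holo2 f p"
  obtains a b where "(f has_derivative (\<lambda>x. a * fst x + b * snd x)) (at p)"
  using assms unfolding holo2_def by blast

lemma holo2_const [holo2_intros]: "holo2 (\<lambda>_. c) p"
  by (rule holo2I[where a = 0 and b = 0]) (rule has_derivative_const, simp)

lemma holo2_fst [holo2_intros]: "holo2 fst p"
  by (rule holo2I[where a = 1 and b = 0], rule has_derivative_fst[OF has_derivative_ident]) simp

lemma holo2_snd [holo2_intros]: "holo2 snd p"
  by (rule holo2I[where a = 0 and b = 1], rule has_derivative_snd[OF has_derivative_ident]) simp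

lemma holo2_add [holo2_intros]:
  assumes "holo2 f p" "holo2 g p"
  shows "holo2 (\<lambda>x. f x + g x) p"
proof -
  from assms(1) obtain a b where 1: "(f has_derivative (\<lambda>x. a * fst x + b * snd x)) (at p)"
    by (rule holo2E)
  from assms(2) obtain c d where 2: "(g has_derivative (\<lambda>x. c * fst x + d * snd x)) (at p)"
    by (rule holo2E)
  show ?thesis
    by (rule holo2I[OF has_derivative_add[OF 1 2], where a = "a + c" and b = "b + d"])
       (simp add: algebra_simps)
qed

lemma holo2_mult [holo2_intros]:
  assumes "holo2 f p" "holo2 g p"
  shows "holo2 (\<lambda>x. f x * g x) p"
proof -
  from assms(1) obtain a b where 1: "(f has_derivative (\<lambda>x. a * fst x + b * snd x)) (at p)"
    by (rule holo2E)
  from assms(2) obtain c d where 2: "(g has_derivative (\<lambda>x. c * fst x + d * snd x)) (at p)"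
    by (rule holo2E)
  show ?thesis
    by (rule holo2I[OF has_derivative_mult[OF 1 2],
          where a = "f p * c + a * g p" and b = "f p * d + b * g p"])
       (simp add: algebra_simps)
qed

lemma holo2_compose1:
  assumes "holo2 f p" "g field_differentiable at (f p)"
  shows "holo2 (\<lambda>x. g (f x)) p"
proof -
  from assms(1) obtain a b where 1: "(f has_derivative (\<lambda>x. a * fst x + b * snd x)) (at p)"
    by (rule holo2E)
  from assms(2) obtain g' where "(g has_field_derivative g') (at (f p))"
    by (auto simp: field_differentiable_def)
  hence 2: "(g has_derivative (\<lambda>h. g' * h)) (at (f p))"
    by (simp add: has_field_derivative_def)
  show ?thesis
    by (rule holo2I[OF has_derivative_compose[OF 1 2], where a = "g' * a" and b = "g' * b"])
       (simp add: algebra_simps)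
qed

lemma holo2_compose2:
  assumes "holo2 F (f p, g p)" "holo2 f p" "holo2 g p"
  shows "holo2 (\<lambda>x. F (f x, g x)) p"
proof -
  from assms(2) obtain a b where 1: "(f has_derivative (\<lambda>x. a * fst x + b * snd x)) (at p)"
    by (rule holo2E)
  from assms(3) obtain c d where 2: "(g has_derivative (\<lambda>x. c * fst x + d * snd x)) (at p)"
    by (rule holo2E)
  from assms(1) obtain r s where 3: "(F has_derivative (\<lambda>x. r * fst x + s * snd x)) (at (f p, g p))"
    by (rule holo2E)
  show ?thesis
    by (rule holo2I[OF has_derivative_compose[OF has_derivative_Pair[OF 1 2] 3],
          where a = "r * a + s * c" and b = "r * b + s * d"])
       (simp add: algebra_simps)
qed

lemma holo2_minus [holo2_intros]: "holo2 f p \<Longrightarrow> holo2 (\<lambda>x. - f x) p"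
  using holo2_mult[OF holo2_const[of "-1"]] by simp

lemma holo2_diff [holo2_intros]: "holo2 f p \<Longrightarrow> holo2 g p \<Longrightarrow> holo2 (\<lambda>x. f x - g x) p"
  using holo2_add[OF _ holo2_minus] by simp

lemma holo2_divide [holo2_intros]:
  assumes "holo2 f p" "holo2 g p" "g p \<noteq> 0"
  shows "holo2 (\<lambda>x. f x / g x) p"
proof -
  have "inverse field_differentiable at (g p)"
    using assms(3) by (intro holomorphic_on_imp_differentiable_at[of _ "-{0}"] holomorphic_intros) auto
  from holo2_mult[OF assms(1) holo2_compose1[OF assms(2) this]] show ?thesis
    by (simp add: divide_inverse)
qed

lemma holo2_exp [holo2_intros]: "holo2 f p \<Longrightarrow> holo2 (\<lambda>x. exp (f x)) p"
  by (rule holo2_compose1[OF _ field_differentiable_within_exp])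

lemma holo2_sum [holo2_intros]:
  "(\<And>i. i \<in> I \<Longrightarrow> holo2 (f i) p) \<Longrightarrow> holo2 (\<lambda>x. \<Sum>i\<in>I. f i x) p"
  by (induction I rule: infinite_finite_induct) (auto intro!: holo2_intros)

lemma holo2_prod [holo2_intros]:
  "(\<And>i. i \<in> I \<Longrightarrow> holo2 (f i) p) \<Longrightarrow> holo2 (\<lambda>x. \<Prod>i\<in>I. f i x) p"
  by (induction I rule: infinite_finite_induct) (auto intro!: holo2_intros)

lemma holo2_power [holo2_intros]: "holo2 f p \<Longrightarrow> holo2 (\<lambda>x. f x ^ n) p"
  by (induction n) (auto intro!: holo2_intros)

lemma holo2_isCont: "holo2 f p \<Longrightarrow> isCont f p"
  by (auto elim!: holo2E intro: has_derivative_continuous)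

lemma holo2_transform:
  assumes "holo2 f p" "eventually (\<lambda>x. f x = g x) (nhds p)"
  shows "holo2 g p"
proof -
  from assms(1) obtain a b where 1: "(f has_derivative (\<lambda>x. a * fst x + b * snd x)) (at p)"
    by (rule holo2E)
  have "f p = g p"
    using assms(2) by (rule eventually_nhds_x_imp_x)
  have "eventually (\<lambda>x. f x = g x) (at p)"
    using assms(2) by (auto simp: eventually_at_filter elim: eventually_mono)
  from has_derivative_transform_eventually[OF 1 this] \<open>f p = g p\<close>
  have "(g has_derivative (\<lambda>x. a * fst x + b * snd x)) (at p)" by simp
  from holo2I[OF this] show ?thesis by simp
qed

lemma holo2_slice1:
  assumes "holo2 f (z, t)"
  shows "(\<lambda>w. f (w, t)) field_differentiable at z"
proof -
  from assms(1) obtain a b where 1: "(f has_derivative (\<lambda>x. a * fst x + b * snd x)) (at (z,t))"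
    by (rule holo2E)
  have "((\<lambda>w. (w, t)) has_derivative (\<lambda>h. (h, 0))) (at z)"
    by (auto intro!: derivative_eq_intros)
  from has_derivative_compose[OF this 1]
  have "((\<lambda>w. f (w, t)) has_field_derivative a) (at z)"
    by (simp add: has_field_derivative_def)
  thus ?thesis by (auto simp: field_differentiable_def)
qed

lemma holo2_slice2:
  assumes "holo2 f (z, t)"
  shows "(\<lambda>w. f (z, w)) field_differentiable at t"
proof -
  from assms(1) obtain a b where 1: "(f has_derivative (\<lambda>x. a * fst x + b * snd x)) (at (z,t))"
    by (rule holo2E)
  have "((\<lambda>w. (z, w)) has_derivative (\<lambda>h. (0, h))) (at t)"
    by (auto intro!: derivative_eq_intros)
  from has_derivative_compose[OF this 1]
  have "((\<lambda>w. f (z, w)) has_field_derivative b) (at t)"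
    by (simp add: has_field_derivative_def)
  thus ?thesis by (auto simp: field_differentiable_def)
qed

text \<open>By Cauchy's estimate, the derivatives of two functions that are uniformly close on a disc
  are close on a smaller disc.\<close>
lemma continuous_on_deriv_param:
  fixes f :: "'a :: metric_space \<Rightarrow> complex \<Rightarrow> complex"
  assumes cont: "continuous_on (U \<times> V) (\<lambda>(w, t). f w t)"
    and V: "open V" and hol: "\<And>w. w \<in> U \<Longrightarrow> f w holomorphic_on V"
  shows "continuous_on (U \<times> V) (\<lambda>(w, t). deriv (f w) t)"
  unfolding continuous_on_def
proof (clarify, rule tendstoI)
  fix w0 t0 and e :: real
  assume w0: "w0 \<in> U" and t0: "t0 \<in> V" and e: "e > 0"
  obtain R where R: "R > 0" "cball t0 R \<subseteq> V"
    using V t0 open_contains_cball by blast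
  define r where "r = R / 2"
  have r: "r > 0" "R = 2 * r" using R by (auto simp: r_def)
  have c: "continuous_on (U \<times> cball t0 R) (\<lambda>(w, t). f w t)"
    by (rule continuous_on_subset[OF cont]) (use R in auto)
  have "e / 2 * r / 2 > 0" using e r by simp
  from continuous_on_prod_compactE[OF c compact_cball w0 this]
  obtain X0 where X0: "w0 \<in> X0" "open X0"
    and X0': "\<forall>w\<in>X0 \<inter> U. \<forall>t\<in>cball t0 R. dist (case (w, t) of (w, t) \<Rightarrow> f w t)
        (case (w0, t) of (w, t) \<Rightarrow> f w t) \<le> e / 2 * r / 2"
    by metis
  have X0b: "dist (f w t) (f w0 t) \<le> e / 2 * r / 2" if "w \<in> X0 \<inter> U" "t \<in> cball t0 R" for w t
    using X0' that by simp
  have holV: "f w holomorphic_on cball t0 R" if "w \<in> U" for w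
    using hol[OF that] R(2) by (rule holomorphic_on_subset)
  have close: "norm (deriv (f w) t - deriv (f w0) t) \<le> e / 4"
    if w: "w \<in> X0" "w \<in> U" and t: "dist t0 t < r" for w t
  proof -
    have sub: "cball t r \<subseteq> cball t0 R"
      using t r by (intro subsetI) (smt (verit) dist_triangle mem_cball)
    have d: "(\<lambda>x. f w x - f w0 x) holomorphic_on cball t r"
      by (intro holomorphic_intros holomorphic_on_subset[OF holV sub] w w0)
    have "norm ((deriv ^^ 1) (\<lambda>x. f w x - f w0 x) t) \<le> fact 1 * (e / 2 * r / 2) / r ^ 1"
    proof (rule Cauchy_inequality)
      show "(\<lambda>x. f w x - f w0 x) holomorphic_on ball t r"
        by (rule holomorphic_on_subset[OF d]) auto
      show "continuous_on (cball t r) (\<lambda>x. f w x - f w0 x)"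
        by (rule holomorphic_on_imp_continuous_on[OF d])
      fix x assume "norm (t - x) = r"
      hence "x \<in> cball t r" by (simp add: dist_norm)
      with sub have "x \<in> cball t0 R" by blast
      from X0b[of w, OF _ this] w show "norm (f w x - f w0 x) \<le> e / 2 * r / 2"
        by (simp add: dist_norm)
    qed fact
    moreover have "deriv (\<lambda>x. f w x - f w0 x) t = deriv (f w) t - deriv (f w0) t"
    proof (rule deriv_diff)
      have "t \<in> ball t0 R" using t r by simp
      moreover have "f w holomorphic_on ball t0 R" "f w0 holomorphic_on ball t0 R"
        using holomorphic_on_subset[OF holV, of _ "ball t0 R"] w w0 by auto
      ultimately show "f w field_differentiable at t" "f w0 field_differentiable at t"
        using holomorphic_on_imp_differentiable_at by blast+
    qed
    ultimately show ?thesis using r by simp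
  qed
  have "continuous_on V (deriv (f w0))"
    by (intro holomorphic_on_imp_continuous_on holomorphic_deriv hol w0 V)
  hence "isCont (deriv (f w0)) t0"
    using V t0 continuous_on_eq_continuous_at by blast
  hence "eventually (\<lambda>t. dist (deriv (f w0) t) (deriv (f w0) t0) < e / 2) (nhds t0)"
    using e by (intro tendstoD) (simp_all add: isCont_def tendsto_at_iff_tendsto_nhds)
  moreover have "eventually (\<lambda>t. dist t0 t < r) (nhds t0)"
    using r by (auto simp: eventually_nhds_metric dist_commute)
  ultimately have ev1: "eventually (\<lambda>t. dist t0 t < r \<and> dist (deriv (f w0) t) (deriv (f w0) t0) < e / 2) (nhds t0)"
    by eventually_elim auto
  have ev2: "eventually (\<lambda>w. w \<in> X0) (nhds w0)"
    using X0 by (auto simp: eventually_nhds)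
  have "eventually (\<lambda>(w, t). w \<in> X0 \<and> dist t0 t < r \<and>
      dist (deriv (f w0) t) (deriv (f w0) t0) < e / 2) (nhds (w0, t0))"
    unfolding nhds_prod using ev1 ev2 by (auto simp: eventually_prod_filter)
  hence "eventually (\<lambda>(w, t). w \<in> X0 \<and> dist t0 t < r \<and>
      dist (deriv (f w0) t) (deriv (f w0) t0) < e / 2) (at (w0, t0) within U \<times> V)"
    unfolding eventually_at_filter by eventually_elim auto
  moreover have "eventually (\<lambda>p. p \<in> U \<times> V) (at (w0, t0) within U \<times> V)"
    by (auto simp: eventually_at_filter)
  ultimately show "\<forall>\<^sub>F x in at (w0, t0) within U \<times> V.
      dist (case x of (w, t) \<Rightarrow> deriv (f w) t) (deriv (f w0) t0) < e"
  proof eventually_elim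
    case (elim p)
    obtain w t where p: "p = (w, t)" by (cases p)
    from elim p have *: "w \<in> X0" "w \<in> U" "dist t0 t < r"
      "dist (deriv (f w0) t) (deriv (f w0) t0) < e / 2" by auto
    have "dist (deriv (f w) t) (deriv (f w0) t0) \<le> e / 4 + dist (deriv (f w0) t) (deriv (f w0) t0)"
      using close[OF *(1-3)] dist_triangle[of "deriv (f w) t" "deriv (f w0) t0" "deriv (f w0) t"]
      by (simp add: dist_norm)
    also have "\<dots> < e" using * e by simp
    finally show ?case by (simp add: p)
  qed
qed

text \<open>Osgood's lemma; the theorem of Hartogs, which drops the continuity, is not needed.\<close>
lemma holo2_if_continuous_separately_holomorphic:
  fixes f :: "complex \<Rightarrow> complex \<Rightarrow> complex"
  assumes U: "open U" and V: "open V"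
    and cont: "continuous_on (U \<times> V) (\<lambda>(w, t). f w t)"
    and hol1: "\<And>t. t \<in> V \<Longrightarrow> (\<lambda>w. f w t) holomorphic_on U"
    and hol2: "\<And>w. w \<in> U \<Longrightarrow> f w holomorphic_on V"
    and p: "w \<in> U" "t \<in> V"
  shows "holo2 (\<lambda>(w, t). f w t) (w, t)"
proof -
  obtain r where r: "r > 0" "ball t r \<subseteq> V"
    using V p open_contains_ball by blast
  have dc: "continuous_on (U \<times> V) (\<lambda>(w, t). deriv (f w) t)"
    by (rule continuous_on_deriv_param[OF cont V hol2])
  have "((\<lambda>(x, y). f x y) has_derivative
      (\<lambda>(tx, ty). deriv (\<lambda>x. f x t) w * tx + blinfun_mult_right (deriv (f w) t) ty))
      (at (w, t) within U \<times> ball t r)"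
  proof (rule has_derivative_partialsI)
    have "((\<lambda>x. f x t) has_field_derivative deriv (\<lambda>x. f x t) w) (at w)"
      using hol1[of t] U p holomorphic_derivI by blast
    thus "((\<lambda>x. f x t) has_derivative (*) (deriv (\<lambda>x. f x t) w)) (at w within U)"
      unfolding has_field_derivative_def by (rule has_derivative_at_withinI)
    fix x y assume "x \<in> U" "y \<in> ball t r"
    hence "(f x has_field_derivative deriv (f x) y) (at y)"
      using hol2[of x] V r holomorphic_derivI by blast
    thus "(f x has_derivative blinfun_apply (blinfun_mult_right (deriv (f x) y))) (at y within ball t r)"
      unfolding has_field_derivative_def blinfun_mult_right.rep_eq by (rule has_derivative_at_withinI)
  next
    have "continuous_on (U \<times> V) (\<lambda>p. blinfun_mult_right (case p of (x, y) \<Rightarrow> deriv (f x) y))"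
      by (intro bounded_linear.continuous_on[OF bounded_linear_blinfun_mult_right] dc)
    hence "continuous_on (U \<times> ball t r) (\<lambda>p. blinfun_mult_right (case p of (x, y) \<Rightarrow> deriv (f x) y))"
      by (rule continuous_on_subset) (use r in auto)
    thus "continuous (at (w, t) within U \<times> ball t r) (\<lambda>(x, y). blinfun_mult_right (deriv (f x) y))"
      using p r by (auto simp: continuous_on_eq_continuous_within case_prod_unfold)
  qed (use r in auto)
  moreover have "at (w, t) within U \<times> ball t r = at (w, t)"
    using p r U by (intro at_within_open open_Times) auto
  ultimately have "((\<lambda>(x, y). f x y) has_derivative
      (\<lambda>(tx, ty). deriv (\<lambda>x. f x t) w * tx + blinfun_mult_right (deriv (f w) t) ty)) (at (w, t))"
    by simp
  thus ?thesis
    by (rule holo2I) (simp add: blinfun_mult_right.rep_eq case_prod_unfold)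
qed


section \<open>The theta function\<close>


text \<open>The infinite product \<open>(1 - X) (1 - Q X) (1 - Q\<^sup>2 X) \<dots>\<close>, for \<open>|Q| < 1\<close>.\<close>
definition qprod :: "complex \<Rightarrow> complex \<Rightarrow> complex" where
  "qprod X Q = (\<Prod>n. 1 - Q ^ n * X)"

lemma qprod_summable:
  assumes "norm Q < 1"
  shows "summable (\<lambda>n. norm (- (Q ^ n * X) :: complex))"
proof -
  have "summable (\<lambda>n. norm X * norm Q ^ n)"
    by (intro summable_mult summable_geometric) (use assms in auto)
  thus ?thesis by (simp add: norm_mult norm_power mult.commute)
qed

lemma qprod_convergent:
  assumes "norm Q < 1"
  shows "convergent_prod (\<lambda>n. 1 - Q ^ n * X :: complex)"
proof -
  have "abs_convergent_prod (\<lambda>n. 1 + (- (Q ^ n * X)) :: complex)"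
    unfolding abs_convergent_prod_conv_summable using qprod_summable[OF assms, of X] by simp
  from abs_convergent_prod_imp_convergent_prod[OF this] show ?thesis by simp
qed

lemma qprod_eq_0_iff: "norm Q < 1 \<Longrightarrow> qprod X Q = 0 \<longleftrightarrow> (\<exists>n. Q ^ n * X = 1)"
  unfolding qprod_def using has_prod_eq_0_iff[OF convergent_prod_has_prod[OF qprod_convergent[of Q X]]]
  by (auto simp: image_iff)

lemma qprod_rec:
  assumes "norm Q < 1"
  shows "qprod X Q = (1 - X) * qprod (Q * X) Q"
proof -
  have "(\<lambda>n. 1 - Q ^ Suc n * X) has_prod qprod (Q * X) Q"
    using convergent_prod_has_prod[OF qprod_convergent[OF assms, of "Q * X"]]
    by (simp add: qprod_def mult.assoc mult.left_commute)
  from has_prod_Suc_imp[OF this] show ?thesis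
    by (simp add: qprod_def has_prod_iff mult.commute)
qed

lemma qprod_uniform_limit:
  assumes "\<rho> < 1" "0 \<le> \<rho>"
  shows "uniform_limit (cball 0 R \<times> cball 0 \<rho>) (\<lambda>N (X, Q). \<Prod>n<N. 1 - Q ^ n * X)
           (\<lambda>(X, Q). qprod X Q) sequentially"
proof -
  let ?A = "cball 0 R \<times> cball 0 \<rho> :: (complex \<times> complex) set"
  let ?f = "\<lambda>n (X, Q). - (Q ^ n * X) :: complex"
  have "uniformly_convergent_on ?A (\<lambda>N x. \<Sum>n<N. norm (?f n x))"
  proof (rule Weierstrass_m_test')
    show "norm (norm (?f n x)) \<le> \<rho> ^ n * R" if "x \<in> ?A" for n x
      using that by (auto simp: norm_mult norm_power assms intro!: mult_mono power_mono)
    show "summable (\<lambda>n. \<rho> ^ n * R)"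
      by (intro summable_mult2 summable_geometric) (use assms in auto)
  qed
  hence "uniformly_convergent_on ?A (\<lambda>N x. \<Prod>n<N. 1 + ?f n x)"
    by (intro uniformly_convergent_on_prod)
       (auto intro!: compact_Times continuous_intros simp: case_prod_unfold)
  then obtain L where L: "uniform_limit ?A (\<lambda>N x. \<Prod>n<N. 1 + ?f n x) L sequentially"
    by (auto simp: uniformly_convergent_on_def)
  have "L x = (case x of (X, Q) \<Rightarrow> qprod X Q)" if x: "x \<in> ?A" for x
  proof -
    obtain X Q where [simp]: "x = (X, Q)" by (cases x)
    from x assms have Q: "norm Q < 1" by auto
    have "(\<lambda>N. \<Prod>n<N. 1 + ?f n x) \<longlonglongrightarrow> L x"
      by (rule tendsto_uniform_limitI[OF L x])
    moreover have "(\<lambda>N. \<Prod>n\<le>N. 1 - Q ^ n * X) \<longlonglongrightarrow> qprod X Q"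
      unfolding qprod_def by (rule convergent_prod_LIMSEQ[OF qprod_convergent[OF Q]])
    hence "(\<lambda>N. \<Prod>n<N. 1 + ?f n x) \<longlonglongrightarrow> qprod X Q"
      by (simp add: LIMSEQ_lessThan_iff_atMost)
    ultimately show ?thesis using LIMSEQ_unique by auto
  qed
  moreover have "(\<lambda>N x. \<Prod>n<N. 1 + ?f n x) = (\<lambda>N (X, Q). \<Prod>n<N. 1 - Q ^ n * X)"
    by (auto simp: fun_eq_iff)
  ultimately show ?thesis
    using L uniform_limit_cong'[of ?A] by (metis (no_types, lifting))
qed

lemma qprod_holo2:
  assumes "norm Q < 1"
  shows "holo2 (\<lambda>(X, Q). qprod X Q) (X, Q)"
proof -
  define R where "R = norm X + 1"
  obtain \<rho> where \<rho>: "norm Q < \<rho>" "\<rho> < 1" using assms dense by blast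
  have \<rho>0: "0 \<le> \<rho>" using \<rho> norm_ge_zero[of Q] by linarith
  note ul = qprod_uniform_limit[OF \<rho>(2) \<rho>0, of R]
  have c: "continuous_on (cball 0 R \<times> cball 0 \<rho>) (\<lambda>(X, Q). qprod X Q)"
    by (rule uniform_limit_theorem[OF _ ul])
       (auto intro!: always_eventually continuous_intros simp: case_prod_unfold)
  show ?thesis
  proof (rule holo2_if_continuous_separately_holomorphic[where U = "ball 0 R" and V = "ball 0 \<rho>"])
    show "continuous_on (ball 0 R \<times> ball 0 \<rho>) (\<lambda>(X, Q). qprod X Q)"
      by (rule continuous_on_subset[OF c]) auto
    show "(\<lambda>X. qprod X Q) holomorphic_on ball 0 R" if "Q \<in> ball 0 \<rho>" for Q
    proof (rule holomorphic_uniform_limit[where F = sequentially])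
      show "uniform_limit (cball 0 R) (\<lambda>N X. \<Prod>n<N. 1 - Q ^ n * X) (\<lambda>X. qprod X Q) sequentially"
        by (rule uniform_limitI, rule eventually_mono[OF uniform_limitD[OF ul]])
           (use that in auto)
    qed (auto intro!: always_eventually continuous_intros holomorphic_intros)
    show "qprod X holomorphic_on ball 0 \<rho>" if "X \<in> ball 0 R" for X
    proof (rule holomorphic_uniform_limit[where F = sequentially])
      show "uniform_limit (cball 0 \<rho>) (\<lambda>N Q. \<Prod>n<N. 1 - Q ^ n * X) (qprod X) sequentially"
        by (rule uniform_limitI, rule eventually_mono[OF uniform_limitD[OF ul]])
           (use that in auto)
    qed (auto intro!: always_eventually continuous_intros holomorphic_intros)
  qed (use \<rho> in \<open>auto simp: R_def\<close>)
qed

text \<open>The constants \<open>2 \<pi> \<i>\<close> and \<open>-2 \<pi> \<i>\<close>.\<close>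
abbreviation tpi :: complex where "tpi \<equiv> 2 * of_real pi * \<i>"
abbreviation neg_tpi :: complex where "neg_tpi \<equiv> - 2 * of_real pi * \<i>"

lemma exp_2pi_i_eq_1_iff: "exp (tpi * x) = 1 \<longleftrightarrow> x \<in> \<int>" for x :: complex
proof
  assume "exp (tpi * x) = 1"
  then obtain n :: int where "tpi * x = of_int (2 * n) * of_real pi * \<i>"
    unfolding exp_eq_1 by (auto simp: complex_eq_iff mult_ac)
  hence "x = of_int n" by auto
  thus "x \<in> \<int>" by simp
next
  assume "x \<in> \<int>"
  then obtain n where "x = of_int n" by (elim Ints_cases)
  thus "exp (tpi * x) = 1"
    unfolding exp_eq_1 by (auto intro!: exI[of _ n])
qed

lemma norm_nome_less_1: "Im \<tau> > 0 \<Longrightarrow> norm (exp (tpi * \<tau>)) < 1"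
  by (simp add: norm_exp_eq_Re)

text \<open>The three families of factors converge separately.\<close>
lemma Theta_conv_qprod:
  assumes "Im \<tau> > 0"
  defines "Q \<equiv> exp (tpi * \<tau>)"
  shows "Theta \<nu> \<tau> = \<i> * exp (tpi * \<tau> / 8) * exp (- \<i> * of_real pi * \<nu>) *
           (1 - exp (tpi * \<nu>)) *
           (qprod Q Q * qprod (Q * exp (tpi * \<nu>)) Q *
            qprod (Q * exp (neg_tpi * \<nu>)) Q)"
proof -
  define y where "y = exp (tpi * \<nu>)"
  have Q: "norm Q < 1" unfolding Q_def by (rule norm_nome_less_1) fact
  note c = qprod_convergent[OF Q]
  have "(\<Prod>n. (1 - Q ^ Suc n) * (1 - Q ^ Suc n * y) * (1 - Q ^ Suc n * inverse y)) =
        (\<Prod>n. (1 - Q ^ n * Q) * (1 - Q ^ n * (Q * y)) * (1 - Q ^ n * (Q * inverse y)))"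
    by (simp add: mult_ac)
  also have "\<dots> = qprod Q Q * qprod (Q * y) Q * qprod (Q * inverse y) Q"
    unfolding qprod_def using c by (simp add: prodinf_mult convergent_prod_mult)
  finally have "Theta \<nu> \<tau> = \<i> * exp (tpi * \<tau> / 8) * exp (- \<i> * of_real pi * \<nu>) *
      (1 - y) * (qprod Q Q * qprod (Q * y) Q * qprod (Q * inverse y) Q)"
    unfolding Theta_def Let_def Q_def[symmetric] y_def[symmetric] by simp
  thus ?thesis by (simp add: y_def exp_minus)
qed

lemma exp_shift_1: "exp (tpi * (x + 1)) = exp (tpi * (x::complex))"
  by (simp add: ring_distribs exp_add)

lemma exp_pi_shift_1: "exp (- \<i> * of_real pi * (x + 1)) = - exp (- \<i> * of_real pi * (x::complex))"
  by (simp add: ring_distribs exp_add exp_minus exp_diff)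

lemma Theta_plus_1:
  assumes "Im \<tau> > 0"
  shows "Theta (\<nu> + 1) \<tau> = - Theta \<nu> \<tau>"
proof -
  have "exp (neg_tpi * (\<nu> + 1)) = exp (neg_tpi * \<nu>)"
    using exp_shift_1[of \<nu>] by (simp add: exp_minus)
  thus ?thesis
    unfolding Theta_conv_qprod[OF assms] exp_shift_1 exp_pi_shift_1 by simp
qed

lemma Theta_plus_tau:
  assumes "Im \<tau> > 0"
  shows "Theta (\<nu> + \<tau>) \<tau> = - exp (- \<i> * of_real pi * \<tau> - 2 * of_real pi * \<i> * \<nu>) * Theta \<nu> \<tau>"
proof -
  define Q where "Q = exp (tpi * \<tau>)"
  define y where "y = exp (tpi * \<nu>)"
  have Q: "norm Q < 1" unfolding Q_def by (rule norm_nome_less_1) fact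
  have nz: "Q \<noteq> 0" "y \<noteq> 0" by (simp_all add: Q_def y_def)
  have e1: "exp (tpi * (\<nu> + \<tau>)) = Q * y"
    by (simp add: Q_def y_def exp_add ring_distribs)
  have e2: "exp (neg_tpi * (\<nu> + \<tau>)) = inverse (Q * y)"
    using e1 by (simp add: exp_minus)
  have e3: "exp (neg_tpi * \<nu>) = inverse y"
    by (simp add: y_def exp_minus)
  have e4: "exp (- \<i> * of_real pi * \<tau> - 2 * of_real pi * \<i> * \<nu>) = exp (- \<i> * of_real pi * \<tau>) * inverse y"
    by (simp add: y_def exp_diff divide_inverse)
  have e5: "exp (- \<i> * of_real pi * (\<nu> + \<tau>)) = exp (- \<i> * of_real pi * \<nu>) * exp (- \<i> * of_real pi * \<tau>)"
    by (simp add: ring_distribs flip: exp_add)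
  define a where "a = qprod (Q * (Q * y)) Q"
  define b where "b = qprod (Q * inverse y) Q"
  have r1: "qprod (Q * y) Q = (1 - Q * y) * a"
    unfolding a_def by (rule qprod_rec[OF Q])
  have r2: "qprod (Q * inverse (Q * y)) Q = (1 - inverse y) * b"
    using qprod_rec[OF Q, of "inverse y"] nz by (simp add: b_def flip: mult.assoc)
  have "(1 - inverse y) = - inverse y * (1 - y)"
    using nz by (simp add: field_simps)
  thus ?thesis
    unfolding Theta_conv_qprod[OF assms] Q_def[symmetric] y_def[symmetric] e1 e2 e3 e4 e5 r2
    unfolding r1 b_def[symmetric] a_def[symmetric] by (simp add: mult_ac)
qed

lemma Theta_tau_plus_1:
  assumes "Im \<tau> > 0"
  shows "Theta \<nu> (\<tau> + 1) = exp (tpi / 8) * Theta \<nu> \<tau>"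
proof -
  have e: "exp (tpi * (\<tau> + 1) / 8) =
      exp (tpi / 8) * exp (tpi * \<tau> / 8)"
    by (simp add: add_divide_distrib ring_distribs add_ac flip: exp_add)
  have "Im (\<tau> + 1) > 0" using assms by simp
  from Theta_conv_qprod[OF this] Theta_conv_qprod[OF assms] show ?thesis
    unfolding exp_shift_1 e by (simp add: mult_ac)
qed

lemma Theta_plus_int:
  assumes "Im \<tau> > 0"
  shows "Theta (\<nu> + of_int m) \<tau> = exp (\<i> * of_real pi * of_int m) * Theta \<nu> \<tau>"
proof (induction m rule: int_induct[where k = 0])
  case (step1 i)
  have "Theta (\<nu> + of_int (i + 1)) \<tau> = Theta ((\<nu> + of_int i) + 1) \<tau>" by (simp add: add_ac)
  also have "\<dots> = - exp (\<i> * of_real pi * of_int i) * Theta \<nu> \<tau>"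
    using step1 Theta_plus_1[OF assms] by simp
  finally show ?case by (simp add: ring_distribs exp_add)
next
  case (step2 i)
  have "- Theta (\<nu> + of_int (i - 1)) \<tau> = Theta ((\<nu> + of_int (i - 1)) + 1) \<tau>"
    by (simp only: Theta_plus_1[OF assms])
  also have "\<dots> = exp (\<i> * of_real pi * of_int i) * Theta \<nu> \<tau>"
    using step2 by simp
  finally have "Theta (\<nu> + of_int (i - 1)) \<tau> = - exp (\<i> * of_real pi * of_int i) * Theta \<nu> \<tau>"
    by (metis minus_minus mult_minus_left)
  thus ?case by (simp add: ring_distribs exp_diff)
qed auto

lemma Theta_plus_int_tau:
  assumes "Im \<tau> > 0"
  shows "Theta (\<nu> + of_int k * \<tau>) \<tau> =
    exp (\<i> * of_real pi * of_int k - \<i> * of_real pi * of_int k ^ 2 * \<tau> - 2 * of_real pi * \<i> * of_int k * \<nu>) * Theta \<nu> \<tau>"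
proof (induction k rule: int_induct[where k = 0])
  case (step1 i)
  have "Theta (\<nu> + of_int (i + 1) * \<tau>) \<tau> = Theta ((\<nu> + of_int i * \<tau>) + \<tau>) \<tau>"
    by (simp add: ring_distribs add_ac)
  also have "\<dots> = exp (\<i> * of_real pi) * exp (- \<i> * of_real pi * \<tau> - 2 * of_real pi * \<i> * (\<nu> + of_int i * \<tau>)) *
      exp (\<i> * of_real pi * of_int i - \<i> * of_real pi * of_int i ^ 2 * \<tau> - 2 * of_real pi * \<i> * of_int i * \<nu>) * Theta \<nu> \<tau>"
    using step1 by (subst Theta_plus_tau[OF assms]) simp
  finally show ?case
    unfolding exp_add[symmetric] by (simp add: algebra_simps power2_eq_square)
next
  case (step2 i)
  have "Theta (\<nu> + of_int (i - 1) * \<tau>) \<tau> =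
      exp (- (\<i> * of_real pi)) * exp (\<i> * of_real pi * \<tau> + tpi * (\<nu> + of_int (i - 1) * \<tau>)) *
      (exp (\<i> * of_real pi) * exp (- \<i> * of_real pi * \<tau> - 2 * of_real pi * \<i> * (\<nu> + of_int (i - 1) * \<tau>)) *
      Theta (\<nu> + of_int (i - 1) * \<tau>) \<tau>)"
    unfolding mult.assoc[symmetric] exp_add[symmetric] by (simp add: algebra_simps)
  also have "exp (\<i> * of_real pi) * exp (- \<i> * of_real pi * \<tau> - 2 * of_real pi * \<i> * (\<nu> + of_int (i - 1) * \<tau>)) *
      Theta (\<nu> + of_int (i - 1) * \<tau>) \<tau> = Theta ((\<nu> + of_int (i - 1) * \<tau>) + \<tau>) \<tau>"
    by (subst Theta_plus_tau[OF assms]) simp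
  also have "(\<nu> + of_int (i - 1) * \<tau>) + \<tau> = \<nu> + of_int i * \<tau>"
    by (simp add: ring_distribs)
  also note step2.IH
  finally show ?case
    unfolding exp_add[symmetric] mult.assoc[symmetric] by (simp add: algebra_simps power2_eq_square)
qed auto

lemma qprod_self_nonzero:
  assumes "norm Q < 1"
  shows "qprod Q Q \<noteq> 0"
proof
  assume "qprod Q Q = 0"
  then obtain n where "Q ^ n * Q = 1" using qprod_eq_0_iff[OF assms] by blast
  hence "norm (Q ^ Suc n) = 1" by (simp add: mult.commute)
  moreover have "norm Q ^ Suc n < 1"
    using assms power_decreasing[of 1 "Suc n" "norm Q"] by simp
  ultimately show False by (simp add: norm_power norm_mult)
qed

text \<open>The lattice \<open>\<int> + \<int> \<tau>\<close> of zeros of the theta function.\<close>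
definition tau_lattice :: "complex \<Rightarrow> complex set" where
  "tau_lattice \<tau> = {of_int m + of_int k * \<tau> | m k. True}"

lemma Theta_eq_0_iff:
  assumes "Im \<tau> > 0"
  shows "Theta \<nu> \<tau> = 0 \<longleftrightarrow> \<nu> \<in> tau_lattice \<tau>"
proof -
  define Q where "Q = exp (tpi * \<tau>)"
  have Q: "norm Q < 1" unfolding Q_def by (rule norm_nome_less_1) fact
  have nz: "exp (neg_tpi * \<nu>) \<noteq> 0" "Q \<noteq> 0" by (simp_all add: Q_def)
  have pow: "Q ^ n * exp (tpi * x) = exp (tpi * (of_nat n * \<tau> + x))" for n x
    by (simp add: Q_def exp_add ring_distribs mult_ac flip: exp_of_nat_mult)
  have z1: "(\<exists>n. Q ^ n * exp (tpi * \<nu>) = 1) \<longleftrightarrow> (\<exists>n::nat. of_nat n * \<tau> + \<nu> \<in> \<int>)"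
    unfolding pow exp_2pi_i_eq_1_iff ..
  have "qprod Q Q \<noteq> 0" using Q by (rule qprod_self_nonzero)
  hence "Theta \<nu> \<tau> = 0 \<longleftrightarrow> (1 - exp (tpi * \<nu>)) * qprod (Q * exp (tpi * \<nu>)) Q = 0 \<or>
      qprod (Q * exp (neg_tpi * \<nu>)) Q = 0"
    unfolding Theta_conv_qprod[OF assms] Q_def[symmetric] by auto
  also have "\<dots> \<longleftrightarrow> (\<exists>n::nat. of_nat n * \<tau> + \<nu> \<in> \<int>) \<or> (\<exists>n::nat. of_nat (Suc n) * \<tau> - \<nu> \<in> \<int>)"
  proof -
    have "qprod (Q * exp (neg_tpi * \<nu>)) Q = 0 \<longleftrightarrow>
        (\<exists>n. Q ^ Suc n * exp (tpi * - \<nu>) = 1)"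
      unfolding qprod_eq_0_iff[OF Q] by (simp add: mult_ac)
    also have "\<dots> \<longleftrightarrow> (\<exists>n::nat. of_nat (Suc n) * \<tau> - \<nu> \<in> \<int>)"
      unfolding pow exp_2pi_i_eq_1_iff by simp
    finally show ?thesis
      unfolding qprod_rec[OF Q, symmetric] qprod_eq_0_iff[OF Q, of "exp (tpi * \<nu>)"] z1 by blast
  qed
  also have "\<dots> \<longleftrightarrow> \<nu> \<in> tau_lattice \<tau>"
  proof
    assume "(\<exists>n::nat. of_nat n * \<tau> + \<nu> \<in> \<int>) \<or> (\<exists>n::nat. of_nat (Suc n) * \<tau> - \<nu> \<in> \<int>)"
    thus "\<nu> \<in> tau_lattice \<tau>"
    proof (elim disjE exE)
      fix n :: nat assume "of_nat n * \<tau> + \<nu> \<in> \<int>"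
      then obtain m where "of_nat n * \<tau> + \<nu> = of_int m" by (elim Ints_cases)
      hence "\<nu> = of_int m + of_int (- int n) * \<tau>" by (simp add: algebra_simps)
      thus ?thesis unfolding tau_lattice_def by blast
    next
      fix n :: nat assume "of_nat (Suc n) * \<tau> - \<nu> \<in> \<int>"
      then obtain m where "of_nat (Suc n) * \<tau> - \<nu> = of_int m" by (elim Ints_cases)
      hence "\<nu> = of_int (- m) + of_int (int (Suc n)) * \<tau>" by (simp add: algebra_simps)
      thus ?thesis unfolding tau_lattice_def by blast
    qed
  next
    assume "\<nu> \<in> tau_lattice \<tau>"
    then obtain m k where mk: "\<nu> = of_int m + of_int k * \<tau>" by (auto simp: tau_lattice_def)
    show "(\<exists>n::nat. of_nat n * \<tau> + \<nu> \<in> \<int>) \<or> (\<exists>n::nat. of_nat (Suc n) * \<tau> - \<nu> \<in> \<int>)"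
    proof (cases "k \<le> 0")
      case True
      hence "of_nat (nat (- k)) * \<tau> + \<nu> = of_int m" by (simp add: mk)
      thus ?thesis by (metis Ints_of_int)
    next
      case False
      hence "of_nat (Suc (nat (k - 1))) * \<tau> - \<nu> = of_int (- m)" by (simp add: mk)
      thus ?thesis by (metis Ints_of_int)
    qed
  qed
  finally show ?thesis .
qed

text \<open>The entire function \<open>(1 - exp (2 \<pi> \<i> w)) / w\<close>; the value at 0 is the derivative of the numerator.\<close>
definition exp_quot :: "complex \<Rightarrow> complex" where
  "exp_quot w = (if w = 0 then - (tpi) else (1 - exp (tpi * w)) / w)"

lemma exp_quot_field_differentiable: "exp_quot field_differentiable at w"
proof -
  let ?g = "\<lambda>w::complex. 1 - exp (tpi * w)"
  have d: "(?g has_field_derivative - (tpi)) (at 0)"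
    by (auto intro!: derivative_eq_intros)
  have "(\<lambda>w. if w = 0 then deriv ?g 0 else (?g w - ?g 0) / (w - 0)) holomorphic_on UNIV"
    by (rule pole_lemma_open) (auto intro!: holomorphic_intros)
  also have "(\<lambda>w. if w = 0 then deriv ?g 0 else (?g w - ?g 0) / (w - 0)) = exp_quot"
    using DERIV_imp_deriv[OF d] by (auto simp: exp_quot_def fun_eq_iff)
  finally show ?thesis by (auto intro: holomorphic_on_imp_differentiable_at)
qed

text \<open>The quotient \<open>\<Theta>(\<nu>, \<tau>) / \<nu>\<close>, with the singularity at \<open>\<nu> = 0\<close> removed.\<close>
definition Theta1 :: "complex \<Rightarrow> complex \<Rightarrow> complex" where
  "Theta1 \<nu> \<tau> = (let Q = exp (tpi * \<tau>) in
     \<i> * exp (tpi * \<tau> / 8) * exp (- \<i> * of_real pi * \<nu>) * exp_quot \<nu> *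
           (qprod Q Q * qprod (Q * exp (tpi * \<nu>)) Q *
            qprod (Q * exp (neg_tpi * \<nu>)) Q))"

lemma Theta_conv_Theta1: "Im \<tau> > 0 \<Longrightarrow> Theta \<nu> \<tau> = \<nu> * Theta1 \<nu> \<tau>"
  unfolding Theta_conv_qprod Theta1_def Let_def exp_quot_def by simp

lemma Theta1_0_nonzero:
  assumes "Im \<tau> > 0"
  shows "Theta1 0 \<tau> \<noteq> 0"
proof -
  define Q where "Q = exp (tpi * \<tau>)"
  have Q: "norm Q < 1" unfolding Q_def by (rule norm_nome_less_1) fact
  have "qprod Q Q \<noteq> 0" using Q by (rule qprod_self_nonzero)
  thus ?thesis by (simp add: Theta1_def exp_quot_def Q_def Let_def)
qed

lemma holo2_qprod:
  assumes "holo2 f p" "holo2 g p" "norm (g p) < 1"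
  shows "holo2 (\<lambda>x. qprod (f x) (g x)) p"
  using holo2_compose2[OF qprod_holo2[OF assms(3)] assms(1,2)] by simp

lemma holo2_exp_quot: "holo2 f p \<Longrightarrow> holo2 (\<lambda>x. exp_quot (f x)) p"
  by (rule holo2_compose1[OF _ exp_quot_field_differentiable])

lemma holo2_Theta1 [holo2_intros]:
  assumes "holo2 f p" "holo2 g p" "Im (g p) > 0"
  shows "holo2 (\<lambda>x. Theta1 (f x) (g x)) p"
  unfolding Theta1_def Let_def
  by (intro holo2_intros holo2_qprod holo2_exp_quot assms norm_nome_less_1) auto

lemma open_upper_half_plane: "open {t. Im t > 0}"
  using open_halfspace_Im_gt[of 0] by simp

lemma eventually_Im_snd_pos:
  "Im (snd p) > 0 \<Longrightarrow> eventually (\<lambda>x. Im (snd x) > 0) (nhds (p :: complex \<times> complex))"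
  using eventually_nhds_in_open[OF open_vimage_snd[OF open_upper_half_plane], of p] by simp

lemma holo2_Theta [holo2_intros]:
  assumes "holo2 f p" "holo2 g p" "Im (g p) > 0"
  shows "holo2 (\<lambda>x. Theta (f x) (g x)) p"
proof (rule holo2_transform)
  show "holo2 (\<lambda>x. f x * Theta1 (f x) (g x)) p" by (intro holo2_intros assms)
  have "isCont (\<lambda>x. Im (g x)) p"
    using holo2_isCont[OF assms(2)] by (auto intro: continuous_intros isCont_o2)
  hence "((\<lambda>x. Im (g x)) \<longlongrightarrow> Im (g p)) (nhds p)"
    using tendsto_at_iff_tendsto_nhds[of "\<lambda>x. Im (g x)" p] by (simp add: isCont_def)
  from order_tendstoD(1)[OF this assms(3)]
  show "eventually (\<lambda>x. f x * Theta1 (f x) (g x) = Theta (f x) (g x)) (nhds p)"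
    by eventually_elim (simp add: Theta_conv_Theta1)
qed

section \<open>Modular inversion of the theta function\<close>

lemma tau_lattice_0: "0 \<in> tau_lattice \<tau>"
  by (auto simp: tau_lattice_def intro!: exI[of _ 0])

lemma tau_lattice_uminus:
  assumes "x \<in> tau_lattice \<tau>"
  shows "- x \<in> tau_lattice \<tau>"
proof -
  from assms obtain m k where "x = of_int m + of_int k * \<tau>"
    by (auto simp: tau_lattice_def)
  hence "- x = of_int (- m) + of_int (- k) * \<tau>" by simp
  thus ?thesis unfolding tau_lattice_def by blast
qed

lemma tau_lattice_add:
  assumes "x \<in> tau_lattice \<tau>" "y \<in> tau_lattice \<tau>"
  shows "x + y \<in> tau_lattice \<tau>"
proof -
  from assms obtain m k m' k' where "x = of_int m + of_int k * \<tau>" "y = of_int m' + of_int k' * \<tau>"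
    by (auto simp: tau_lattice_def)
  hence "x + y = of_int (m + m') + of_int (k + k') * \<tau>" by (simp add: algebra_simps)
  thus ?thesis unfolding tau_lattice_def by blast
qed

lemma tau_lattice_diff: "x \<in> tau_lattice \<tau> \<Longrightarrow> y \<in> tau_lattice \<tau> \<Longrightarrow> x - y \<in> tau_lattice \<tau>"
  using tau_lattice_add[OF _ tau_lattice_uminus] by simp

lemma tau_lattice_int: "of_int m \<in> tau_lattice \<tau>"
  unfolding tau_lattice_def by (rule CollectI, rule exI[of _ m], rule exI[of _ 0]) simp

lemma tau_lattice_tau: "\<tau> \<in> tau_lattice \<tau>"
  unfolding tau_lattice_def by (rule CollectI, rule exI[of _ 0], rule exI[of _ 1]) simp

lemma Theta_field_differentiable:
  assumes "Im \<tau> > 0"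
  shows "(\<lambda>w. Theta w \<tau>) field_differentiable at z"
  using holo2_slice1[OF holo2_Theta[OF holo2_fst holo2_snd, of "(z, \<tau>)"]] assms by simp

lemma Theta1_field_differentiable:
  assumes "Im \<tau> > 0"
  shows "(\<lambda>w. Theta1 w \<tau>) field_differentiable at z"
  using holo2_slice1[OF holo2_Theta1[OF holo2_fst holo2_snd, of "(z, \<tau>)"]] assms by simp

lemma eventually_nonzero_isCont:
  fixes f :: "'a :: t2_space \<Rightarrow> complex"
  assumes "isCont f x" "f x \<noteq> 0"
  shows "eventually (\<lambda>y. f y \<noteq> 0) (nhds x)"
proof -
  have "(f \<longlongrightarrow> f x) (nhds x)"
    using assms(1) tendsto_at_iff_tendsto_nhds[of f x] by (simp add: isCont_def)
  from tendsto_imp_eventually_ne[OF this assms(2)] show ?thesis .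
qed

lemma field_differentiable_transform_nhds:
  assumes "f field_differentiable at x" "eventually (\<lambda>y. f y = g y) (nhds x)"
  shows "g field_differentiable at (x :: complex)"
proof -
  from assms(1) obtain D where D: "(f has_field_derivative D) (at x)"
    by (auto simp: field_differentiable_def)
  have "(g has_field_derivative D) (at x)"
    using DERIV_cong_ev[OF refl assms(2) refl] D by simp
  thus ?thesis by (auto simp: field_differentiable_def)
qed

text \<open>The quotient \<open>g / \<Theta>\<close> is doubly periodic; it has no poles since \<open>g\<close> vanishes at the
  simple zeros of \<open>\<Theta>\<close>, so it is constant by Liouville's theorem.\<close>
lemma quasi_periodic_imp_multiple_Theta:
  assumes \<tau>: "Im \<tau> > 0" and g: "g holomorphic_on UNIV" and g0: "g 0 = 0"
    and g1: "\<And>\<nu>. g (\<nu> + 1) = - g \<nu>"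
    and g\<tau>: "\<And>\<nu>. g (\<nu> + \<tau>) = - exp (- \<i> * of_real pi * \<tau> - 2 * of_real pi * \<i> * \<nu>) * g \<nu>"
  shows "\<exists>C. \<forall>\<nu>. g \<nu> = C * Theta \<nu> \<tau>"
proof -
  define L where "L = tau_lattice \<tau>"
  define h where "h = (\<lambda>z. if z = 0 then deriv g 0 else (g z - g 0) / (z - 0))"
  have h: "h field_differentiable at z" for z
    using pole_lemma_open[OF g open_UNIV, of 0] unfolding h_def
    by (intro holomorphic_on_imp_differentiable_at[of _ UNIV]) auto
  define R where "R = (\<lambda>\<nu>. if \<nu> \<in> L then deriv g 0 / Theta1 0 \<tau> else g \<nu> / Theta \<nu> \<tau>)"
  have L1: "\<nu> + 1 \<in> L \<longleftrightarrow> \<nu> \<in> L" for \<nu>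
    using tau_lattice_add[of \<nu> \<tau> 1] tau_lattice_diff[of "\<nu> + 1" \<tau> 1] tau_lattice_int[of 1 \<tau>]
    by (auto simp: L_def)
  have L\<tau>: "\<nu> + \<tau> \<in> L \<longleftrightarrow> \<nu> \<in> L" for \<nu>
    using tau_lattice_add[of \<nu> \<tau> \<tau>] tau_lattice_diff[of "\<nu> + \<tau>" \<tau> \<tau>] tau_lattice_tau[of \<tau>]
    by (auto simp: L_def)
  have R1: "R (\<nu> + 1) = R \<nu>" for \<nu>
    by (simp add: R_def L1 g1 Theta_plus_1[OF \<tau>])
  have R\<tau>: "R (\<nu> + \<tau>) = R \<nu>" for \<nu>
    by (simp add: R_def L\<tau> g\<tau> Theta_plus_tau[OF \<tau>])
  have Rm: "R (\<nu> + of_int m) = R \<nu>" for \<nu> m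
  proof (induction m rule: int_induct[where k = 0])
    case (step1 i)
    thus ?case using R1[of "\<nu> + of_int i"] by (simp add: add_ac)
  next
    case (step2 i)
    thus ?case using R1[of "\<nu> + of_int (i - 1)"] by simp
  qed auto
  have Rk: "R (\<nu> + of_int k * \<tau>) = R \<nu>" for \<nu> k
  proof (induction k rule: int_induct[where k = 0])
    case (step1 i)
    thus ?case using R\<tau>[of "\<nu> + of_int i * \<tau>"] by (simp add: algebra_simps)
  next
    case (step2 i)
    thus ?case using R\<tau>[of "\<nu> + of_int (i - 1) * \<tau>"] by (simp add: algebra_simps)
  qed auto
  have RL: "R (\<nu> + l) = R \<nu>" if "l \<in> L" for \<nu> l
  proof -
    from that obtain m k where "l = of_int m + of_int k * \<tau>" by (auto simp: L_def tau_lattice_def)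
    thus ?thesis using Rk[of "\<nu> + of_int m" k] Rm[of \<nu> m] by (simp add: add_ac)
  qed
  \<comment> \<open>Near 0 both \<open>g\<close> and \<open>\<Theta>\<close> can be divided by the variable.\<close>
  have R0: "R field_differentiable at 0"
  proof (rule field_differentiable_transform_nhds)
    show "(\<lambda>w. h w / Theta1 w \<tau>) field_differentiable at 0"
      by (intro field_differentiable_divide h Theta1_field_differentiable \<tau> Theta1_0_nonzero)
    have "eventually (\<lambda>w. Theta1 w \<tau> \<noteq> 0) (nhds 0)"
      by (intro eventually_nonzero_isCont field_differentiable_imp_continuous_at
          Theta1_field_differentiable Theta1_0_nonzero \<tau>)
    thus "eventually (\<lambda>w. h w / Theta1 w \<tau> = R w) (nhds 0)"
    proof eventually_elim
      case (elim w)
      show ?case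
      proof (cases "w = 0")
        case True
        thus ?thesis by (simp add: R_def h_def L_def tau_lattice_0)
      next
        case False
        hence "Theta w \<tau> \<noteq> 0" using elim Theta_conv_Theta1[OF \<tau>] by simp
        hence "w \<notin> L" using Theta_eq_0_iff[OF \<tau>] by (auto simp: L_def)
        thus ?thesis using False by (simp add: R_def h_def g0 Theta_conv_Theta1[OF \<tau>])
      qed
    qed
  qed
  have "R field_differentiable at \<nu>" for \<nu>
  proof (cases "\<nu> \<in> L")
    case True
    have "(R \<circ> (\<lambda>w. w - \<nu>)) field_differentiable at \<nu>"
      using R0 by (intro field_differentiable_compose derivative_intros) auto
    moreover have "R \<circ> (\<lambda>w. w - \<nu>) = R"
      using RL[OF tau_lattice_uminus[of \<nu> \<tau>, folded L_def, OF True]] by (auto simp: fun_eq_iff)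
    ultimately show ?thesis by simp
  next
    case False
    hence nz: "Theta \<nu> \<tau> \<noteq> 0" using Theta_eq_0_iff[OF \<tau>] by (auto simp: L_def)
    show ?thesis
    proof (rule field_differentiable_transform_nhds)
      show "(\<lambda>w. g w / Theta w \<tau>) field_differentiable at \<nu>"
        using g by (intro field_differentiable_divide Theta_field_differentiable \<tau> nz
            holomorphic_on_imp_differentiable_at[of _ UNIV]) auto
      have "eventually (\<lambda>w. Theta w \<tau> \<noteq> 0) (nhds \<nu>)"
        by (intro eventually_nonzero_isCont field_differentiable_imp_continuous_at
            Theta_field_differentiable nz \<tau>)
      thus "eventually (\<lambda>w. g w / Theta w \<tau> = R w) (nhds \<nu>)"
        by eventually_elim (auto simp: R_def Theta_eq_0_iff[OF \<tau>] L_def)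
    qed
  qed
  hence Rhol: "R holomorphic_on UNIV"
    by (auto simp: holomorphic_on_def field_differentiable_at_within)
  define K where "K = (\<lambda>(x, y). of_real x + of_real y * \<tau>) ` ({0..1} \<times> {0..1::real})"
  have "compact K" unfolding K_def case_prod_unfold
    by (intro compact_continuous_image continuous_intros compact_Times compact_Icc)
  hence "compact (R ` K)"
    by (intro compact_continuous_image continuous_on_subset[OF holomorphic_on_imp_continuous_on[OF Rhol]]) auto
  hence "bounded (R ` K)" by (rule compact_imp_bounded)
  moreover have "range R \<subseteq> R ` K"
  proof safe
    fix \<nu>
    define y where "y = Im \<nu> / Im \<tau>"
    define x where "x = Re \<nu> - y * Re \<tau>"
    have "\<nu> = of_real x + of_real y * \<tau>"
      using \<tau> by (simp add: complex_eq_iff x_def y_def)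
    hence eq: "\<nu> = (of_real (frac x) + of_real (frac y) * \<tau>) + (of_int \<lfloor>x\<rfloor> + of_int \<lfloor>y\<rfloor> * \<tau>)"
      by (simp add: frac_def algebra_simps)
    have "of_int \<lfloor>x\<rfloor> + of_int \<lfloor>y\<rfloor> * \<tau> \<in> L" by (auto simp: L_def tau_lattice_def)
    hence "R \<nu> = R (of_real (frac x) + of_real (frac y) * \<tau>)"
      by (subst eq) (rule RL)
    moreover have "of_real (frac x) + of_real (frac y) * \<tau> \<in> K"
      unfolding K_def by (rule image_eqI[of _ _ "(frac x, frac y)"])
        (auto simp: frac_lt_1 less_imp_le)
    ultimately show "R \<nu> \<in> R ` K" by blast
  qed
  ultimately have "bounded (range R)" by (rule bounded_subset)
  from Liouville_theorem[OF Rhol this] have "R constant_on UNIV" .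
  then obtain C where C: "\<And>\<nu>. R \<nu> = C" by (auto simp: constant_on_def)
  have gL: "g \<nu> = 0" if "\<nu> \<in> L" for \<nu>
  proof -
    have gm: "g (of_int m) = 0" for m
    proof (induction m rule: int_induct[where k = 0])
      case (step1 i)
      thus ?case using g1[of "of_int i"] by simp
    next
      case (step2 i)
      thus ?case using g1[of "of_int (i - 1)"] by simp
    qed (simp add: g0)
    have "g (of_int m + of_int k * \<tau>) = 0" for m k
    proof (induction k rule: int_induct[where k = 0])
      case (step1 i)
      thus ?case using g\<tau>[of "of_int m + of_int i * \<tau>"] by (simp add: algebra_simps)
    next
      case (step2 i)
      thus ?case using g\<tau>[of "of_int m + of_int (i - 1) * \<tau>"] by (simp add: algebra_simps)
    qed (simp add: gm)
    thus ?thesis using that by (auto simp: L_def tau_lattice_def)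
  qed
  have "g \<nu> = C * Theta \<nu> \<tau>" for \<nu>
  proof (cases "\<nu> \<in> L")
    case True
    thus ?thesis using gL Theta_eq_0_iff[OF \<tau>] by (simp add: L_def)
  next
    case False
    thus ?thesis using C[of \<nu>] Theta_eq_0_iff[OF \<tau>] by (auto simp: R_def L_def field_simps)
  qed
  thus ?thesis by blast
qed

lemma Im_neg_inverse_pos: "Im \<tau> > 0 \<Longrightarrow> Im (- 1 / \<tau>) > 0"
  using Im_complex_div_lt_0[of 1 \<tau>] by simp

text \<open>The constant is \<open>-\<i> sqrt (-\<i> \<tau>)\<close>, but only its independence of \<open>\<nu>\<close> is of importance below.\<close>
lemma Theta_inversion:
  assumes \<tau>: "Im \<tau> > 0"
  shows "\<exists>C. C \<noteq> 0 \<and> (\<forall>\<nu>. Theta (\<nu> / \<tau>) (- 1 / \<tau>) = C * exp (\<i> * of_real pi * \<nu>\<^sup>2 / \<tau>) * Theta \<nu> \<tau>)"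
proof -
  define \<sigma> where "\<sigma> = - 1 / \<tau>"
  have \<sigma>: "Im \<sigma> > 0" unfolding \<sigma>_def by (rule Im_neg_inverse_pos[OF \<tau>])
  have nz: "\<tau> \<noteq> 0" using \<tau> by auto
  define g where "g = (\<lambda>\<nu>. Theta (\<nu> / \<tau>) \<sigma> * exp (- \<i> * of_real pi * \<nu>\<^sup>2 / \<tau>))"
  have "\<exists>C. \<forall>\<nu>. g \<nu> = C * Theta \<nu> \<tau>"
  proof (rule quasi_periodic_imp_multiple_Theta[OF \<tau>])
    have "(\<lambda>w. Theta w \<sigma>) holomorphic_on UNIV"
      using Theta_field_differentiable[OF \<sigma>] by (auto simp: holomorphic_on_def field_differentiable_at_within)
    moreover have "(\<lambda>\<nu>. \<nu> / \<tau>) holomorphic_on UNIV"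
      by (intro holomorphic_intros) (use nz in auto)
    ultimately have "(\<lambda>\<nu>. Theta (\<nu> / \<tau>) \<sigma>) holomorphic_on UNIV"
      using holomorphic_on_compose_gen[of "\<lambda>\<nu>. \<nu> / \<tau>" UNIV "\<lambda>w. Theta w \<sigma>" UNIV] by (simp add: o_def)
    thus "g holomorphic_on UNIV" unfolding g_def by (intro holomorphic_intros) (use nz in auto)
    show "g 0 = 0" using Theta_eq_0_iff[OF \<sigma>, of 0] tau_lattice_0 by (simp add: g_def)
    fix \<nu> :: complex
    have "Theta (\<nu> / \<tau>) \<sigma> = - exp (- \<i> * of_real pi * \<sigma> - 2 * of_real pi * \<i> * ((\<nu> + 1) / \<tau>)) * Theta ((\<nu> + 1) / \<tau>) \<sigma>"
      using Theta_plus_tau[OF \<sigma>, of "(\<nu> + 1) / \<tau>"] by (simp add: \<sigma>_def add_divide_distrib)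
    hence "- g \<nu> = exp (- \<i> * of_real pi * \<sigma> - 2 * of_real pi * \<i> * ((\<nu> + 1) / \<tau>) - \<i> * of_real pi * \<nu>\<^sup>2 / \<tau>) * Theta ((\<nu> + 1) / \<tau>) \<sigma>"
      by (simp add: g_def exp_diff exp_minus divide_inverse mult_ac)
    also have "- \<i> * of_real pi * \<sigma> - 2 * of_real pi * \<i> * ((\<nu> + 1) / \<tau>) - \<i> * of_real pi * \<nu>\<^sup>2 / \<tau> =
        - \<i> * of_real pi * (\<nu> + 1)\<^sup>2 / \<tau>"
      using nz by (simp add: \<sigma>_def field_simps power2_eq_square)
    finally show "g (\<nu> + 1) = - g \<nu>" by (simp add: g_def)
    have "g (\<nu> + \<tau>) = - Theta (\<nu> / \<tau>) \<sigma> * exp (- \<i> * of_real pi * (\<nu> + \<tau>)\<^sup>2 / \<tau>)"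
      using Theta_plus_1[OF \<sigma>, of "\<nu> / \<tau>"] nz by (simp add: g_def add_divide_distrib)
    also have "- \<i> * of_real pi * (\<nu> + \<tau>)\<^sup>2 / \<tau> =
        (- \<i> * of_real pi * \<tau> - 2 * of_real pi * \<i> * \<nu>) + (- \<i> * of_real pi * \<nu>\<^sup>2 / \<tau>)"
      using nz by (simp add: field_simps power2_eq_square)
    finally show "g (\<nu> + \<tau>) = - exp (- \<i> * of_real pi * \<tau> - 2 * of_real pi * \<i> * \<nu>) * g \<nu>"
      unfolding exp_add by (simp add: g_def)
  qed
  then obtain C where C: "\<And>\<nu>. g \<nu> = C * Theta \<nu> \<tau>" by blast
  have eq: "Theta (\<nu> / \<tau>) \<sigma> = C * exp (\<i> * of_real pi * \<nu>\<^sup>2 / \<tau>) * Theta \<nu> \<tau>" for \<nu>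
    using C[of \<nu>] by (simp add: g_def exp_minus field_simps)
  \<comment> \<open>Otherwise \<open>\<Theta>(\<sqdot>, \<sigma>)\<close> would vanish identically, in particular at the non-lattice point 1/2.\<close>
  have "C \<noteq> 0"
  proof
    assume "C = 0"
    hence "Theta (1/2) \<sigma> = 0" using eq[of "\<tau> / 2"] nz by simp
    then obtain m k where mk: "1/2 = of_int m + of_int k * \<sigma>"
      using Theta_eq_0_iff[OF \<sigma>] by (auto simp: tau_lattice_def)
    hence "Im (1/2) = Im (of_int m + of_int k * \<sigma>)" by metis
    hence "k = 0" using \<sigma> by simp
    hence "(1/2 :: complex) = of_int m" using mk by simp
    hence "(1/2 :: real) = of_int m" by (simp add: complex_eq_iff)
    hence "real_of_int (2 * m) = real_of_int 1" by simp
    hence "2 * m = 1" by (simp only: of_int_eq_iff)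
    thus False by presburger
  qed
  thus ?thesis using eq unfolding \<sigma>_def by blast
qed


section \<open>The factors of the summands and their transformation laws\<close>

text \<open>One factor of a summand of the elliptic genus: \<open>\<kappa>\<close> is the weight \<open>q\<^sub>j\<close>, and \<open>a\<close>, \<open>b\<close> are the
  angles \<open>\<theta>\<^sub>j(n)\<close>, \<open>\<theta>\<^sub>j(n\<^sub>1)\<close>. The laws below hold at the zeros of the denominator too: both
  sides are then 0, as the denominators differ by a nonvanishing factor.\<close>
definition ell_factor :: "real \<Rightarrow> real \<Rightarrow> real \<Rightarrow> complex \<Rightarrow> complex \<Rightarrow> complex" where
  "ell_factor \<kappa> a b z \<tau> = exp (neg_tpi * z * of_real a) *
     (Theta ((1 - of_real \<kappa>) * z - of_real a * \<tau> - of_real b) \<tau> /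
      Theta (of_real \<kappa> * z + of_real a * \<tau> + of_real b) \<tau>)"

lemma exp_int_2pi_i: "exp (tpi * of_int k) = 1"
  by (simp add: exp_2pi_i_eq_1_iff)

lemma ell_factor_shift:
  assumes \<tau>: "Im \<tau> > 0"
  shows "ell_factor \<kappa> (a + of_int k) (b + of_int m) z \<tau> = ell_factor \<kappa> a b z \<tau>"
proof -
  define \<nu> where "\<nu> = of_real \<kappa> * z + of_real a * \<tau> + of_real b"
  define \<mu> where "\<mu> = (1 - of_real \<kappa>) * z - of_real a * \<tau> - of_real b"
  have \<mu>\<nu>: "\<mu> = z - \<nu>" by (simp add: \<mu>_def \<nu>_def algebra_simps)
  have 1: "Theta (of_real \<kappa> * z + of_real (a + of_int k) * \<tau> + of_real (b + of_int m)) \<tau> =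
    exp (\<i> * of_real pi * of_int k - \<i> * of_real pi * of_int k ^ 2 * \<tau> - 2 * of_real pi * \<i> * of_int k * \<nu>) *
    exp (\<i> * of_real pi * of_int m) * Theta \<nu> \<tau>"
  proof -
    have "of_real \<kappa> * z + of_real (a + of_int k) * \<tau> + of_real (b + of_int m) = (\<nu> + of_int k * \<tau>) + of_int m"
      by (simp add: \<nu>_def algebra_simps)
    thus ?thesis by (simp only: Theta_plus_int[OF \<tau>] Theta_plus_int_tau[OF \<tau>]) (simp add: mult_ac)
  qed
  have 2: "Theta ((1 - of_real \<kappa>) * z - of_real (a + of_int k) * \<tau> - of_real (b + of_int m)) \<tau> =
    exp (- \<i> * of_real pi * of_int k - \<i> * of_real pi * of_int k ^ 2 * \<tau> + tpi * of_int k * \<mu>) *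
    exp (- \<i> * of_real pi * of_int m) * Theta \<mu> \<tau>"
  proof -
    have "(1 - of_real \<kappa>) * z - of_real (a + of_int k) * \<tau> - of_real (b + of_int m) =
        (\<mu> + of_int (-k) * \<tau>) + of_int (-m)"
      by (simp add: \<mu>_def algebra_simps)
    hence "Theta ((1 - of_real \<kappa>) * z - of_real (a + of_int k) * \<tau> - of_real (b + of_int m)) \<tau> =
      exp (\<i> * of_real pi * of_int (-m)) * (exp (\<i> * of_real pi * of_int (-k) - \<i> * of_real pi * of_int (-k) ^ 2 * \<tau> - 2 * of_real pi * \<i> * of_int (-k) * \<mu>) * Theta \<mu> \<tau>)"
      by (simp only: Theta_plus_int[OF \<tau>] Theta_plus_int_tau[OF \<tau>])
    thus ?thesis by (simp add: mult_ac)
  qed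
  have 3: "exp (neg_tpi * z * of_real (a + of_int k)) =
      exp (neg_tpi * z * of_real a) * exp (neg_tpi * z * of_int k)"
    by (simp add: ring_distribs flip: exp_add)
  define e1 where "e1 = - 2 * of_real pi * \<i> * z * of_int k"
  define e2 where "e2 = - \<i> * of_real pi * of_int k - \<i> * of_real pi * of_int k ^ 2 * \<tau> + tpi * of_int k * \<mu>"
  define e3 where "e3 = - \<i> * of_real pi * of_int m"
  define e4 where "e4 = \<i> * of_real pi * of_int k - \<i> * of_real pi * of_int k ^ 2 * \<tau> - 2 * of_real pi * \<i> * of_int k * \<nu>"
  define e5 where "e5 = \<i> * of_real pi * of_int m"
  have "ell_factor \<kappa> (a + of_int k) (b + of_int m) z \<tau> =
     exp (neg_tpi * z * of_real a) * exp e1 * ((exp e2 * exp e3 * Theta \<mu> \<tau>) / (exp e4 * exp e5 * Theta \<nu> \<tau>))"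
    unfolding ell_factor_def 1 2 3 e1_def e2_def e3_def e4_def e5_def ..
  also have "\<dots> = exp (neg_tpi * z * of_real a) * (Theta \<mu> \<tau> / Theta \<nu> \<tau>) * exp (e1 + e2 + e3 - e4 - e5)"
    by (simp add: exp_add exp_diff mult_ac)
  also have "e1 + e2 + e3 - e4 - e5 = tpi * of_int (- k - m)"
    by (simp add: e1_def e2_def e3_def e4_def e5_def \<mu>\<nu> algebra_simps)
  finally show ?thesis
    unfolding exp_int_2pi_i by (simp add: ell_factor_def \<mu>_def \<nu>_def)
qed

lemma ell_factor_cong:
  assumes \<tau>: "Im \<tau> > 0" and "a - a' \<in> \<int>" "b - b' \<in> \<int>"
  shows "ell_factor \<kappa> a b z \<tau> = ell_factor \<kappa> a' b' z \<tau>"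
proof -
  from assms(2,3) obtain k m where "a - a' = of_int k" "b - b' = of_int m"
    by (auto elim!: Ints_cases)
  hence "a = a' + of_int k" "b = b' + of_int m" by (simp_all add: algebra_simps)
  thus ?thesis using ell_factor_shift[OF \<tau>] by simp
qed

lemma ell_factor_z_plus_1:
  assumes \<tau>: "Im \<tau> > 0"
  shows "ell_factor \<kappa> a b (z + 1) \<tau> = - exp (neg_tpi * of_real a) * ell_factor \<kappa> a (b + \<kappa>) z \<tau>"
proof -
  have 1: "of_real \<kappa> * (z + 1) + of_real a * \<tau> + of_real b = of_real \<kappa> * z + of_real a * \<tau> + of_real (b + \<kappa>)"
    by (simp add: algebra_simps)
  have 2: "(1 - of_real \<kappa>) * (z + 1) - of_real a * \<tau> - of_real b = ((1 - of_real \<kappa>) * z - of_real a * \<tau> - of_real (b + \<kappa>)) + 1"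
    by (simp add: algebra_simps)
  have 3: "exp (neg_tpi * (z + 1) * of_real a) = exp (neg_tpi * z * of_real a) * exp (neg_tpi * of_real a)"
    by (simp add: ring_distribs flip: exp_add)
  show ?thesis unfolding ell_factor_def 1 2 3 Theta_plus_1[OF \<tau>] by simp
qed

lemma ell_factor_z_plus_tau:
  assumes \<tau>: "Im \<tau> > 0"
  shows "ell_factor \<kappa> a b (z + \<tau>) \<tau> = - exp (- \<i> * of_real pi * (\<tau> + 2 * z) * of_real (1 - 2 * \<kappa>)) *
    exp (tpi * of_real b) * ell_factor \<kappa> (a + \<kappa>) b z \<tau>"
proof -
  define \<mu> where "\<mu> = (1 - of_real \<kappa>) * z - of_real (a + \<kappa>) * \<tau> - of_real b"
  have 1: "of_real \<kappa> * (z + \<tau>) + of_real a * \<tau> + of_real b = of_real \<kappa> * z + of_real (a + \<kappa>) * \<tau> + of_real b"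
    by (simp add: algebra_simps)
  have 2: "(1 - of_real \<kappa>) * (z + \<tau>) - of_real a * \<tau> - of_real b = \<mu> + \<tau>"
    by (simp add: algebra_simps \<mu>_def)
  have 3: "exp (neg_tpi * (z + \<tau>) * of_real a) * exp (- \<i> * of_real pi * \<tau> - 2 * of_real pi * \<i> * \<mu>) =
     exp (- \<i> * of_real pi * (\<tau> + 2 * z) * of_real (1 - 2 * \<kappa>)) * exp (tpi * of_real b) * exp (neg_tpi * z * of_real (a + \<kappa>))"
    unfolding exp_add[symmetric] by (simp add: algebra_simps \<mu>_def)
  have "ell_factor \<kappa> a b (z + \<tau>) \<tau> = - (exp (neg_tpi * (z + \<tau>) * of_real a) * exp (- \<i> * of_real pi * \<tau> - 2 * of_real pi * \<i> * \<mu>)) *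
     (Theta \<mu> \<tau> / Theta (of_real \<kappa> * z + of_real (a + \<kappa>) * \<tau> + of_real b) \<tau>)"
    unfolding ell_factor_def 1 2 Theta_plus_tau[OF \<tau>] by simp
  also note 3
  finally show ?thesis by (simp add: ell_factor_def \<mu>_def)
qed

lemma ell_factor_tau_plus_1:
  assumes \<tau>: "Im \<tau> > 0"
  shows "ell_factor \<kappa> a b z (\<tau> + 1) = ell_factor \<kappa> a (a + b) z \<tau>"
proof -
  have 1: "of_real \<kappa> * z + of_real a * (\<tau> + 1) + of_real b = of_real \<kappa> * z + of_real a * \<tau> + of_real (a + b)"
    by (simp add: algebra_simps)
  have 2: "(1 - of_real \<kappa>) * z - of_real a * (\<tau> + 1) - of_real b = (1 - of_real \<kappa>) * z - of_real a * \<tau> - of_real (a + b)"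
    by (simp add: algebra_simps)
  show ?thesis unfolding ell_factor_def 1 2 Theta_tau_plus_1[OF \<tau>] by simp
qed

lemma ell_factor_inversion:
  assumes \<tau>: "Im \<tau> > 0"
  shows "ell_factor \<kappa> a b (z / \<tau>) (- 1 / \<tau>) = exp (\<i> * of_real pi * z\<^sup>2 / \<tau> * of_real (1 - 2 * \<kappa>)) * ell_factor \<kappa> b (- a) z \<tau>"
proof -
  have nz: "\<tau> \<noteq> 0" using \<tau> by auto
  define \<nu> where "\<nu> = of_real \<kappa> * z + of_real b * \<tau> + of_real (- a)"
  define \<mu> where "\<mu> = (1 - of_real \<kappa>) * z - of_real b * \<tau> - of_real (- a)"
  from Theta_inversion[OF \<tau>] obtain C where C: "C \<noteq> 0"
    "\<And>\<nu>. Theta (\<nu> / \<tau>) (- 1 / \<tau>) = C * exp (\<i> * of_real pi * \<nu>\<^sup>2 / \<tau>) * Theta \<nu> \<tau>" by blast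
  have 1: "of_real \<kappa> * (z / \<tau>) + of_real a * (- 1 / \<tau>) + of_real b = \<nu> / \<tau>"
    using nz by (simp add: \<nu>_def field_simps)
  have 2: "(1 - of_real \<kappa>) * (z / \<tau>) - of_real a * (- 1 / \<tau>) - of_real b = \<mu> / \<tau>"
    using nz by (simp add: \<mu>_def field_simps)
  have 3: "neg_tpi * (z / \<tau>) * of_real a + \<i> * of_real pi * \<mu>\<^sup>2 / \<tau> - \<i> * of_real pi * \<nu>\<^sup>2 / \<tau> =
      \<i> * of_real pi * z\<^sup>2 / \<tau> * of_real (1 - 2 * \<kappa>) + (neg_tpi * z * of_real b)"
    using nz by (simp add: \<mu>_def \<nu>_def field_simps power2_eq_square)
  have "ell_factor \<kappa> a b (z / \<tau>) (- 1 / \<tau>) =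
     exp (neg_tpi * (z / \<tau>) * of_real a + \<i> * of_real pi * \<mu>\<^sup>2 / \<tau> - \<i> * of_real pi * \<nu>\<^sup>2 / \<tau>) * (Theta \<mu> \<tau> / Theta \<nu> \<tau>)"
    unfolding ell_factor_def 1 2 C(2) using C(1) by (simp add: exp_diff exp_add exp_minus divide_inverse mult_ac)
  thus ?thesis unfolding 3 exp_add by (simp add: ell_factor_def \<mu>_def \<nu>_def)
qed

section \<open>Pointers in nondegenerate invertible polynomials\<close>

text \<open>The \<open>i\<close>-th monomial is \<open>x\<^sub>k\<close>, with \<open>k\<close> outside \<open>T\<close>, times a monomial in the variables
  of \<open>T\<close>.\<close>
definition pointing_row :: "nat^'n^'n \<Rightarrow> 'n set \<Rightarrow> 'n \<Rightarrow> 'n \<Rightarrow> bool" where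
  "pointing_row A T k i \<longleftrightarrow> k \<notin> T \<and> A $ i $ k = 1 \<and> (\<forall>j. j \<notin> T \<longrightarrow> j \<noteq> k \<longrightarrow> A $ i $ j = 0)"

lemma pointing_row_unique: "pointing_row A T k i \<Longrightarrow> pointing_row A T l i \<Longrightarrow> k = l"
  unfolding pointing_row_def by (metis zero_neq_one)

lemma ex_nonzero_sum_zero:
  assumes "finite R" "\<not> (\<exists>!i. i \<in> R)"
  shows "\<exists>c :: 'a \<Rightarrow> complex. (\<forall>i. c i \<noteq> 0) \<and> (\<Sum>i\<in>R. c i) = 0"
proof (cases "R = {}")
  case True
  thus ?thesis by (intro exI[of _ "\<lambda>_. 1"]) auto
next
  case False
  then obtain s where s: "s \<in> R" by blast
  with assms(2) have ne: "R - {s} \<noteq> {}" by blast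
  define c where "c = (\<lambda>i. if i = s then - of_nat (card (R - {s})) else 1 :: complex)"
  have "(\<Sum>i\<in>R. c i) = c s + (\<Sum>i\<in>R - {s}. c i)"
    using s assms(1) by (simp add: sum.remove)
  also have "(\<Sum>i\<in>R - {s}. c i) = (\<Sum>i\<in>R - {s}. 1)"
    by (intro sum.cong) (auto simp: c_def)
  finally have "(\<Sum>i\<in>R. c i) = 0" by (simp add: c_def)
  moreover have "c i \<noteq> 0" for i
    using ne assms(1) by (auto simp: c_def card_gt_0_iff)
  ultimately show ?thesis by blast
qed

text \<open>On the torus the monomials take arbitrary nonzero values: take logarithms and invert the
  exponent matrix.\<close>
lemma solve_monomial_equations:
  fixes A :: "nat^'n^'n" and y :: "'n \<Rightarrow> complex"
  assumes inv: "invertible (\<chi> i j. of_nat (A $ i $ j) :: rat^'n^'n)" and y: "\<And>i. y i \<noteq> 0"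
  shows "\<exists>x. (\<forall>j. x j \<noteq> 0) \<and> (\<forall>i. (\<Prod>j\<in>UNIV. x j ^ (A $ i $ j)) = y i)"
proof -
  define M where "M = (\<chi> i j. of_nat (A $ i $ j) :: rat^'n^'n)"
  from inv obtain B where "M ** B = mat 1"
    by (auto simp: invertible_def M_def)
  hence MB: "(\<Sum>j\<in>UNIV. M $ i $ j * B $ j $ k) = (if i = k then 1 else 0)" for i k
    by (simp add: matrix_matrix_mult_def mat_def vec_eq_iff)
  define \<xi> where "\<xi> = (\<lambda>j. \<Sum>k\<in>UNIV. of_rat (B $ j $ k) * Ln (y k))"
  have "(\<Prod>j\<in>UNIV. exp (\<xi> j) ^ (A $ i $ j)) = y i" for i
  proof -
    have "(\<Prod>j\<in>UNIV. exp (\<xi> j) ^ (A $ i $ j)) = exp (\<Sum>j\<in>UNIV. of_nat (A $ i $ j) * \<xi> j)"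
      by (simp add: exp_sum exp_of_nat_mult)
    also have "(\<Sum>j\<in>UNIV. of_nat (A $ i $ j) * \<xi> j) =
        (\<Sum>j\<in>UNIV. \<Sum>k\<in>UNIV. of_rat (M $ i $ j * B $ j $ k) * Ln (y k))"
      by (simp add: \<xi>_def sum_distrib_left M_def of_rat_mult mult.assoc)
    also have "\<dots> = (\<Sum>k\<in>UNIV. of_rat (\<Sum>j\<in>UNIV. M $ i $ j * B $ j $ k) * Ln (y k))"
      by (subst sum.swap) (simp add: of_rat_sum sum_distrib_right)
    also have "\<dots> = (\<Sum>k\<in>UNIV. if i = k then Ln (y k) else 0)"
      unfolding MB by (intro sum.cong) auto
    also have "\<dots> = Ln (y i)" by simp
    finally show ?thesis using y by simp
  qed
  thus ?thesis by (intro exI[of _ "\<lambda>j. exp (\<xi> j)"]) auto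
qed

lemma partial_deriv_W_poly:
  fixes A :: "nat^'n^'n"
  shows "partial_deriv l (W_poly A) x =
    (\<Sum>i\<in>UNIV. of_nat (A $ i $ l) * (x $ l) ^ (A $ i $ l - 1) * (\<Prod>k\<in>UNIV - {l}. (x $ k) ^ (A $ i $ k)))"
proof -
  have eq: "W_poly A (\<chi> k. if k = l then t else x $ k) =
      (\<Sum>i\<in>UNIV. t ^ (A $ i $ l) * (\<Prod>k\<in>UNIV - {l}. (x $ k) ^ (A $ i $ k)))" for t
  proof -
    have "(\<Prod>j\<in>UNIV. ((\<chi> k. if k = l then t else x $ k) $ j) ^ (A $ i $ j)) =
        t ^ (A $ i $ l) * (\<Prod>k\<in>UNIV - {l}. (x $ k) ^ (A $ i $ k))" for i
    proof -
      have "(\<Prod>k\<in>UNIV - {l}. ((\<chi> k. if k = l then t else x $ k) $ k) ^ (A $ i $ k)) =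
          (\<Prod>k\<in>UNIV - {l}. (x $ k) ^ (A $ i $ k))"
        by (intro prod.cong) auto
      thus ?thesis by (subst prod.remove[of _ l]) auto
    qed
    thus ?thesis unfolding W_poly_def by simp
  qed
  show ?thesis
    unfolding partial_deriv_def eq
    by (rule DERIV_imp_deriv) (auto intro!: derivative_eq_intros sum.cong simp: mult_ac)
qed

text \<open>If each \<open>k\<close> had no or at least two monomials \<open>x\<^sub>k m(x\<^sub>T)\<close>, then the values of the \<open>m(x\<^sub>T)\<close> could be
  chosen nonzero with sum 0 for each \<open>k\<close>. The corresponding point with support \<open>T\<close> is a singular
  point of the hypersurface \<open>W = 0\<close>.\<close>
lemma ex_unique_pointing_row:
  fixes A :: "nat^'n^'n"
  assumes inv: "invertible (\<chi> i j. of_nat (A $ i $ j) :: rat^'n^'n)"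
    and nondeg: "nondegenerate A"
    and T: "T \<noteq> {}" and noT: "\<And>i. \<exists>j. j \<notin> T \<and> A $ i $ j \<noteq> 0"
  shows "\<exists>k. \<exists>!i. pointing_row A T k i"
proof (rule ccontr)
  assume contra: "\<not> ?thesis"
  have "\<exists>c :: 'n \<Rightarrow> complex. (\<forall>i. c i \<noteq> 0) \<and> (\<Sum>i\<in>{i. pointing_row A T k i}. c i) = 0" for k
    by (rule ex_nonzero_sum_zero) (use contra in auto)
  then obtain c :: "'n \<Rightarrow> 'n \<Rightarrow> complex" where c: "\<And>k i. c k i \<noteq> 0"
    "\<And>k. (\<Sum>i\<in>{i. pointing_row A T k i}. c k i) = 0"
    by metis
  \<comment> \<open>A row points to at most one \<open>k\<close>; for a row that points to none, any nonzero value would do.\<close>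
  define y where "y = (\<lambda>i. c (THE k. pointing_row A T k i) i)"
  have y: "y i = c k i" if "pointing_row A T k i" for k i
    using pointing_row_unique[OF that] that unfolding y_def by (metis the_equality)
  obtain x where x: "\<And>j. x j \<noteq> 0" "\<And>i. (\<Prod>j\<in>UNIV. x j ^ (A $ i $ j)) = y i"
    using solve_monomial_equations[OF inv, of y] c(1) by (auto simp: y_def)
  define x' where "x' = (\<chi> j. if j \<in> T then x j else 0)"
  from T obtain j0 where "j0 \<in> T" by blast
  hence "x' $ j0 \<noteq> 0" using x(1) by (simp add: x'_def)
  hence "x' \<noteq> 0" by (metis zero_index)
  moreover have "W_poly A x' = 0"
    unfolding W_poly_def
  proof (intro sum.neutral ballI)
    fix i
    obtain j where "j \<notin> T" "A $ i $ j \<noteq> 0" using noT by blast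
    hence "(x' $ j) ^ (A $ i $ j) = 0" by (simp add: x'_def)
    thus "(\<Prod>j\<in>UNIV. (x' $ j) ^ (A $ i $ j)) = 0" by (meson UNIV_I finite prod_zero)
  qed
  ultimately obtain l where l: "partial_deriv l (W_poly A) x' \<noteq> 0"
    using nondeg by (auto simp: nondegenerate_def)
  define p where "p = (\<lambda>i. \<Prod>k\<in>UNIV - {l}. (x' $ k) ^ (A $ i $ k))"
  have p0: "p i = 0" if "j \<notin> T" "j \<noteq> l" "A $ i $ j \<noteq> 0" for i j
  proof -
    have "(x' $ j) ^ (A $ i $ j) = 0" using that by (simp add: x'_def)
    thus ?thesis unfolding p_def by (intro prod_zero) (use that in auto)
  qed
  have pd: "partial_deriv l (W_poly A) x' = (\<Sum>i\<in>UNIV. of_nat (A $ i $ l) * (x' $ l) ^ (A $ i $ l - 1) * p i)"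
    unfolding partial_deriv_W_poly p_def ..
  have lT: "l \<notin> T"
  proof
    assume "l \<in> T"
    have "p i = 0" for i
    proof -
      obtain j where "j \<notin> T" "A $ i $ j \<noteq> 0" using noT by blast
      thus ?thesis using p0[of j i] \<open>l \<in> T\<close> by blast
    qed
    thus False using l pd by simp
  qed
  have "of_nat (A $ i $ l) * (x' $ l) ^ (A $ i $ l - 1) * p i =
      (if pointing_row A T l i then c l i / x l else 0)" for i
  proof (cases "pointing_row A T l i")
    case True
    hence A1: "A $ i $ l = 1" and A0: "\<And>j. j \<notin> T \<Longrightarrow> j \<noteq> l \<Longrightarrow> A $ i $ j = 0"
      by (auto simp: pointing_row_def)
    have "(\<Prod>j\<in>UNIV. x j ^ (A $ i $ j)) = x l ^ (A $ i $ l) * (\<Prod>k\<in>UNIV - {l}. x k ^ (A $ i $ k))"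
      by (rule prod.remove) auto
    also have "(\<Prod>k\<in>UNIV - {l}. x k ^ (A $ i $ k)) = p i"
      unfolding p_def by (intro prod.cong) (auto simp: x'_def A0)
    finally have "p i = c l i / x l"
      using x(1)[of l] x(2)[of i] y[OF True] A1 by (simp add: field_simps)
    thus ?thesis using True A1 by simp
  next
    case False
    have "of_nat (A $ i $ l) * (x' $ l) ^ (A $ i $ l - 1) * p i = 0"
    proof (cases "A $ i $ l = 1")
      case True
      then obtain j where "j \<notin> T" "j \<noteq> l" "A $ i $ j \<noteq> 0"
        using False lT by (auto simp: pointing_row_def)
      from p0[OF this] show ?thesis by simp
    next
      case False
      hence "A $ i $ l = 0 \<or> A $ i $ l - 1 \<noteq> 0" by linarith
      thus ?thesis using lT by (auto simp: x'_def)
    qed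
    thus ?thesis using False by simp
  qed
  hence "partial_deriv l (W_poly A) x' = (\<Sum>i\<in>UNIV. if pointing_row A T l i then c l i / x l else 0)"
    unfolding pd by simp
  also have "\<dots> = (\<Sum>i\<in>{i. pointing_row A T l i}. c l i / x l)"
    by (intro sum.mono_neutral_cong_right) auto
  also have "\<dots> = 0" using c(2)[of l] by (simp flip: sum_divide_distrib)
  finally show False using l by simp
qed

text \<open>If no monomial is supported in \<open>S\<close>, then at least \<open>|S|\<close> variables \<open>x\<^sub>k\<close> occur in monomials of
  the form \<open>x\<^sub>k m(x\<^sub>S)\<close>. This is the bound that dimension theory gives for the number of partial
  derivatives whose only common zero on the coordinate subspace of \<open>S\<close> is the origin; for as many
  monomials as variables, an induction on \<open>S\<close> suffices.\<close>
lemma card_le_card_pointed: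
  fixes A :: "nat^'n^'n"
  assumes inv: "invertible (\<chi> i j. of_nat (A $ i $ j) :: rat^'n^'n)"
    and nondeg: "nondegenerate A"
    and nolin: "\<And>i j. A $ i $ j = 1 \<Longrightarrow> \<exists>k. k \<noteq> j \<and> A $ i $ k \<noteq> 0"
    and noS: "\<And>i. \<exists>j. j \<notin> S \<and> A $ i $ j \<noteq> 0"
  shows "card S \<le> card {k. \<exists>i. pointing_row A S k i}"
  using finite[of S] noS
proof (induction S rule: finite_remove_induct)
  case (remove T)
  define P where "P = (\<lambda>T. {k. \<exists>i. pointing_row A T k i})"
  obtain k i where ki: "pointing_row A T k i" and uniq: "\<And>i'. pointing_row A T k i' \<Longrightarrow> i' = i"
    using ex_unique_pointing_row[OF inv nondeg remove.hyps(2) remove.prems] by blast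
  then obtain j where j: "j \<noteq> k" "A $ i $ j \<noteq> 0"
    using nolin[of i k] by (auto simp: pointing_row_def)
  hence jT: "j \<in> T" using ki by (auto simp: pointing_row_def)
  \<comment> \<open>Without \<open>j\<close>, the only monomial pointing to \<open>k\<close> is lost and no new pointers arise.\<close>
  have row: "pointing_row A T l i'" if "pointing_row A (T - {j}) l i'" for l i'
  proof -
    have "l \<noteq> j"
    proof
      assume "l = j"
      obtain m where m: "m \<notin> T" "A $ i' $ m \<noteq> 0" using remove.prems by blast
      have "m \<noteq> j" using m(1) jT by metis
      hence "A $ i' $ m = 0" using that m(1) \<open>l = j\<close> by (simp add: pointing_row_def)
      thus False using m(2) by simp
    qed
    thus ?thesis using that by (auto simp: pointing_row_def)
  qed
  have "P (T - {j}) \<subseteq> P T - {k}"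
  proof safe
    fix l assume "l \<in> P (T - {j})"
    thus "l \<in> P T" using row by (auto simp: P_def)
  next
    assume "k \<in> P (T - {j})"
    then obtain i' where i': "pointing_row A (T - {j}) k i'" by (auto simp: P_def)
    hence "i' = i" using row uniq by blast
    thus False using i' j by (auto simp: pointing_row_def)
  qed
  hence "card (P (T - {j})) \<le> card (P T - {k})" by (intro card_mono) auto
  moreover have "k \<in> P T" using ki by (auto simp: P_def)
  hence "card (P T) = Suc (card (P T - {k}))" by (intro card.remove) auto
  moreover have "card (T - {j}) \<le> card (P (T - {j}))"
    unfolding P_def by (rule remove.IH[OF jT]) (use remove.prems in blast)
  moreover have "card T = Suc (card (T - {j}))" using jT by (intro card.remove) auto
  ultimately show ?case unfolding P_def by linarith
qed auto

section \<open>Cancellation of poles\<close>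

text \<open>If \<open>\<kappa> z + a \<tau> + b\<close> meets the lattice at \<open>(z\<^sub>0, \<tau>\<^sub>0)\<close>, say in \<open>m + k \<tau>\<^sub>0\<close>, then
  \<open>\<kappa> \<alpha> + a = k\<close> and \<open>\<kappa> \<beta> + b = m\<close>, as \<open>\<alpha>\<close> and \<open>\<beta>\<close> are the real coordinates of \<open>z\<^sub>0\<close>
  in the basis \<open>\<tau>\<^sub>0, 1\<close>. So it lies in the lattice on the whole line \<open>z = \<alpha> \<tau> + \<beta>\<close>, which is the
  same for all \<open>\<kappa>\<close>, \<open>a\<close>, \<open>b\<close>.\<close>
lemma affine_Theta_factor:
  fixes \<alpha> \<beta> \<kappa> a b :: real
  assumes \<tau>0: "Im \<tau>0 > 0" and z0: "z0 = of_real \<alpha> * \<tau>0 + of_real \<beta>" and \<kappa>: "\<kappa> \<noteq> 0"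
  shows "\<exists>u. eventually (holo2 u) (nhds (z0, \<tau>0)) \<and> u (z0, \<tau>0) \<noteq> 0 \<and>
     eventually (\<lambda>p. Theta (of_real \<kappa> * fst p + of_real a * snd p + of_real b) (snd p) =
        (if of_real \<kappa> * z0 + of_real a * \<tau>0 + of_real b \<in> tau_lattice \<tau>0
         then fst p - of_real \<alpha> * snd p - of_real \<beta> else 1) * u p) (nhds (z0, \<tau>0))"
proof -
  define t where "t = (\<lambda>p :: complex \<times> complex. fst p - of_real \<alpha> * snd p - of_real \<beta>)"
  have ev: "eventually (\<lambda>p. Im (snd p) > 0) (nhds (z0, \<tau>0))"
    by (rule eventually_Im_snd_pos) (use \<tau>0 in simp)
  show ?thesis
  proof (cases "of_real \<kappa> * z0 + of_real a * \<tau>0 + of_real b \<in> tau_lattice \<tau>0")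
    case False
    define u where "u = (\<lambda>p. Theta (of_real \<kappa> * fst p + of_real a * snd p + of_real b) (snd p))"
    have "eventually (holo2 u) (nhds (z0, \<tau>0))"
      using ev unfolding u_def by eventually_elim (intro holo2_intros, auto)
    moreover have "u (z0, \<tau>0) \<noteq> 0" using False Theta_eq_0_iff[OF \<tau>0] by (simp add: u_def)
    ultimately show ?thesis using False by (intro exI[of _ u]) (simp add: u_def)
  next
    case True
    then obtain m k where mk: "of_real \<kappa> * z0 + of_real a * \<tau>0 + of_real b = of_int m + of_int k * \<tau>0"
      by (auto simp: tau_lattice_def)
    have eq: "of_real (\<kappa> * \<alpha> + a - of_int k) * \<tau>0 + of_real (\<kappa> * \<beta> + b - of_int m) = 0"
      using mk unfolding z0 by (simp add: algebra_simps)
    have "(\<kappa> * \<alpha> + a - of_int k) * Im \<tau>0 = 0"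
      using arg_cong[OF eq, of Im] by simp
    hence 1: "a = of_int k - \<kappa> * \<alpha>" using \<tau>0 by simp
    have "\<kappa> * \<beta> + b - of_int m = 0"
      using arg_cong[OF eq, of Re] 1 by simp
    hence 2: "b = of_int m - \<kappa> * \<beta>" by simp
    have \<nu>: "of_real \<kappa> * fst p + of_real a * snd p + of_real b = (of_real \<kappa> * t p + of_int k * snd p) + of_int m" for p
      by (simp add: t_def 1 2 algebra_simps)
    define u where "u = (\<lambda>p. exp (\<i> * of_real pi * of_int m) * exp (\<i> * of_real pi * of_int k -
       \<i> * of_real pi * of_int k ^ 2 * snd p - 2 * of_real pi * \<i> * of_int k * (of_real \<kappa> * t p)) *
       (of_real \<kappa> * Theta1 (of_real \<kappa> * t p) (snd p)))"
    have "eventually (holo2 u) (nhds (z0, \<tau>0))"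
      using ev unfolding u_def t_def by eventually_elim (intro holo2_intros, auto)
    moreover have "t (z0, \<tau>0) = 0" by (simp add: t_def z0)
    hence "u (z0, \<tau>0) \<noteq> 0" using Theta1_0_nonzero[OF \<tau>0] \<kappa> by (simp add: u_def)
    moreover have "eventually (\<lambda>p. Theta (of_real \<kappa> * fst p + of_real a * snd p + of_real b) (snd p) = t p * u p) (nhds (z0, \<tau>0))"
      using ev
    proof eventually_elim
      case (elim p)
      show ?case
        unfolding \<nu> Theta_plus_int[OF elim] Theta_plus_int_tau[OF elim] Theta_conv_Theta1[OF elim, of "of_real \<kappa> * t p"] u_def
        by (simp add: mult_ac)
    qed
    ultimately show ?thesis using True by (intro exI[of _ u]) (simp add: t_def)
  qed
qed

text \<open>If at \<open>(z\<^sub>0, \<tau>\<^sub>0)\<close> at least as many numerators as denominators vanish, then off the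
  line of zeros the product of the factors agrees with a function that is holomorphic there.\<close>
lemma ell_factor_prod_local:
  fixes \<alpha> \<beta> :: real and \<kappa> a b :: "'n :: finite \<Rightarrow> real"
  assumes \<tau>0: "Im \<tau>0 > 0" and z0: "z0 = of_real \<alpha> * \<tau>0 + of_real \<beta>"
    and \<kappa>: "\<And>j. \<kappa> j \<noteq> 0" "\<And>j. \<kappa> j \<noteq> 1"
  defines "w \<equiv> \<lambda>j. of_real (\<kappa> j) * z0 + of_real (a j) * \<tau>0 + of_real (b j)"
  assumes card: "card {j. w j \<in> tau_lattice \<tau>0} \<le> card {j. z0 - w j \<in> tau_lattice \<tau>0}"
  shows "\<exists>g. eventually (holo2 g) (nhds (z0, \<tau>0)) \<and>
     eventually (\<lambda>p. fst p \<noteq> of_real \<alpha> * snd p + of_real \<beta> \<longrightarrow>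
        (\<Prod>j\<in>UNIV. ell_factor (\<kappa> j) (a j) (b j) (fst p) (snd p)) = g p) (nhds (z0, \<tau>0))"
proof -
  define D where "D = {j. w j \<in> tau_lattice \<tau>0}"
  define N where "N = {j. z0 - w j \<in> tau_lattice \<tau>0}"
  define t where "t = (\<lambda>p :: complex \<times> complex. fst p - of_real \<alpha> * snd p - of_real \<beta>)"
  let ?F = "nhds (z0, \<tau>0)"
  have "\<exists>u. eventually (holo2 u) ?F \<and> u (z0, \<tau>0) \<noteq> 0 \<and>
     eventually (\<lambda>p. Theta (of_real (\<kappa> j) * fst p + of_real (a j) * snd p + of_real (b j)) (snd p) =
        (if j \<in> D then t p else 1) * u p) ?F" for j
    unfolding D_def mem_Collect_eq w_def t_def
    by (rule affine_Theta_factor[OF \<tau>0 z0 \<kappa>(1)])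
  from choice[OF allI[OF this]] obtain u where u': "\<forall>j. eventually (holo2 (u j)) ?F \<and> u j (z0, \<tau>0) \<noteq> 0 \<and>
    eventually (\<lambda>p. Theta (of_real (\<kappa> j) * fst p + of_real (a j) * snd p + of_real (b j)) (snd p) =
        (if j \<in> D then t p else 1) * u j p) ?F" ..
  note u = u'[rule_format, THEN conjunct1] u'[rule_format, THEN conjunct2, THEN conjunct1]
    u'[rule_format, THEN conjunct2, THEN conjunct2]
  have "\<exists>v. eventually (holo2 v) ?F \<and>
     eventually (\<lambda>p. Theta ((1 - of_real (\<kappa> j)) * fst p - of_real (a j) * snd p - of_real (b j)) (snd p) =
        (if j \<in> N then t p else 1) * v p) ?F" for j
  proof -
    have k: "1 - \<kappa> j \<noteq> 0" using \<kappa>(2)[of j] by simp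
    have e: "of_real (1 - \<kappa> j) * x + of_real (- a j) * y + of_real (- b j) =
        (1 - of_real (\<kappa> j)) * x - of_real (a j) * y - of_real (b j)" for x y :: complex
      by simp
    have zw: "(1 - of_real (\<kappa> j)) * z0 - of_real (a j) * \<tau>0 - of_real (b j) = z0 - w j"
      by (simp add: w_def algebra_simps)
    from affine_Theta_factor[OF \<tau>0 z0 k, of "- a j" "- b j", unfolded e zw]
    show ?thesis unfolding N_def mem_Collect_eq t_def by (elim exE conjE) (intro exI conjI)
  qed
  from choice[OF allI[OF this]] obtain v where v': "\<forall>j. eventually (holo2 (v j)) ?F \<and>
    eventually (\<lambda>p. Theta ((1 - of_real (\<kappa> j)) * fst p - of_real (a j) * snd p - of_real (b j)) (snd p) =
        (if j \<in> N then t p else 1) * v j p) ?F" ..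
  note v = v'[rule_format, THEN conjunct1] v'[rule_format, THEN conjunct2]
  define g where "g = (\<lambda>p. t p ^ (card N - card D) *
     (\<Prod>j\<in>UNIV. exp (neg_tpi * fst p * of_real (a j)) * (v j p / u j p)))"
  have nz: "eventually (\<lambda>p. u j p \<noteq> 0) ?F" for j
    using u(2)[of j] holo2_isCont[OF eventually_nhds_x_imp_x[OF u(1)[of j]]]
    by (intro eventually_nonzero_isCont)
  have ev: "eventually (\<lambda>p. \<forall>j. holo2 (u j) p \<and> holo2 (v j) p \<and> u j p \<noteq> 0 \<and>
      Theta (of_real (\<kappa> j) * fst p + of_real (a j) * snd p + of_real (b j)) (snd p) =
        (if j \<in> D then t p else 1) * u j p \<and>
      Theta ((1 - of_real (\<kappa> j)) * fst p - of_real (a j) * snd p - of_real (b j)) (snd p) =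
        (if j \<in> N then t p else 1) * v j p) ?F"
    by (intro eventually_all_finite eventually_conj u v nz)
  have "eventually (holo2 g) ?F"
    using ev unfolding g_def t_def by eventually_elim (intro holo2_intros, auto)
  moreover have "eventually (\<lambda>p. fst p \<noteq> of_real \<alpha> * snd p + of_real \<beta> \<longrightarrow>
        (\<Prod>j\<in>UNIV. ell_factor (\<kappa> j) (a j) (b j) (fst p) (snd p)) = g p) ?F"
    using ev
  proof eventually_elim
    case (elim p)
    note p = elim
    show ?case
    proof
      assume "fst p \<noteq> of_real \<alpha> * snd p + of_real \<beta>"
      hence t: "t p \<noteq> 0" by (simp add: t_def algebra_simps)
      have pow: "(\<Prod>j\<in>UNIV. if j \<in> M then t p else 1) = t p ^ card M" for M :: "'n set"
      proof -
        have "(\<Prod>j\<in>UNIV. if j \<in> M then t p else 1) = (\<Prod>j\<in>M. t p)"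
          by (intro prod.mono_neutral_cong_right) auto
        thus ?thesis by simp
      qed
      have "(\<Prod>j\<in>UNIV. ell_factor (\<kappa> j) (a j) (b j) (fst p) (snd p)) =
          (\<Prod>j\<in>UNIV. ((if j \<in> N then t p else 1) / (if j \<in> D then t p else 1)) *
            (exp (neg_tpi * fst p * of_real (a j)) * (v j p / u j p)))"
        by (intro prod.cong refl) (simp add: ell_factor_def p)
      also have "\<dots> = (t p ^ card N / t p ^ card D) *
          (\<Prod>j\<in>UNIV. exp (neg_tpi * fst p * of_real (a j)) * (v j p / u j p))"
        unfolding prod.distrib prod_dividef pow ..
      also have "t p ^ card N / t p ^ card D = t p ^ (card N - card D)"
        using t card by (simp add: power_diff D_def N_def)
      finally show "(\<Prod>j\<in>UNIV. ell_factor (\<kappa> j) (a j) (b j) (fst p) (snd p)) = g p"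
        by (simp add: g_def)
    qed
  qed
  ultimately show ?thesis by blast
qed

text \<open>Removing singularities for each \<open>\<tau>\<close> separately yields the local extension \<open>g\<close> in both
  variables, because every slice meets the exceptional line in a single point.\<close>
lemma remove_sings_local:
  fixes F :: "complex \<Rightarrow> complex \<Rightarrow> complex" and \<alpha> \<beta> :: complex
  assumes "eventually (holo2 g) (nhds (z0, \<tau>0))"
    "eventually (\<lambda>p. fst p \<noteq> \<alpha> * snd p + \<beta> \<longrightarrow> F (fst p) (snd p) = g p) (nhds (z0, \<tau>0))"
  shows "holo2 (\<lambda>(z, \<tau>). remove_sings (\<lambda>w. F w \<tau>) z) (z0, \<tau>0)"
    and "((\<lambda>w. F w \<tau>0) \<longlongrightarrow> remove_sings (\<lambda>w. F w \<tau>0) z0) (at z0)"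
proof -
  from eventually_conj[OF assms] obtain U where U: "open U" "(z0, \<tau>0) \<in> U"
    and Ug: "\<And>p. p \<in> U \<Longrightarrow> holo2 g p"
    and UF: "\<And>p. p \<in> U \<Longrightarrow> fst p \<noteq> \<alpha> * snd p + \<beta> \<Longrightarrow> F (fst p) (snd p) = g p"
    unfolding eventually_nhds by blast
  have lim: "((\<lambda>w. F w \<tau>) \<longlongrightarrow> g (z, \<tau>)) (at z)" if zt: "(z, \<tau>) \<in> U" for z \<tau>
  proof (rule Lim_transform_eventually)
    have "isCont (\<lambda>w. g (w, \<tau>)) z"
      by (intro field_differentiable_imp_continuous_at holo2_slice1 Ug zt)
    thus "((\<lambda>w. g (w, \<tau>)) \<longlongrightarrow> g (z, \<tau>)) (at z)" by (simp add: isCont_def)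
    have "open ((\<lambda>w. (w, \<tau>)) -` U)"
      by (intro open_vimage U continuous_intros)
    hence "eventually (\<lambda>w. w \<in> (\<lambda>w. (w, \<tau>)) -` U) (nhds z)"
      by (rule eventually_nhds_in_open) (use zt in simp)
    hence "eventually (\<lambda>w. (w, \<tau>) \<in> U) (at z)"
      by (auto simp: eventually_at_filter elim: eventually_mono)
    moreover have "eventually (\<lambda>w. w \<noteq> \<alpha> * \<tau> + \<beta>) (at z)"
      by (rule eventually_neq_at_within)
    ultimately show "eventually (\<lambda>w. g (w, \<tau>) = F w \<tau>) (at z)"
      by eventually_elim (use UF in force)
  qed
  have eq: "remove_sings (\<lambda>w. F w \<tau>) z = g (z, \<tau>)" if "(z, \<tau>) \<in> U" for z \<tau>
    by (rule remove_sings_eqI[OF lim[OF that]])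
  show "holo2 (\<lambda>(z, \<tau>). remove_sings (\<lambda>w. F w \<tau>) z) (z0, \<tau>0)"
  proof (rule holo2_transform[OF Ug[OF U(2)]])
    have "eventually (\<lambda>p. p \<in> U) (nhds (z0, \<tau>0))" using U by (rule eventually_nhds_in_open)
    thus "eventually (\<lambda>p. g p = (case p of (z, \<tau>) \<Rightarrow> remove_sings (\<lambda>w. F w \<tau>) z)) (nhds (z0, \<tau>0))"
      by eventually_elim (auto simp: eq)
  qed
  show "((\<lambda>w. F w \<tau>0) \<longlongrightarrow> remove_sings (\<lambda>w. F w \<tau>0) z0) (at z0)"
    using lim[OF U(2)] eq[OF U(2)] by simp
qed

lemma tau_lattice_of_nat_mult: "x \<in> tau_lattice \<tau> \<Longrightarrow> of_nat n * x \<in> tau_lattice \<tau>"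
  by (induction n) (auto simp: tau_lattice_0 ring_distribs intro: tau_lattice_add)

lemma tau_lattice_sum: "(\<And>i. i \<in> I \<Longrightarrow> f i \<in> tau_lattice \<tau>) \<Longrightarrow> sum f I \<in> tau_lattice \<tau>"
  by (induction I rule: infinite_finite_induct) (auto simp: tau_lattice_0 intro: tau_lattice_add)

lemma tau_lattice_Ints_mult: "x \<in> \<int> \<Longrightarrow> y \<in> \<int> \<Longrightarrow> x * \<tau> + y \<in> tau_lattice \<tau>"
  by (auto elim!: Ints_cases simp: tau_lattice_def add.commute)

lemma of_rat_complex_conv_real: "(of_rat r :: complex) = of_real (of_rat r)"
  by (cases r) (auto simp: of_rat_rat)

text \<open>The polynomial \<open>W\<close> given by \<open>A\<close>, the group \<open>G\<close> and a choice \<open>\<theta>\<close> of angles.\<close>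
locale LG_orbifold =
  fixes A :: "nat^'n^'n" and q :: "rat^'n" and G :: "(complex^'n) set"
    and \<theta> :: "complex^'n \<Rightarrow> rat^'n" and chat :: int
  assumes inv: "invertible (\<chi> i j. of_nat (A $ i $ j) :: rat^'n^'n)"
    and q_pos: "\<forall>j. q $ j > 0"
    and A_q: "\<forall>i. (\<Sum>j\<in>UNIV. of_nat (A $ i $ j) * q $ j) = 1"
    and nondeg: "nondegenerate A"
    and q_sum_int: "(\<Sum>j\<in>UNIV. q $ j) \<in> \<int>"
    and G_subgroup: "subgroup G (Aut_W A)"
    and J_G: "generate (Aut_W A) {J_W q} \<subseteq> G" and G_SL: "G \<subseteq> SL_W A"
    and \<theta>: "\<forall>n\<in>G. \<forall>j. n $ j = exp (tpi * of_rat (\<theta> n $ j))"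
    and chat: "of_int chat = of_nat CARD('n) - 2 * (\<Sum>j\<in>UNIV. q $ j)"
begin

text \<open>The weights \<open>q\<^sub>j\<close> and the angles \<open>\<theta>\<^sub>j(n)\<close> as real numbers.\<close>
definition \<kappa> :: "'n \<Rightarrow> real" where "\<kappa> j = of_rat (q $ j)"
definition th :: "complex^'n \<Rightarrow> 'n \<Rightarrow> real" where "th n j = of_rat (\<theta> n $ j)"

lemma Ell_formula_ell_factor:
  "Ell_formula q \<theta> G z \<tau> = 1 / of_nat (card G) *
    (\<Sum>n\<in>G. \<Sum>n1\<in>G. \<Prod>j\<in>UNIV. ell_factor (\<kappa> j) (th n j) (th n1 j) z \<tau>)"
  unfolding Ell_formula_def ell_factor_def \<kappa>_def th_def of_rat_complex_conv_real ..

lemma \<kappa>_pos: "\<kappa> j > 0"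
  using q_pos by (simp add: \<kappa>_def)

lemma A_\<kappa>: "(\<Sum>j\<in>UNIV. of_nat (A $ i $ j) * \<kappa> j) = 1"
proof -
  have "real_of_rat (\<Sum>j\<in>UNIV. of_nat (A $ i $ j) * q $ j) = 1" using A_q by simp
  thus ?thesis by (simp add: of_rat_sum of_rat_mult \<kappa>_def)
qed

lemma exp_th: "n \<in> G \<Longrightarrow> n $ j = exp (tpi * of_real (th n j))"
  using \<theta> by (simp add: th_def of_rat_complex_conv_real)

lemma A_th_int:
  assumes "n \<in> G"
  shows "(\<Sum>j\<in>UNIV. of_nat (A $ i $ j) * th n j) \<in> \<int>"
proof -
  have "1 = (\<Prod>j\<in>UNIV. (n $ j) ^ (A $ i $ j))"
    using assms subgroup.subset[OF G_subgroup] by (auto simp: Aut_W_def)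
  also have "\<dots> = (\<Prod>j\<in>UNIV. exp (of_nat (A $ i $ j) * (tpi * of_real (th n j))))"
    by (simp add: exp_th[OF assms] exp_of_nat_mult)
  also have "\<dots> = exp (tpi * of_real (\<Sum>j\<in>UNIV. of_nat (A $ i $ j) * th n j))"
    by (simp add: sum_distrib_left mult_ac flip: exp_sum)
  finally have "complex_of_real (\<Sum>j\<in>UNIV. of_nat (A $ i $ j) * th n j) \<in> \<int>"
    using exp_2pi_i_eq_1_iff by metis
  thus ?thesis by (simp only: of_real_in_Ints_iff)
qed

text \<open>If no weight is 1, the poles of a summand at \<open>(z, \<tau>)\<close> are at most as many as its zeros, both
  counted by factors.\<close>
lemma card_poles_le_card_zeros:
  fixes z \<tau> :: complex
  assumes \<tau>: "Im \<tau> > 0" and n: "n \<in> G" "n1 \<in> G" and ne1: "\<And>j. \<kappa> j \<noteq> 1"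
  defines "w \<equiv> \<lambda>j. of_real (\<kappa> j) * z + of_real (th n j) * \<tau> + of_real (th n1 j)"
  shows "card {j. w j \<in> tau_lattice \<tau>} \<le> card {j. z - w j \<in> tau_lattice \<tau>}"
proof (cases "z \<in> tau_lattice \<tau>")
  case True
  have "w j \<in> tau_lattice \<tau> \<longleftrightarrow> z - w j \<in> tau_lattice \<tau>" for j
    using tau_lattice_diff[OF True, of "w j"] tau_lattice_diff[OF True, of "z - w j"] by auto
  thus ?thesis by simp
next
  case False
  define S where "S = {j. w j \<in> tau_lattice \<tau>}"
  have row: "z - (\<Sum>j\<in>UNIV. of_nat (A $ i $ j) * w j) \<in> tau_lattice \<tau>" for i
  proof -
    have "(\<Sum>j\<in>UNIV. of_nat (A $ i $ j) * w j) =
        of_real (\<Sum>j\<in>UNIV. of_nat (A $ i $ j) * \<kappa> j) * z +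
        of_real (\<Sum>j\<in>UNIV. of_nat (A $ i $ j) * th n j) * \<tau> + of_real (\<Sum>j\<in>UNIV. of_nat (A $ i $ j) * th n1 j)"
      by (simp add: w_def sum_distrib_left sum.distrib ring_distribs mult_ac)
    hence "(\<Sum>j\<in>UNIV. of_nat (A $ i $ j) * w j) - z \<in> tau_lattice \<tau>"
      unfolding A_\<kappa> using tau_lattice_Ints_mult[of "of_real (\<Sum>j\<in>UNIV. of_nat (A $ i $ j) * th n j)"
          "of_real (\<Sum>j\<in>UNIV. of_nat (A $ i $ j) * th n1 j)" \<tau>] A_th_int[OF n(1), of i] A_th_int[OF n(2), of i]
      by (simp only: of_real_in_Ints_iff) simp
    from tau_lattice_uminus[OF this] show ?thesis by simp
  qed
  have noS: "\<exists>j. j \<notin> S \<and> A $ i $ j \<noteq> 0" for i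
  proof (rule ccontr)
    assume *: "\<not> ?thesis"
    have "of_nat (A $ i $ j) * w j \<in> tau_lattice \<tau>" for j
    proof (cases "j \<in> S")
      case True
      thus ?thesis by (auto simp: S_def intro: tau_lattice_of_nat_mult)
    qed (use * in \<open>auto simp: tau_lattice_0\<close>)
    hence "(\<Sum>j\<in>UNIV. of_nat (A $ i $ j) * w j) \<in> tau_lattice \<tau>"
      by (intro tau_lattice_sum)
    from tau_lattice_add[OF row[of i] this] False show False by simp
  qed
  have nolin: "\<exists>k. k \<noteq> j \<and> A $ i $ k \<noteq> 0" if "A $ i $ j = 1" for i j
  proof (rule ccontr)
    assume "\<not> ?thesis"
    hence "(\<Sum>k\<in>UNIV. of_nat (A $ i $ k) * \<kappa> k) = (\<Sum>k\<in>{j}. of_nat (A $ i $ k) * \<kappa> k)"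
      by (intro sum.mono_neutral_right) auto
    thus False using A_\<kappa>[of i] that ne1[of j] by simp
  qed
  have "card S \<le> card {k. \<exists>i. pointing_row A S k i}"
    by (rule card_le_card_pointed[OF inv nondeg nolin noS])
  also have "\<dots> \<le> card {j. z - w j \<in> tau_lattice \<tau>}"
  proof (intro card_mono subsetI CollectI finite; elim CollectE exE)
    fix k i assume ki: "pointing_row A S k i"
    have "(\<Sum>j\<in>UNIV. of_nat (A $ i $ j) * w j) = w k + (\<Sum>j\<in>UNIV - {k}. of_nat (A $ i $ j) * w j)"
      using ki by (simp add: sum.remove[of _ k] pointing_row_def)
    moreover have "(\<Sum>j\<in>UNIV - {k}. of_nat (A $ i $ j) * w j) \<in> tau_lattice \<tau>"
    proof (intro tau_lattice_sum)
      fix j assume "j \<in> UNIV - {k}"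
      thus "of_nat (A $ i $ j) * w j \<in> tau_lattice \<tau>"
        using ki by (cases "j \<in> S") (auto simp: pointing_row_def S_def tau_lattice_0 intro: tau_lattice_of_nat_mult)
    qed
    ultimately show "z - w k \<in> tau_lattice \<tau>"
      using tau_lattice_add[OF row[of i], of "\<Sum>j\<in>UNIV - {k}. of_nat (A $ i $ j) * w j"] by simp
  qed
  finally show ?thesis by (simp add: S_def)
qed

text \<open>If no weight is 1, then near every point the elliptic genus is holomorphic in both variables, and it is the limit of
  the defining formula.\<close>
lemma Ell_local:
  assumes \<tau>0: "Im \<tau>0 > 0" and ne1: "\<And>j. \<kappa> j \<noteq> 1"
  shows "holo2 (\<lambda>(z, \<tau>). Ell q \<theta> G z \<tau>) (z0, \<tau>0)"
    and "((\<lambda>w. Ell_formula q \<theta> G w \<tau>0) \<longlongrightarrow> Ell q \<theta> G z0 \<tau>0) (at z0)"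
proof -
  define \<alpha> where "\<alpha> = Im z0 / Im \<tau>0"
  define \<beta> where "\<beta> = Re z0 - \<alpha> * Re \<tau>0"
  have z0: "z0 = of_real \<alpha> * \<tau>0 + of_real \<beta>"
    using \<tau>0 by (simp add: complex_eq_iff \<alpha>_def \<beta>_def)
  have \<kappa>0: "\<kappa> j \<noteq> 0" for j using \<kappa>_pos[of j] by simp
  let ?F = "nhds (z0, \<tau>0)"
  have loc: "\<exists>g. eventually (holo2 g) ?F \<and>
     eventually (\<lambda>p. fst p \<noteq> of_real \<alpha> * snd p + of_real \<beta> \<longrightarrow>
        (\<Prod>j\<in>UNIV. ell_factor (\<kappa> j) (th n j) (th n1 j) (fst p) (snd p)) = g p) ?F"
    if "n \<in> G" "n1 \<in> G" for n n1
    by (rule ell_factor_prod_local[OF \<tau>0 z0 \<kappa>0 ne1 card_poles_le_card_zeros[OF \<tau>0 that ne1]])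
  define g where "g = (\<lambda>n n1. SOME g. eventually (holo2 g) ?F \<and>
     eventually (\<lambda>p. fst p \<noteq> of_real \<alpha> * snd p + of_real \<beta> \<longrightarrow>
        (\<Prod>j\<in>UNIV. ell_factor (\<kappa> j) (th n j) (th n1 j) (fst p) (snd p)) = g p) ?F)"
  have g: "\<And>n n1. n \<in> G \<Longrightarrow> n1 \<in> G \<Longrightarrow> eventually (holo2 (g n n1)) ?F"
    "\<And>n n1. n \<in> G \<Longrightarrow> n1 \<in> G \<Longrightarrow> eventually (\<lambda>p. fst p \<noteq> of_real \<alpha> * snd p + of_real \<beta> \<longrightarrow>
        (\<Prod>j\<in>UNIV. ell_factor (\<kappa> j) (th n j) (th n1 j) (fst p) (snd p)) = g n n1 p) ?F"
    unfolding g_def by (drule (1) loc, erule someI2_ex, erule conjunct1)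
       (drule (1) loc, erule someI2_ex, erule conjunct2)
  define h where "h = (\<lambda>p. if finite G then 1 / of_nat (card G) * (\<Sum>n\<in>G. \<Sum>n1\<in>G. g n n1 p) else 0)"
  have ev: "eventually (\<lambda>p. holo2 h p \<and> (fst p \<noteq> of_real \<alpha> * snd p + of_real \<beta> \<longrightarrow>
      Ell_formula q \<theta> G (fst p) (snd p) = h p)) ?F"
  proof (cases "finite G")
    case True
    have "eventually (\<lambda>p. \<forall>n\<in>G. \<forall>n1\<in>G. holo2 (g n n1) p \<and> (fst p \<noteq> of_real \<alpha> * snd p + of_real \<beta> \<longrightarrow>
        (\<Prod>j\<in>UNIV. ell_factor (\<kappa> j) (th n j) (th n1 j) (fst p) (snd p)) = g n n1 p)) ?F"
      using True by (intro eventually_ball_finite ballI eventually_conj g)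
    thus ?thesis
    proof eventually_elim
      case (elim p)
      have "holo2 h p" 
        unfolding h_def if_P[OF True] using elim by (intro holo2_mult holo2_const holo2_sum) blast
      moreover have "(\<Sum>n\<in>G. \<Sum>n1\<in>G. \<Prod>j\<in>UNIV. ell_factor (\<kappa> j) (th n j) (th n1 j) (fst p) (snd p)) =
          (\<Sum>n\<in>G. \<Sum>n1\<in>G. g n n1 p)" if "fst p \<noteq> of_real \<alpha> * snd p + of_real \<beta>"
        using elim that by (intro sum.cong refl) blast
      ultimately show ?case using True by (simp add: Ell_formula_ell_factor h_def)
    qed
  next
    case False
    thus ?thesis by (simp add: h_def Ell_formula_ell_factor holo2_const)
  qed
  note * = remove_sings_local[of h z0 \<tau>0 "of_real \<alpha>" "of_real \<beta>" "\<lambda>w \<tau>. Ell_formula q \<theta> G w \<tau>", folded Ell_def]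
  show "holo2 (\<lambda>(z, \<tau>). Ell q \<theta> G z \<tau>) (z0, \<tau>0)"
    by (rule *(1); use ev in \<open>eventually_elim, blast\<close>)
  show "((\<lambda>w. Ell_formula q \<theta> G w \<tau>0) \<longlongrightarrow> Ell q \<theta> G z0 \<tau>0) (at z0)"
    by (rule *(2); use ev in \<open>eventually_elim, blast\<close>)
qed

end

section \<open>Transformation laws of the elliptic genus\<close>

text \<open>The inverse of a diagonal automorphism.\<close>
definition vec_inv :: "complex^'n \<Rightarrow> complex^'n" where
  "vec_inv n = (\<chi> j. inverse (n $ j))"

context LG_orbifold
begin

text \<open>The summand of the elliptic genus that belongs to \<open>(n, n\<^sub>1)\<close>.\<close>
definition ell_term :: "complex^'n \<Rightarrow> complex^'n \<Rightarrow> complex \<Rightarrow> complex \<Rightarrow> complex" where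
  "ell_term n n1 z \<tau> = (\<Prod>j\<in>UNIV. ell_factor (\<kappa> j) (th n j) (th n1 j) z \<tau>)"

text \<open>The defining formula, with 0 as value of a quotient with vanishing denominator.\<close>
abbreviation ell_sum :: "complex \<Rightarrow> complex \<Rightarrow> complex" where
  "ell_sum \<equiv> Ell_formula q \<theta> G"

lemma ell_sum_eq: "ell_sum z \<tau> = 1 / of_nat (card G) * (\<Sum>n\<in>G. \<Sum>n1\<in>G. ell_term n n1 z \<tau>)"
  by (simp add: Ell_formula_ell_factor ell_term_def)

lemma G_nonzero: "n \<in> G \<Longrightarrow> n $ j \<noteq> 0"
  using exp_th by simp

lemma G_mult: "n \<in> G \<Longrightarrow> m \<in> G \<Longrightarrow> n * m \<in> G"
  using subgroup.m_closed[OF G_subgroup, of n m] by (simp add: Aut_W_def)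

lemma vec_inv_mult: "n \<in> G \<Longrightarrow> n * vec_inv n = 1"
  using G_nonzero by (simp add: vec_inv_def vec_eq_iff)

lemma G_vec_inv:
  assumes "n \<in> G"
  shows "vec_inv n \<in> G"
proof -
  have n: "n \<in> carrier (Aut_W A)"
    using assms subgroup.subset[OF G_subgroup] by blast
  have "m_inv (Aut_W A) n = vec_inv n"
    unfolding m_inv_def
  proof (rule the_equality)
    have "(\<Prod>j\<in>UNIV. (vec_inv n $ j) ^ (A $ i $ j)) = inverse (\<Prod>j\<in>UNIV. (n $ j) ^ (A $ i $ j))" for i
      by (simp add: vec_inv_def power_inverse prod_inversef[symmetric] o_def)
    thus "vec_inv n \<in> carrier (Aut_W A) \<and> n \<otimes>\<^bsub>Aut_W A\<^esub> vec_inv n = \<one>\<^bsub>Aut_W A\<^esub> \<and>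
        vec_inv n \<otimes>\<^bsub>Aut_W A\<^esub> n = \<one>\<^bsub>Aut_W A\<^esub>"
      using n vec_inv_mult[OF assms]
      by (auto simp: Aut_W_def mult.commute) (simp add: vec_inv_def)
  next
    fix y assume "y \<in> carrier (Aut_W A) \<and> n \<otimes>\<^bsub>Aut_W A\<^esub> y = \<one>\<^bsub>Aut_W A\<^esub> \<and>
        y \<otimes>\<^bsub>Aut_W A\<^esub> n = \<one>\<^bsub>Aut_W A\<^esub>"
    hence "n * y = 1" by (simp add: Aut_W_def)
    hence "n $ j * y $ j = 1" for j by (metis one_index vector_mult_component)
    hence "y $ j = inverse (n $ j)" for j using inverse_unique by metis
    thus "y = vec_inv n" by (simp add: vec_inv_def vec_eq_iff)
  qed
  thus ?thesis using subgroup.m_inv_closed[OF G_subgroup assms] by simp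
qed

lemma J_in_G: "J_W q \<in> G"
  using J_G generate.incl[of "J_W q" "{J_W q}" "Aut_W A"] by blast

lemma bij_betw_mult_left: "n \<in> G \<Longrightarrow> bij_betw (\<lambda>m. n * m) G G"
  using vec_inv_mult[of n]
  by (intro bij_betwI[where g = "\<lambda>m. vec_inv n * m"])
     (auto intro: G_mult G_vec_inv simp: mult.assoc[symmetric] mult.commute[of "vec_inv n" n])

lemma bij_betw_mult_right: "n \<in> G \<Longrightarrow> bij_betw (\<lambda>m. m * n) G G"
  using bij_betw_mult_left[of n] by (simp add: mult.commute[of _ n])

lemma bij_betw_vec_inv: "bij_betw vec_inv G G"
  by (intro bij_betwI[where g = vec_inv]) (auto intro: G_vec_inv simp: vec_inv_def)

lemma exp_eq_imp_diff_Ints: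
  assumes "exp (tpi * of_real x) = exp (tpi * of_real y)"
  shows "x - y \<in> \<int>"
proof -
  have "exp (tpi * of_real (x - y)) = 1"
    using assms by (simp add: ring_distribs exp_diff)
  hence "complex_of_real (x - y) \<in> \<int>" using exp_2pi_i_eq_1_iff by blast
  thus ?thesis by (simp only: of_real_in_Ints_iff)
qed

lemma th_mult:
  assumes "n \<in> G" "m \<in> G"
  shows "(th n j + th m j) - th (n * m) j \<in> \<int>"
proof (rule exp_eq_imp_diff_Ints)
  have "(n * m) $ j = n $ j * m $ j" by simp
  thus "exp (tpi * of_real (th n j + th m j)) = exp (tpi * of_real (th (n * m) j))"
    unfolding exp_th[OF assms(1)] exp_th[OF assms(2)] exp_th[OF G_mult[OF assms]]
    by (simp add: ring_distribs exp_add)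
qed

lemma th_J:
  assumes "n \<in> G"
  shows "(th n j + \<kappa> j) - th (n * J_W q) j \<in> \<int>"
proof (rule exp_eq_imp_diff_Ints)
  have "(n * J_W q) $ j = n $ j * exp (tpi * of_real (\<kappa> j))"
    by (simp add: J_W_def \<kappa>_def of_rat_complex_conv_real)
  thus "exp (tpi * of_real (th n j + \<kappa> j)) = exp (tpi * of_real (th (n * J_W q) j))"
    unfolding exp_th[OF assms(1)] exp_th[OF G_mult[OF assms J_in_G]]
    by (simp add: ring_distribs exp_add)
qed

lemma th_vec_inv:
  assumes "n \<in> G"
  shows "- th n j - th (vec_inv n) j \<in> \<int>"
proof (rule exp_eq_imp_diff_Ints)
  have "vec_inv n $ j = inverse (n $ j)" by (simp add: vec_inv_def)
  thus "exp (tpi * of_real (- th n j)) = exp (tpi * of_real (th (vec_inv n) j))"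
    unfolding exp_th[OF assms(1)] exp_th[OF G_vec_inv[OF assms]] by (simp add: exp_minus)
qed

lemma exp_sum_th:
  assumes "n \<in> G"
  shows "exp (tpi * of_real (\<Sum>j\<in>UNIV. th n j)) = 1"
proof -
  have "(\<Prod>j\<in>UNIV. n $ j) = 1" using assms G_SL by (auto simp: SL_W_def)
  thus ?thesis
    by (simp add: exp_th[OF assms] sum_distrib_left flip: exp_sum)
qed

lemma chat_real: "real_of_int chat = real CARD('n) - 2 * (\<Sum>j\<in>UNIV. \<kappa> j)"
proof -
  have "real_of_rat (of_int chat) = real_of_rat (of_nat CARD('n) - 2 * (\<Sum>j\<in>UNIV. q $ j))"
    by (simp only: chat)
  thus ?thesis by (simp add: of_rat_diff of_rat_mult of_rat_sum \<kappa>_def)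
qed

lemma sum_1_minus_2\<kappa>: "(\<Sum>j\<in>UNIV. 1 - 2 * \<kappa> j) = real_of_int chat"
  unfolding chat_real by (simp add: sum_subtractf sum_distrib_left)

lemma minus_1_power_chat: "(- 1 :: complex) ^ CARD('n) = (- 1) powi chat"
proof -
  obtain k where k: "(\<Sum>j\<in>UNIV. q $ j) = of_int k" using q_sum_int by (elim Ints_cases)
  have "(of_int chat :: rat) = of_int (int CARD('n) - 2 * k)" using chat k by simp
  hence c: "chat = int CARD('n) - 2 * k" by (simp only: of_int_eq_iff)
  have "(- 1 :: complex) powi (int CARD('n) - 2 * k) = (- 1) powi (int CARD('n)) / ((- 1) powi 2) powi k"
    by (simp add: power_int_diff power_int_mult)
  thus ?thesis using c by simp
qed

text \<open>A summand depends on the angles modulo 1 only.\<close>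
lemma ell_term_congI:
  assumes "Im \<tau> > 0" "\<And>j. a j - th n j \<in> \<int>" "\<And>j. b j - th n1 j \<in> \<int>"
  shows "(\<Prod>j\<in>UNIV. ell_factor (\<kappa> j) (a j) (b j) z \<tau>) = ell_term n n1 z \<tau>"
  unfolding ell_term_def by (intro prod.cong refl ell_factor_cong assms)

lemma ell_sum_tau_plus_1:
  assumes \<tau>: "Im \<tau> > 0"
  shows "ell_sum z (\<tau> + 1) = ell_sum z \<tau>"
proof -
  have "ell_term n n1 z (\<tau> + 1) = ell_term n (n * n1) z \<tau>" if "n \<in> G" "n1 \<in> G" for n n1
    unfolding ell_term_def[of n n1] ell_factor_tau_plus_1[OF \<tau>]
    by (intro ell_term_congI \<tau> th_mult that) auto
  hence "(\<Sum>n\<in>G. \<Sum>n1\<in>G. ell_term n n1 z (\<tau> + 1)) = (\<Sum>n\<in>G. \<Sum>n1\<in>G. ell_term n (n * n1) z \<tau>)"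
    by (intro sum.cong) auto
  also have "\<dots> = (\<Sum>n\<in>G. \<Sum>n1\<in>G. ell_term n n1 z \<tau>)"
    by (intro sum.cong refl sum.reindex_bij_betw bij_betw_mult_left)
  finally show ?thesis by (simp add: ell_sum_eq)
qed

lemma ell_sum_z_plus_1:
  assumes \<tau>: "Im \<tau> > 0"
  shows "ell_sum (z + 1) \<tau> = (- 1) powi chat * ell_sum z \<tau>"
proof -
  have "ell_term n n1 (z + 1) \<tau> = (- 1) powi chat * ell_term n (n1 * J_W q) z \<tau>" if n: "n \<in> G" "n1 \<in> G" for n n1
  proof -
    have "(\<Prod>j\<in>UNIV. - exp (neg_tpi * of_real (th n j))) =
       (- 1) ^ CARD('n) * inverse (exp (tpi * of_real (\<Sum>j\<in>UNIV. th n j)))"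
      by (simp add: prod_uminus sum_distrib_left sum_negf flip: exp_sum exp_minus)
    hence "(\<Prod>j\<in>UNIV. - exp (neg_tpi * of_real (th n j))) = (- 1) powi chat"
      by (simp only: exp_sum_th[OF n(1)] minus_1_power_chat) simp
    moreover have "(\<Prod>j\<in>UNIV. ell_factor (\<kappa> j) (th n j) (th n1 j + \<kappa> j) z \<tau>) = ell_term n (n1 * J_W q) z \<tau>"
      by (intro ell_term_congI \<tau> th_J n) auto
    ultimately show ?thesis
      unfolding ell_term_def[of n n1] ell_factor_z_plus_1[OF \<tau>] prod.distrib by simp
  qed
  hence "(\<Sum>n\<in>G. \<Sum>n1\<in>G. ell_term n n1 (z + 1) \<tau>) = (\<Sum>n\<in>G. \<Sum>n1\<in>G. (- 1) powi chat * ell_term n (n1 * J_W q) z \<tau>)"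
    by (intro sum.cong) auto
  also have "\<dots> = (- 1) powi chat * (\<Sum>n\<in>G. \<Sum>n1\<in>G. ell_term n (n1 * J_W q) z \<tau>)"
    by (simp add: sum_distrib_left)
  also have "(\<Sum>n\<in>G. \<Sum>n1\<in>G. ell_term n (n1 * J_W q) z \<tau>) = (\<Sum>n\<in>G. \<Sum>n1\<in>G. ell_term n n1 z \<tau>)"
    by (intro sum.cong refl sum.reindex_bij_betw bij_betw_mult_right J_in_G)
  finally show ?thesis by (simp add: ell_sum_eq)
qed

lemma ell_sum_z_plus_tau:
  assumes \<tau>: "Im \<tau> > 0"
  shows "ell_sum (z + \<tau>) \<tau> = (- 1) powi chat * exp (- \<i> * of_real pi * of_int chat * (\<tau> + 2 * z)) * ell_sum z \<tau>"
proof -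
  define c where "c = (- 1) powi chat * exp (- \<i> * of_real pi * of_int chat * (\<tau> + 2 * z))"
  have "ell_term n n1 (z + \<tau>) \<tau> = c * ell_term (n * J_W q) n1 z \<tau>" if n: "n \<in> G" "n1 \<in> G" for n n1
  proof -
    have "(\<Prod>j\<in>UNIV. - exp (- \<i> * of_real pi * (\<tau> + 2 * z) * of_real (1 - 2 * \<kappa> j)) * exp (tpi * of_real (th n1 j))) =
       (- 1) ^ CARD('n) * exp (- \<i> * of_real pi * (\<tau> + 2 * z) * of_real (\<Sum>j\<in>UNIV. 1 - 2 * \<kappa> j)) *
        exp (tpi * of_real (\<Sum>j\<in>UNIV. th n1 j))"
      unfolding prod.distrib prod_uminus of_real_sum sum_distrib_left by (simp add: exp_sum)
    also have "\<dots> = c"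
      unfolding exp_sum_th[OF n(2)] sum_1_minus_2\<kappa> minus_1_power_chat by (simp add: c_def mult_ac)
    finally have "(\<Prod>j\<in>UNIV. - exp (- \<i> * of_real pi * (\<tau> + 2 * z) * of_real (1 - 2 * \<kappa> j)) * exp (tpi * of_real (th n1 j))) = c" .
    moreover have "(\<Prod>j\<in>UNIV. ell_factor (\<kappa> j) (th n j + \<kappa> j) (th n1 j) z \<tau>) = ell_term (n * J_W q) n1 z \<tau>"
      by (intro ell_term_congI \<tau> th_J n) auto
    ultimately show ?thesis
      unfolding ell_term_def[of n n1] ell_factor_z_plus_tau[OF \<tau>] prod.distrib[where h = "\<lambda>j. ell_factor (\<kappa> j) (th n j + \<kappa> j) (th n1 j) z \<tau>"]
      by simp
  qed
  hence "(\<Sum>n\<in>G. \<Sum>n1\<in>G. ell_term n n1 (z + \<tau>) \<tau>) = (\<Sum>n\<in>G. \<Sum>n1\<in>G. c * ell_term (n * J_W q) n1 z \<tau>)"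
    by (intro sum.cong) auto
  also have "\<dots> = c * (\<Sum>n\<in>G. \<Sum>n1\<in>G. ell_term (n * J_W q) n1 z \<tau>)"
    by (simp add: sum_distrib_left)
  also have "(\<Sum>n\<in>G. \<Sum>n1\<in>G. ell_term (n * J_W q) n1 z \<tau>) = (\<Sum>n\<in>G. \<Sum>n1\<in>G. ell_term n n1 z \<tau>)"
    by (rule sum.reindex_bij_betw[OF bij_betw_mult_right[OF J_in_G], of "\<lambda>n. \<Sum>n1\<in>G. ell_term n n1 z \<tau>"])
  finally show ?thesis by (simp add: ell_sum_eq c_def)
qed

lemma ell_sum_inversion:
  assumes \<tau>: "Im \<tau> > 0"
  shows "ell_sum (z / \<tau>) (- 1 / \<tau>) = exp (\<i> * of_real pi * of_int chat * z\<^sup>2 / \<tau>) * ell_sum z \<tau>"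
proof -
  define c where "c = exp (\<i> * of_real pi * of_int chat * z\<^sup>2 / \<tau>)"
  have "ell_term n n1 (z / \<tau>) (- 1 / \<tau>) = c * ell_term n1 (vec_inv n) z \<tau>" if n: "n \<in> G" "n1 \<in> G" for n n1
  proof -
    have "(\<Prod>j\<in>UNIV. exp (\<i> * of_real pi * z\<^sup>2 / \<tau> * of_real (1 - 2 * \<kappa> j))) =
       exp (\<i> * of_real pi * z\<^sup>2 / \<tau> * of_real (\<Sum>j\<in>UNIV. 1 - 2 * \<kappa> j))"
      unfolding of_real_sum sum_distrib_left by (simp add: exp_sum)
    also have "\<dots> = c"
      unfolding sum_1_minus_2\<kappa> by (simp add: c_def mult_ac)
    finally have "(\<Prod>j\<in>UNIV. exp (\<i> * of_real pi * z\<^sup>2 / \<tau> * of_real (1 - 2 * \<kappa> j))) = c" .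
    moreover have "(\<Prod>j\<in>UNIV. ell_factor (\<kappa> j) (th n1 j) (- th n j) z \<tau>) = ell_term n1 (vec_inv n) z \<tau>"
      by (intro ell_term_congI \<tau> th_vec_inv n) auto
    ultimately show ?thesis
      unfolding ell_term_def[of n n1] ell_factor_inversion[OF \<tau>] prod.distrib by simp
  qed
  hence "(\<Sum>n\<in>G. \<Sum>n1\<in>G. ell_term n n1 (z / \<tau>) (- 1 / \<tau>)) = (\<Sum>n\<in>G. \<Sum>n1\<in>G. c * ell_term n1 (vec_inv n) z \<tau>)"
    by (intro sum.cong) auto
  also have "\<dots> = c * (\<Sum>n\<in>G. \<Sum>n1\<in>G. ell_term n1 (vec_inv n) z \<tau>)"
    by (simp add: sum_distrib_left)
  also have "(\<Sum>n\<in>G. \<Sum>n1\<in>G. ell_term n1 (vec_inv n) z \<tau>) = (\<Sum>n\<in>G. \<Sum>n1\<in>G. ell_term n1 n z \<tau>)"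
    by (rule sum.reindex_bij_betw[OF bij_betw_vec_inv, of "\<lambda>n. \<Sum>n1\<in>G. ell_term n1 n z \<tau>"])
  also have "\<dots> = (\<Sum>n\<in>G. \<Sum>n1\<in>G. ell_term n n1 z \<tau>)" by (rule sum.swap)
  finally show ?thesis by (simp add: ell_sum_eq c_def)
qed

text \<open>An identity for the defining formula under an affine change of \<open>z\<close> passes to the limit.\<close>
lemma Ell_transfer:
  assumes ne1: "\<And>j. \<kappa> j \<noteq> 1" and \<tau>: "Im \<tau> > 0" "Im \<tau>' > 0" and u: "u \<noteq> 0"
    and law: "\<And>w. ell_sum (u * w + v) \<tau>' = c w * ell_sum w \<tau>" and c: "isCont c z"
  shows "Ell q \<theta> G (u * z + v) \<tau>' = c z * Ell q \<theta> G z \<tau>"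
proof (rule tendsto_unique)
  have "filterlim (\<lambda>w. u * w + v) (at (u * z + v)) (at z)"
    using u by (intro filterlim_atI tendsto_intros)
      (auto simp: eventually_at_filter)
  from filterlim_compose[OF Ell_local(2)[OF \<tau>(2) ne1] this]
  show "((\<lambda>w. c w * ell_sum w \<tau>) \<longlongrightarrow> Ell q \<theta> G (u * z + v) \<tau>') (at z)"
    by (simp only: law)
  show "((\<lambda>w. c w * ell_sum w \<tau>) \<longlongrightarrow> c z * Ell q \<theta> G z \<tau>) (at z)"
    using c by (intro tendsto_mult Ell_local(2) \<tau> ne1) (simp add: isCont_def)
qed auto

lemma Ell_transformations:
  assumes ne1: "\<And>j. \<kappa> j \<noteq> 1" and \<tau>: "Im \<tau> > 0"
  shows "Ell q \<theta> G z (\<tau> + 1) = Ell q \<theta> G z \<tau>"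
    and "Ell q \<theta> G (z / \<tau>) (- 1 / \<tau>) = exp (\<i> * of_real pi * of_int chat * z\<^sup>2 / \<tau>) * Ell q \<theta> G z \<tau>"
    and "Ell q \<theta> G (z + 1) \<tau> = (- 1) powi chat * Ell q \<theta> G z \<tau>"
    and "Ell q \<theta> G (z + \<tau>) \<tau> = (- 1) powi chat * exp (- \<i> * of_real pi * of_int chat * (\<tau> + 2 * z)) * Ell q \<theta> G z \<tau>"
proof -
  have nz: "\<tau> \<noteq> 0" using \<tau> by auto
  have "Ell q \<theta> G (1 * z + 0) (\<tau> + 1) = 1 * Ell q \<theta> G z \<tau>"
  proof (rule Ell_transfer[OF ne1 \<tau>])
    fix w show "ell_sum (1 * w + 0) (\<tau> + 1) = 1 * ell_sum w \<tau>"
      using ell_sum_tau_plus_1[OF \<tau>, of w] by simp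
  qed (use \<tau> in auto)
  thus "Ell q \<theta> G z (\<tau> + 1) = Ell q \<theta> G z \<tau>" by simp
  have "Ell q \<theta> G (1 * z + 1) \<tau> = (- 1) powi chat * Ell q \<theta> G z \<tau>"
  proof (rule Ell_transfer[OF ne1 \<tau> \<tau>])
    fix w show "ell_sum (1 * w + 1) \<tau> = (- 1) powi chat * ell_sum w \<tau>"
      using ell_sum_z_plus_1[OF \<tau>, of w] by simp
  qed auto
  thus "Ell q \<theta> G (z + 1) \<tau> = (- 1) powi chat * Ell q \<theta> G z \<tau>" by simp
  have "Ell q \<theta> G (1 * z + \<tau>) \<tau> =
      (- 1) powi chat * exp (- \<i> * of_real pi * of_int chat * (\<tau> + 2 * z)) * Ell q \<theta> G z \<tau>"
  proof (rule Ell_transfer[OF ne1 \<tau> \<tau>])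
    fix w show "ell_sum (1 * w + \<tau>) \<tau> = (- 1) powi chat * exp (- \<i> * of_real pi * of_int chat * (\<tau> + 2 * w)) * ell_sum w \<tau>"
      using ell_sum_z_plus_tau[OF \<tau>, of w] by simp
  qed (auto intro!: continuous_intros)
  thus "Ell q \<theta> G (z + \<tau>) \<tau> = (- 1) powi chat * exp (- \<i> * of_real pi * of_int chat * (\<tau> + 2 * z)) * Ell q \<theta> G z \<tau>"
    by simp
  have "Ell q \<theta> G (1 / \<tau> * z + 0) (- 1 / \<tau>) = exp (\<i> * of_real pi * of_int chat * z\<^sup>2 / \<tau>) * Ell q \<theta> G z \<tau>"
  proof (rule Ell_transfer[OF ne1 \<tau> Im_neg_inverse_pos[OF \<tau>]])
    fix w show "ell_sum (1 / \<tau> * w + 0) (- 1 / \<tau>) = exp (\<i> * of_real pi * of_int chat * w\<^sup>2 / \<tau>) * ell_sum w \<tau>"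
      using ell_sum_inversion[OF \<tau>, of w] by simp
  qed (use nz in \<open>auto intro!: continuous_intros\<close>)
  thus "Ell q \<theta> G (z / \<tau>) (- 1 / \<tau>) = exp (\<i> * of_real pi * of_int chat * z\<^sup>2 / \<tau>) * Ell q \<theta> G z \<tau>"
    by simp
qed

lemma column_nonzero: "\<exists>i. A $ i $ j \<ge> 1"
proof -
  define M where "M = (\<chi> i j. of_nat (A $ i $ j) :: rat^'n^'n)"
  from inv obtain B where "B ** M = mat 1"
    by (auto simp: invertible_def M_def)
  hence "(B ** M) $ j $ j = 1" by (simp add: mat_def)
  hence "(\<Sum>i\<in>UNIV. B $ j $ i * M $ i $ j) \<noteq> 0"
    by (simp add: matrix_matrix_mult_def)
  then obtain i where "B $ j $ i * M $ i $ j \<noteq> 0"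
    by (rule sum.not_neutral_contains_not_neutral)
  hence "A $ i $ j \<ge> 1" by (simp add: M_def)
  thus ?thesis ..
qed

text \<open>A weight 1 forces the monomial \<open>x\<^sub>j\<close>, whence the angles \<open>\<theta>\<^sub>j\<close> are integers and the
  numerators \<open>\<Theta>(-\<theta>\<^sub>j(n) \<tau> - \<theta>\<^sub>j(n\<^sub>1), \<tau>)\<close> vanish.\<close>
lemma Ell_eq_0:
  assumes \<kappa>1: "\<kappa> j = 1" and \<tau>: "Im \<tau> > 0"
  shows "Ell q \<theta> G z \<tau> = 0"
proof -
  obtain i where Aij: "A $ i $ j \<ge> 1" using column_nonzero by blast
  have "1 = of_nat (A $ i $ j) * \<kappa> j + (\<Sum>k\<in>UNIV - {j}. of_nat (A $ i $ k) * \<kappa> k)"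
    using A_\<kappa>[of i] by (simp add: sum.remove[of _ j])
  moreover have nonneg: "of_nat (A $ i $ k) * \<kappa> k \<ge> 0" for k
    using \<kappa>_pos[of k] by simp
  hence "(\<Sum>k\<in>UNIV - {j}. of_nat (A $ i $ k) * \<kappa> k) \<ge> 0" by (intro sum_nonneg) auto
  ultimately have A1: "A $ i $ j = 1" and "(\<Sum>k\<in>UNIV - {j}. of_nat (A $ i $ k) * \<kappa> k) = 0"
    using Aij \<kappa>1 by auto
  hence "\<forall>k\<in>UNIV - {j}. of_nat (A $ i $ k) * \<kappa> k = 0"
    using nonneg by (subst (asm) sum_nonneg_eq_0_iff) auto
  hence A0: "A $ i $ k = 0" if "k \<noteq> j" for k
    using \<kappa>_pos[of k] that by auto
  have th: "th n j \<in> \<int>" if "n \<in> G" for n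
  proof -
    have "(\<Sum>k\<in>UNIV. of_nat (A $ i $ k) * th n k) = (\<Sum>k\<in>{j}. of_nat (A $ i $ k) * th n k)"
      by (intro sum.mono_neutral_right) (auto simp: A0)
    thus ?thesis using A_th_int[OF that, of i] by (simp add: A1)
  qed
  have "ell_term n n1 w \<tau> = 0" if "n \<in> G" "n1 \<in> G" for n n1 w
  proof -
    have "- (of_real (th n j) * \<tau> + of_real (th n1 j)) \<in> tau_lattice \<tau>"
      using th that by (intro tau_lattice_uminus tau_lattice_Ints_mult) (simp_all only: of_real_in_Ints_iff)
    hence "Theta ((1 - of_real (\<kappa> j)) * w - of_real (th n j) * \<tau> - of_real (th n1 j)) \<tau> = 0"
      using Theta_eq_0_iff[OF \<tau>] \<kappa>1 by simp
    hence "ell_factor (\<kappa> j) (th n j) (th n1 j) w \<tau> = 0" by (simp add: ell_factor_def)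
    thus ?thesis unfolding ell_term_def by (intro prod_zero) auto
  qed
  hence "ell_sum w \<tau> = 0" for w by (simp add: ell_sum_eq)
  thus ?thesis unfolding Ell_def by (simp add: remove_sings_eqI)
qed

end

section \<open>Boundedness at the cusp\<close>

lemma qprod_near_0:
  obtains \<delta> where "0 < \<delta>" "\<delta> < 1"
    "\<And>X Q. norm X < \<delta> \<Longrightarrow> norm Q < \<delta> \<Longrightarrow> 1/2 \<le> norm (qprod X Q) \<and> norm (qprod X Q) \<le> 3/2"
proof -
  have "isCont (\<lambda>(X, Q). qprod X Q) (0, 0)"
    by (intro holo2_isCont qprod_holo2) auto
  moreover have q0: "qprod 0 0 = 1" by (simp add: qprod_def)
  ultimately obtain d where d: "d > 0" "\<And>p. dist p (0, 0) < d \<Longrightarrow> dist (case p of (X, Q) \<Rightarrow> qprod X Q) 1 < 1/2"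
    unfolding continuous_at_eps_delta using half_gt_zero[OF zero_less_one] by (metis (no_types, lifting) case_prod_conv)
  have "1/2 \<le> norm (qprod X Q) \<and> norm (qprod X Q) \<le> 3/2" if "norm X < d / 2" "norm Q < d / 2" for X Q
  proof -
    have "dist (X, Q) (0, 0) \<le> norm X + norm Q"
      using sqrt_sum_squares_le_sum[of "norm X" "norm Q"] by (simp add: dist_Pair_Pair)
    with that have "dist (qprod X Q) 1 < 1/2" using d(2)[of "(X, Q)"] by simp
    thus ?thesis
      using norm_triangle_ineq2[of 1 "qprod X Q"] norm_triangle_ineq2[of "qprod X Q" 1]
      by (auto simp: dist_norm norm_minus_commute)
  qed
  thus ?thesis using d(1) by (intro that[of "min (d / 2) (1/2)"]) auto
qed

lemma norm_exp_2pi_i: "norm (exp (tpi * x)) = exp (- 2 * pi * Im x)"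
  by (simp add: norm_exp_eq_Re)

text \<open>When \<open>exp (2 \<pi> \<i> \<tau>)\<close> is small compared with \<open>exp (\<plusminus> 2 \<pi> \<i> x)\<close> for \<open>x = \<mu>, \<nu>\<close>, each infinite product
  has modulus between 1/2 and 3/2, and the quotient is governed by the leading factors of \<open>\<Theta>\<close>.\<close>
lemma Theta_quotient_bound:
  assumes \<delta>: "0 < \<delta>" "\<delta> < 1"
    and qp: "\<And>X Q. norm X < \<delta> \<Longrightarrow> norm Q < \<delta> \<Longrightarrow> 1/2 \<le> norm (qprod X Q) \<and> norm (qprod X Q) \<le> 3/2"
    and \<tau>: "Im \<tau> > 0" "exp (- 2 * pi * Im \<tau>) < \<delta>"
    and \<mu>: "exp (- 2 * pi * (Im \<tau> + Im \<mu>)) < \<delta>" "exp (- 2 * pi * (Im \<tau> - Im \<mu>)) < \<delta>"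
    and \<nu>: "exp (- 2 * pi * (Im \<tau> + Im \<nu>)) < \<delta>" "exp (- 2 * pi * (Im \<tau> - Im \<nu>)) < \<delta>"
    and pos: "Im \<nu> > 0"
  shows "norm (Theta \<mu> \<tau> / Theta \<nu> \<tau>) \<le>
    9 * (exp (pi * (Im \<mu> - Im \<nu>)) + exp (- pi * (Im \<mu> + Im \<nu>))) / (1 - exp (- 2 * pi * Im \<nu>))"
proof -
  define Q where "Q = exp (tpi * \<tau>)"
  have Q: "norm Q < \<delta>" using \<tau>(2) by (simp add: Q_def norm_exp_2pi_i)
  define R where "R = (\<lambda>x. qprod (Q * exp (tpi * x)) Q * qprod (Q * exp (neg_tpi * x)) Q)"
  define S where "S = (\<lambda>x. exp (- \<i> * of_real pi * x) * (1 - exp (tpi * x)))"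
  define c where "c = \<i> * exp (tpi * \<tau> / 8) * qprod Q Q"
  have Th: "Theta x \<tau> = c * S x * R x" for x
    unfolding Theta_conv_qprod[OF \<tau>(1)] Q_def[symmetric] by (simp add: c_def S_def R_def)
  have c0: "c \<noteq> 0" using qprod_self_nonzero[of Q] Q \<delta> by (simp add: c_def)
  have R: "1/4 \<le> norm (R x) \<and> norm (R x) \<le> 9/4"
    if "exp (- 2 * pi * (Im \<tau> + Im x)) < \<delta>" "exp (- 2 * pi * (Im \<tau> - Im x)) < \<delta>" for x
  proof -
    have "norm (Q * exp (tpi * x)) < \<delta>"
      using that(1) by (simp add: Q_def norm_exp_eq_Re ring_distribs flip: exp_add)
    note 1 = qp[OF this Q]
    have "norm (Q * exp (neg_tpi * x)) < \<delta>"
      using that(2) by (simp add: Q_def norm_exp_eq_Re ring_distribs flip: exp_add)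
    note 2 = qp[OF this Q]
    have "1/2 * (1/2) \<le> norm (R x)" "norm (R x) \<le> 3/2 * (3/2)"
      unfolding R_def norm_mult by (intro mult_mono; use 1 2 in linarith)+
    thus ?thesis by simp
  qed
  have S\<mu>: "norm (S \<mu>) \<le> exp (pi * Im \<mu>) + exp (- pi * Im \<mu>)"
  proof -
    have "S \<mu> = exp (- \<i> * of_real pi * \<mu>) - exp (\<i> * of_real pi * \<mu>)"
      by (simp add: S_def ring_distribs mult_ac flip: exp_add)
    also have "norm \<dots> \<le> norm (exp (- \<i> * of_real pi * \<mu>)) + norm (exp (\<i> * of_real pi * \<mu>))"
      by (rule norm_triangle_ineq4)
    finally show ?thesis by (simp add: norm_exp_eq_Re)
  qed
  define e where "e = exp (- 2 * pi * Im \<nu>)"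
  have e: "0 < 1 - e" using pos by (simp add: e_def)
  have S\<nu>: "norm (S \<nu>) \<ge> exp (pi * Im \<nu>) * (1 - e)"
  proof -
    have "1 - e \<le> norm (1 - exp (tpi * \<nu>))"
      using norm_triangle_ineq2[of 1 "exp (tpi * \<nu>)"] by (simp add: norm_exp_2pi_i e_def)
    thus ?thesis by (simp add: S_def norm_mult norm_exp_eq_Re)
  qed
  have "norm (Theta \<mu> \<tau> / Theta \<nu> \<tau>) = norm (S \<mu>) * norm (R \<mu>) / (norm (S \<nu>) * norm (R \<nu>))"
    using c0 by (simp add: Th norm_mult norm_divide)
  also have "\<dots> \<le> (exp (pi * Im \<mu>) + exp (- pi * Im \<mu>)) * (9/4) / ((exp (pi * Im \<nu>) * (1 - e)) * (1/4))"
    using R[OF \<mu>] R[OF \<nu>] S\<mu> S\<nu> e by (intro frac_le mult_mono mult_pos_pos) (auto intro!: mult_nonneg_nonneg)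
  also have "\<dots> = 9 * ((exp (pi * Im \<mu>) + exp (- pi * Im \<mu>)) / exp (pi * Im \<nu>)) / (1 - e)"
    using e by (simp add: field_simps)
  also have "(exp (pi * Im \<mu>) + exp (- pi * Im \<mu>)) / exp (pi * Im \<nu>) = exp (pi * (Im \<mu> - Im \<nu>)) + exp (- pi * (Im \<mu> + Im \<nu>))"
    by (simp add: add_divide_distrib ring_distribs exp_diff exp_add exp_minus divide_inverse)
  finally show ?thesis by (simp add: e_def)
qed

text \<open>Bounded on the open strip \<open>1/2 < Im z < 3/2\<close> for all sufficiently large \<open>Im \<tau>\<close>. The strip
  is a neighbourhood of the line \<open>Im z = 1\<close>, so that the bound passes to limits in \<open>z\<close>.\<close>
definition cusp_bounded :: "(complex \<Rightarrow> complex \<Rightarrow> complex) \<Rightarrow> bool" where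
  "cusp_bounded f \<longleftrightarrow> (\<exists>M. eventually (\<lambda>t. \<forall>z \<tau>. Im \<tau> = t \<and> 1/2 < Im z \<and> Im z < 3/2 \<longrightarrow> norm (f z \<tau>) \<le> M) at_top)"

lemma cusp_bounded_const: "cusp_bounded (\<lambda>_ _. c)"
  unfolding cusp_bounded_def by (intro exI[of _ "norm c"]) simp

lemma cusp_bounded_mult:
  assumes "cusp_bounded f" "cusp_bounded g"
  shows "cusp_bounded (\<lambda>z \<tau>. f z \<tau> * g z \<tau>)"
proof -
  from assms obtain M N where
    "eventually (\<lambda>t. \<forall>z \<tau>. Im \<tau> = t \<and> 1/2 < Im z \<and> Im z < 3/2 \<longrightarrow> norm (f z \<tau>) \<le> M) at_top"
    "eventually (\<lambda>t. \<forall>z \<tau>. Im \<tau> = t \<and> 1/2 < Im z \<and> Im z < 3/2 \<longrightarrow> norm (g z \<tau>) \<le> N) at_top"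
    unfolding cusp_bounded_def by blast
  hence "eventually (\<lambda>t. \<forall>z \<tau>. Im \<tau> = t \<and> 1/2 < Im z \<and> Im z < 3/2 \<longrightarrow> norm (f z \<tau> * g z \<tau>) \<le> M * N) at_top"
  proof eventually_elim
    case (elim t)
    show ?case
    proof (intro allI impI)
      fix z \<tau> assume *: "Im \<tau> = t \<and> 1/2 < Im z \<and> Im z < 3/2"
      with elim have "norm (f z \<tau>) \<le> M" "norm (g z \<tau>) \<le> N" by auto
      thus "norm (f z \<tau> * g z \<tau>) \<le> M * N"
        using order_trans[OF norm_ge_zero, of "f z \<tau>" M] by (simp add: norm_mult mult_mono)
    qed
  qed
  thus ?thesis unfolding cusp_bounded_def by blast
qed

lemma cusp_bounded_add:
  assumes "cusp_bounded f" "cusp_bounded g"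
  shows "cusp_bounded (\<lambda>z \<tau>. f z \<tau> + g z \<tau>)"
proof -
  from assms obtain M N where
    "eventually (\<lambda>t. \<forall>z \<tau>. Im \<tau> = t \<and> 1/2 < Im z \<and> Im z < 3/2 \<longrightarrow> norm (f z \<tau>) \<le> M) at_top"
    "eventually (\<lambda>t. \<forall>z \<tau>. Im \<tau> = t \<and> 1/2 < Im z \<and> Im z < 3/2 \<longrightarrow> norm (g z \<tau>) \<le> N) at_top"
    unfolding cusp_bounded_def by blast
  hence "eventually (\<lambda>t. \<forall>z \<tau>. Im \<tau> = t \<and> 1/2 < Im z \<and> Im z < 3/2 \<longrightarrow> norm (f z \<tau> + g z \<tau>) \<le> M + N) at_top"
    by eventually_elim (blast intro: norm_triangle_mono)
  thus ?thesis unfolding cusp_bounded_def by blast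
qed

lemma cusp_bounded_sum:
  "(\<And>i. i \<in> I \<Longrightarrow> cusp_bounded (f i)) \<Longrightarrow> cusp_bounded (\<lambda>z \<tau>. \<Sum>i\<in>I. f i z \<tau>)"
  by (induction I rule: infinite_finite_induct) (simp_all add: cusp_bounded_const cusp_bounded_add)

lemma cusp_bounded_prod:
  "(\<And>i. i \<in> I \<Longrightarrow> cusp_bounded (f i)) \<Longrightarrow> cusp_bounded (\<lambda>z \<tau>. \<Prod>i\<in>I. f i z \<tau>)"
  by (induction I rule: infinite_finite_induct) (simp_all add: cusp_bounded_const cusp_bounded_mult)

lemma cusp_bounded_cong:
  assumes "cusp_bounded f" "\<And>z \<tau>. Im \<tau> > 0 \<Longrightarrow> f z \<tau> = g z \<tau>"
  shows "cusp_bounded g"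
proof -
  from assms(1) obtain M where
    "eventually (\<lambda>t. \<forall>z \<tau>. Im \<tau> = t \<and> 1/2 < Im z \<and> Im z < 3/2 \<longrightarrow> norm (f z \<tau>) \<le> M) at_top"
    unfolding cusp_bounded_def by blast
  with eventually_gt_at_top[of 0]
  have "eventually (\<lambda>t. \<forall>z \<tau>. Im \<tau> = t \<and> 1/2 < Im z \<and> Im z < 3/2 \<longrightarrow> norm (g z \<tau>) \<le> M) at_top"
    by eventually_elim (use assms(2) in force)
  thus ?thesis unfolding cusp_bounded_def by blast
qed

text \<open>For \<open>0 \<le> a < 1\<close> the growth \<open>exp (\<pi> a Im \<tau>)\<close> of numerator and denominator is the same, and
  \<open>Im z > 1/2\<close> keeps the denominator away from its zeros in the case \<open>a = 0\<close>.\<close>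
lemma cusp_bounded_ell_factor_aux:
  assumes \<kappa>: "0 < \<kappa>" "\<kappa> < 1" and a: "0 \<le> a" "a < 1"
  shows "cusp_bounded (ell_factor \<kappa> a b)"
proof -
  obtain \<delta> where \<delta>: "0 < \<delta>" "\<delta> < 1" and
    qp: "\<And>X Q. norm X < \<delta> \<Longrightarrow> norm Q < \<delta> \<Longrightarrow> 1/2 \<le> norm (qprod X Q) \<and> norm (qprod X Q) \<le> 3/2"
    using qprod_near_0 by metis
  define K where "K = - ln \<delta>"
  have K: "K > 0" using \<delta> by (simp add: K_def)
  have exp_lt: "exp (- 2 * pi * x) < \<delta>" if "x \<ge> K" for x
  proof -
    have "1 * x < 2 * pi * x" using that K pi_gt3 by (intro mult_strict_right_mono) auto
    hence "- 2 * pi * x < ln \<delta>" using that by (simp add: K_def)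
    thus ?thesis using \<delta> by (metis exp_less_mono exp_ln)
  qed
  define T0 where "T0 = (K + 3/2) / (1 - a)"
  define M where "M = exp (3 * pi) * (9 * (exp (3 * pi) + 1) / (1 - exp (- pi * \<kappa>)))"
  have "norm (ell_factor \<kappa> a b z \<tau>) \<le> M" if t: "Im \<tau> \<ge> T0" "1/2 < Im z" "Im z < 3/2" for z \<tau>
  proof -
    define \<nu> where "\<nu> = of_real \<kappa> * z + of_real a * \<tau> + of_real b"
    define \<mu> where "\<mu> = (1 - of_real \<kappa>) * z - of_real a * \<tau> - of_real b"
    have I\<nu>: "Im \<nu> = \<kappa> * Im z + a * Im \<tau>" and I\<mu>: "Im \<mu> = Im z - \<kappa> * Im z - a * Im \<tau>"
      by (simp_all add: \<nu>_def \<mu>_def left_diff_distrib)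
    have "T0 > 0" using K a by (simp add: T0_def)
    hence \<tau>0: "Im \<tau> > 0" using t by simp
    have "(1 - a) * T0 = K + 3/2" using a by (simp add: T0_def)
    moreover have "(1 - a) * T0 \<le> (1 - a) * Im \<tau>" using a t by (intro mult_left_mono) auto
    ultimately have 1: "Im \<tau> - a * Im \<tau> \<ge> K + 3/2" by (simp add: left_diff_distrib)
    have 2: "a * Im \<tau> \<ge> 0" using a \<tau>0 by simp
    have 3: "0 < \<kappa> * Im z" "\<kappa> * Im z < Im z" using \<kappa> t by auto
    have 4: "\<kappa> * (1/2) \<le> \<kappa> * Im z" using \<kappa> t by (intro mult_left_mono) auto
    have "norm (Theta \<mu> \<tau> / Theta \<nu> \<tau>) \<le>
      9 * (exp (pi * (Im \<mu> - Im \<nu>)) + exp (- pi * (Im \<mu> + Im \<nu>))) / (1 - exp (- 2 * pi * Im \<nu>))"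
    proof (intro Theta_quotient_bound[OF \<delta> qp] exp_lt \<tau>0)
      show "K \<le> Im \<tau>" using 1 2 K by linarith
      show "K \<le> Im \<tau> + Im \<mu>" "K \<le> Im \<tau> - Im \<mu>" unfolding I\<mu> using 1 2 3 t by linarith+
      show "K \<le> Im \<tau> + Im \<nu>" "K \<le> Im \<tau> - Im \<nu>" "0 < Im \<nu>"
        unfolding I\<nu> using 1 2 3 t K by linarith+
    qed
    also have "\<dots> \<le> 9 * (exp (3 * pi) + 1) / (1 - exp (- pi * \<kappa>))"
    proof (intro frac_le mult_left_mono add_mono)
      have "pi * (Im \<mu> - Im \<nu>) \<le> pi * 3"
        using 2 3 t by (intro mult_left_mono) (auto simp: I\<mu> I\<nu>)
      thus "exp (pi * (Im \<mu> - Im \<nu>)) \<le> exp (3 * pi)" by (simp add: mult.commute)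
      have "0 \<le> pi * (Im \<mu> + Im \<nu>)" using t by (simp add: I\<mu> I\<nu>)
      thus "exp (- pi * (Im \<mu> + Im \<nu>)) \<le> 1" by simp
      have "pi * \<kappa> \<le> pi * (2 * Im \<nu>)" using 2 4 by (intro mult_left_mono) (auto simp: I\<nu>)
      thus "1 - exp (- pi * \<kappa>) \<le> 1 - exp (- 2 * pi * Im \<nu>)" by simp
      show "0 < 1 - exp (- pi * \<kappa>)" using \<kappa> by simp
    qed auto
    finally have q: "norm (Theta \<mu> \<tau> / Theta \<nu> \<tau>) \<le> 9 * (exp (3 * pi) + 1) / (1 - exp (- pi * \<kappa>))" .
    have "a * Im z \<le> 1 * (3/2)" using a t by (intro mult_mono) auto
    hence "pi * (2 * (a * Im z)) \<le> pi * 3" by (intro mult_left_mono) auto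
    hence e: "norm (exp (neg_tpi * z * of_real a)) \<le> exp (3 * pi)"
      by (simp add: norm_exp_eq_Re mult_ac)
    have "norm (ell_factor \<kappa> a b z \<tau>) = norm (exp (neg_tpi * z * of_real a)) * norm (Theta \<mu> \<tau> / Theta \<nu> \<tau>)"
      unfolding ell_factor_def \<mu>_def \<nu>_def norm_mult ..
    also have "\<dots> \<le> M" unfolding M_def by (intro mult_mono e q) auto
    finally show ?thesis .
  qed
  hence "\<forall>z \<tau>. Im \<tau> = t \<and> 1/2 < Im z \<and> Im z < 3/2 \<longrightarrow> norm (ell_factor \<kappa> a b z \<tau>) \<le> M" if "t \<ge> T0" for t
    using that by blast
  thus ?thesis unfolding cusp_bounded_def eventually_at_top_linorder by blast
qed

lemma cusp_bounded_ell_factor: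
  assumes "0 < \<kappa>" "\<kappa> < 1"
  shows "cusp_bounded (ell_factor \<kappa> a b)"
proof (rule cusp_bounded_cong)
  show "cusp_bounded (ell_factor \<kappa> (frac a) b)"
    by (intro cusp_bounded_ell_factor_aux assms frac_ge_0 frac_lt_1)
  show "ell_factor \<kappa> (frac a) b z \<tau> = ell_factor \<kappa> a b z \<tau>" if "Im \<tau> > 0" for z \<tau>
    by (intro ell_factor_cong that) (auto simp: frac_def)
qed

context LG_orbifold
begin

lemma \<kappa>_le_1: "\<kappa> j \<le> 1"
proof -
  obtain i where "A $ i $ j \<ge> 1" using column_nonzero by blast
  hence "1 \<le> real (A $ i $ j)" by simp
  hence "1 * \<kappa> j \<le> of_nat (A $ i $ j) * \<kappa> j" using \<kappa>_pos[of j] by (intro mult_right_mono) auto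
  also have "\<dots> \<le> (\<Sum>k\<in>UNIV. of_nat (A $ i $ k) * \<kappa> k)"
    by (rule member_le_sum) (auto intro!: mult_nonneg_nonneg less_imp_le[OF \<kappa>_pos])
  finally show ?thesis by (simp add: A_\<kappa>)
qed

lemma Ell_bounded:
  assumes ne1: "\<And>j. \<kappa> j \<noteq> 1"
  obtains M T0 where "T0 > 0" "\<And>z \<tau>. Im \<tau> \<ge> T0 \<Longrightarrow> Im z = 1 \<Longrightarrow> norm (Ell q \<theta> G z \<tau>) \<le> M"
proof -
  have lt1: "\<kappa> j < 1" for j using \<kappa>_le_1[of j] ne1[of j] by simp
  have "cusp_bounded ell_sum"
    unfolding ell_sum_eq ell_term_def
    by (intro cusp_bounded_mult cusp_bounded_const cusp_bounded_sum cusp_bounded_prod cusp_bounded_ell_factor \<kappa>_pos lt1)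
  then obtain M where
    "eventually (\<lambda>t. \<forall>z \<tau>. Im \<tau> = t \<and> 1/2 < Im z \<and> Im z < 3/2 \<longrightarrow> norm (ell_sum z \<tau>) \<le> M) at_top"
    unfolding cusp_bounded_def by blast
  then obtain T1 where T1: "\<And>t z \<tau>. t \<ge> T1 \<Longrightarrow> Im \<tau> = t \<and> 1/2 < Im z \<and> Im z < 3/2 \<Longrightarrow> norm (ell_sum z \<tau>) \<le> M"
    unfolding eventually_at_top_linorder by blast
  have "norm (Ell q \<theta> G z \<tau>) \<le> M" if "Im \<tau> \<ge> max 1 T1" "Im z = 1" for z \<tau>
  proof (rule tendsto_upperbound)
    show "((\<lambda>w. norm (ell_sum w \<tau>)) \<longlongrightarrow> norm (Ell q \<theta> G z \<tau>)) (at z)"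
      by (intro tendsto_norm Ell_local(2) ne1) (use that in auto)
    have "eventually (\<lambda>w. 1/2 < Im w) (at z)" "eventually (\<lambda>w. Im w < 3/2) (at z)"
      by (intro order_tendstoD[of Im "Im z"] tendsto_intros; use that in simp)+
    thus "eventually (\<lambda>w. norm (ell_sum w \<tau>) \<le> M) (at z)"
      by eventually_elim (use T1[of "Im \<tau>" \<tau>] that in auto)
  qed auto
  thus ?thesis by (intro that[of "max 1 T1" M]) auto
qed

end

section \<open>Fourier expansion of periodic holomorphic functions\<close>

text \<open>The horizontal strip over an interval \<open>J\<close>; the plane and the upper half plane are the
  cases \<open>J = \<real>\<close> and \<open>J = (0, \<infinity>)\<close>.\<close>
definition strip :: "real set \<Rightarrow> complex set" where
  "strip J = {z. Im z \<in> J}"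

lemma open_strip: "open J \<Longrightarrow> open (strip J)"
  using open_vimage[of J Im] continuous_on_Im[OF continuous_on_id] by (simp add: strip_def vimage_def)

lemma convex_strip: "convex J \<Longrightarrow> convex (strip J)"
  unfolding strip_def convex_alt by (auto simp: scaleR_conv_of_real)

text \<open>The \<open>l\<close>-th Fourier coefficient of a function of period 1, computed at height \<open>s\<close>.\<close>
definition fcoeff :: "(complex \<Rightarrow> complex) \<Rightarrow> real \<Rightarrow> int \<Rightarrow> complex" where
  "fcoeff f s l = integral {0..1} (\<lambda>x. f (of_real x + \<i> * of_real s) *
     exp (neg_tpi * of_int l * (of_real x + \<i> * of_real s)))"

lemma has_integral_horizontal:
  assumes "\<And>x. x \<in> {0..1} \<Longrightarrow> (P has_field_derivative g (of_real x + \<i> * of_real s)) (at (of_real x + \<i> * of_real s))"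
  shows "((\<lambda>x. g (of_real x + \<i> * of_real s)) has_integral (P (1 + \<i> * of_real s) - P (\<i> * of_real s))) {0..1}"
proof -
  have "((\<lambda>x. g (of_real x + \<i> * of_real s)) has_integral
      ((\<lambda>x. P (of_real x + \<i> * of_real s)) 1 - (\<lambda>x. P (of_real x + \<i> * of_real s)) 0)) {0..1}"
  proof (rule fundamental_theorem_of_calculus)
    fix x :: real assume x: "x \<in> {0..1}"
    have "((\<lambda>x. of_real x + \<i> * of_real s) has_vector_derivative 1) (at x)"
      by (auto intro!: derivative_eq_intros simp: has_vector_derivative_def scaleR_conv_of_real)
    from field_vector_diff_chain_at[OF this assms[OF x]]
    show "((\<lambda>x. P (of_real x + \<i> * of_real s)) has_vector_derivative g (of_real x + \<i> * of_real s)) (at x within {0..1})"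
      by (auto simp: o_def intro: has_vector_derivative_at_within)
  qed auto
  thus ?thesis by simp
qed

text \<open>With a primitive \<open>P\<close> of \<open>g\<close>, the integral is a value of \<open>P(z + 1) - P(z)\<close>, which has
  derivative 0.\<close>
lemma has_integral_periodic_const:
  assumes J: "open J" "convex J" and g: "g holomorphic_on strip J"
    and per: "\<And>z. z \<in> strip J \<Longrightarrow> g (z + 1) = g z"
  obtains c where "\<And>s. s \<in> J \<Longrightarrow> ((\<lambda>x. g (of_real x + \<i> * of_real s)) has_integral c) {0..1}"
proof -
  note op = open_strip[OF J(1)] and cv = convex_strip[OF J(2)]
  obtain P where "\<And>z. z \<in> strip J \<Longrightarrow> (P has_field_derivative g z) (at z within strip J)"
    using holomorphic_convex_primitive'[OF cv op g] by metis
  hence P: "(P has_field_derivative g z) (at z)" if "z \<in> strip J" for z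
    using that op by (metis at_within_open)
  have shift: "z + 1 \<in> strip J" if "z \<in> strip J" for z
    using that by (simp add: strip_def)
  have "((\<lambda>z. P (z + 1) - P z) has_field_derivative 0) (at z within strip J)" if z: "z \<in> strip J" for z
  proof -
    have "((\<lambda>z. P (z + 1)) has_field_derivative g (z + 1)) (at z)"
      using DERIV_shift[of P "g (z + 1)" z 1] P[OF shift[OF z]] by (simp add: add.commute)
    from DERIV_diff[OF this P[OF z]] show ?thesis
      by (simp add: per[OF z] has_field_derivative_at_within)
  qed
  from has_field_derivative_zero_constant[OF cv this]
  obtain c where c: "\<And>z. z \<in> strip J \<Longrightarrow> P (z + 1) - P z = c" by blast
  have "((\<lambda>x. g (of_real x + \<i> * of_real s)) has_integral c) {0..1}" if s: "s \<in> J" for s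
  proof -
    have "((\<lambda>x. g (of_real x + \<i> * of_real s)) has_integral (P (1 + \<i> * of_real s) - P (\<i> * of_real s))) {0..1}"
      by (intro has_integral_horizontal P) (use s in \<open>simp add: strip_def\<close>)
    also have "P (1 + \<i> * of_real s) - P (\<i> * of_real s) = c"
      using c[of "\<i> * of_real s"] s by (simp add: strip_def add.commute)
    finally show ?thesis .
  qed
  thus ?thesis by (rule that)
qed

lemma exp_int_shift: "exp (c * of_int l * (z + 1)) = exp (c * of_int l * z)"
  if "c = - 2 * of_real pi * \<i> \<or> c = tpi" for z :: complex
proof -
  have "exp (c * of_int l) = 1"
    using that exp_2pi_i_eq_1_iff[of "of_int l"] exp_2pi_i_eq_1_iff[of "of_int (- l)"] by auto
  thus ?thesis by (simp add: ring_distribs exp_add)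
qed

lemma fcoeff_has_integral:
  assumes J: "open J" "convex J" and f: "f holomorphic_on strip J"
    and per: "\<And>z. z \<in> strip J \<Longrightarrow> f (z + 1) = f z" and s: "s \<in> J"
  shows "((\<lambda>x. f (of_real x + \<i> * of_real s) *
     exp (neg_tpi * of_int l * (of_real x + \<i> * of_real s))) has_integral fcoeff f s l) {0..1}"
    and "s' \<in> J \<Longrightarrow> fcoeff f s l = fcoeff f s' l"
proof -
  define g where "g = (\<lambda>z. f z * exp (neg_tpi * of_int l * z))"
  have "g holomorphic_on strip J" unfolding g_def by (intro holomorphic_intros f)
  moreover have "g (z + 1) = g z" if "z \<in> strip J" for z
    unfolding g_def using per[OF that] exp_int_shift[of "neg_tpi" l z] by simp
  ultimately obtain c where c: "\<And>s. s \<in> J \<Longrightarrow> ((\<lambda>x. g (of_real x + \<i> * of_real s)) has_integral c) {0..1}"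
    using has_integral_periodic_const[OF J] by metis
  have fc: "fcoeff f s l = c" if "s \<in> J" for s
    unfolding fcoeff_def using integral_unique[OF c[OF that]] by (simp add: g_def)
  show "((\<lambda>x. f (of_real x + \<i> * of_real s) *
     exp (neg_tpi * of_int l * (of_real x + \<i> * of_real s))) has_integral fcoeff f s l) {0..1}"
    using c[OF s] fc[OF s] by (simp add: g_def)
  show "s' \<in> J \<Longrightarrow> fcoeff f s l = fcoeff f s' l" using fc s by simp
qed

lemma norm_fcoeff_le:
  assumes J: "open J" "convex J" and f: "f holomorphic_on strip J"
    and per: "\<And>z. z \<in> strip J \<Longrightarrow> f (z + 1) = f z" and s: "s \<in> J"
    and K: "\<And>x. x \<in> {0..1} \<Longrightarrow> norm (f (of_real x + \<i> * of_real s)) \<le> K"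
  shows "norm (fcoeff f s l) \<le> K * exp (2 * pi * of_int l * s)"
proof -
  have "0 \<le> K" using order_trans[OF norm_ge_zero K[of 0]] by simp
  have "norm (fcoeff f s l) \<le> (K * exp (2 * pi * of_int l * s)) * measure lborel {0..1::real}"
  proof (rule has_integral_bound_real[OF _ finite.emptyI fcoeff_has_integral(1)[OF J f per s]])
    fix x :: real assume "x \<in> {0..1} - {}"
    thus "norm (f (of_real x + \<i> * of_real s) *
     exp (neg_tpi * of_int l * (of_real x + \<i> * of_real s))) \<le> K * exp (2 * pi * of_int l * s)"
      using K[of x] by (simp add: norm_mult norm_exp_eq_Re)
  qed (use \<open>0 \<le> K\<close> in auto)
  thus ?thesis by simp
qed

lemma fcoeff_const_1: "fcoeff (\<lambda>_. 1) s l = (if l = 0 then 1 else 0)"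
proof (cases "l = 0")
  case True
  thus ?thesis by (simp add: fcoeff_def)
next
  case False
  let ?c = "neg_tpi * of_int l"
  have "((\<lambda>x. exp (?c * (of_real x + \<i> * of_real s))) has_integral
      ((\<lambda>w. exp (?c * w) / ?c) (1 + \<i> * of_real s) - (\<lambda>w. exp (?c * w) / ?c) (\<i> * of_real s))) {0..1}"
    using False by (intro has_integral_horizontal) (auto intro!: derivative_eq_intros)
  moreover have "exp (?c * (1 + \<i> * of_real s)) = exp (?c * (\<i> * of_real s))"
    using exp_int_shift[of "neg_tpi" l "\<i> * of_real s"] by (simp add: add.commute)
  ultimately have "((\<lambda>x. exp (?c * (of_real x + \<i> * of_real s))) has_integral 0) {0..1}" by simp
  thus ?thesis using False unfolding fcoeff_def by (simp add: integral_unique)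
qed

lemma summable_on_int_geometric:
  assumes r: "0 \<le> r" "r < (1 :: real)"
  shows "(\<lambda>l :: int. r ^ nat \<bar>l\<bar>) summable_on UNIV"
proof -
  have g: "(\<lambda>n. r ^ n) summable_on UNIV"
    using r by (subst summable_on_UNIV_nonneg_real_iff) (auto intro: summable_geometric)
  have "(\<lambda>l :: int. r ^ nat \<bar>l\<bar>) summable_on (range int)"
    by (subst summable_on_reindex) (auto simp: o_def g intro: inj_onI)
  moreover have "(\<lambda>l :: int. r ^ nat \<bar>l\<bar>) summable_on (range (\<lambda>n. - 1 - int n))"
  proof (subst summable_on_reindex)
    have "(\<lambda>n. r * r ^ n) summable_on UNIV" by (intro summable_on_cmult_right g)
    moreover have "nat \<bar>- 1 - int n\<bar> = Suc n" for n by simp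
    ultimately show "((\<lambda>l :: int. r ^ nat \<bar>l\<bar>) \<circ> (\<lambda>n. - 1 - int n)) summable_on UNIV"
      by (simp only: o_def power_Suc)
  qed (auto intro: inj_onI)
  moreover have "range int \<inter> range (\<lambda>n. - 1 - int n) = {}" by auto
  ultimately have "(\<lambda>l :: int. r ^ nat \<bar>l\<bar>) summable_on (range int \<union> range (\<lambda>n. - 1 - int n))"
    by (rule summable_on_Un_disjoint)
  moreover have "range int \<union> range (\<lambda>n. - 1 - int n) = UNIV"
  proof (intro equalityI subset_UNIV subsetI)
    fix l :: int
    show "l \<in> range int \<union> range (\<lambda>n. - 1 - int n)"
    proof (cases "l \<ge> 0")
      case True
      hence "l = int (nat l)" by simp
      thus ?thesis by blast
    next
      case False
      hence "l = - 1 - int (nat (- 1 - l))" by simp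
      thus ?thesis by blast
    qed
  qed
  ultimately show ?thesis by simp
qed

text \<open>Bounds for a coefficient at the heights \<open>y - \<epsilon>\<close> and \<open>y + \<epsilon>\<close> give geometric decay, in both
  directions, of the terms of the series at height \<open>y\<close>.\<close>
lemma exp_two_sided_le:
  assumes "x \<le> K * exp (2 * pi * of_int l * (y - \<epsilon>))" "x \<le> K * exp (2 * pi * of_int l * (y + \<epsilon>))"
  shows "x * exp (- 2 * pi * of_int l * y) \<le> K * exp (- 2 * pi * \<epsilon>) ^ nat \<bar>l\<bar>"
proof (cases "l \<ge> 0")
  case True
  have "x * exp (- 2 * pi * of_int l * y) \<le> K * exp (2 * pi * of_int l * (y - \<epsilon>)) * exp (- 2 * pi * of_int l * y)"
    by (intro mult_right_mono assms) auto
  also have "\<dots> = K * exp (of_nat (nat \<bar>l\<bar>) * (- 2 * pi * \<epsilon>))"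
    using True by (simp add: algebra_simps flip: exp_add)
  finally show ?thesis by (simp only: exp_of_nat_mult)
next
  case False
  have "x * exp (- 2 * pi * of_int l * y) \<le> K * exp (2 * pi * of_int l * (y + \<epsilon>)) * exp (- 2 * pi * of_int l * y)"
    by (intro mult_right_mono assms) auto
  also have "\<dots> = K * exp (of_nat (nat \<bar>l\<bar>) * (- 2 * pi * \<epsilon>))"
    using False by (simp add: algebra_simps flip: exp_add)
  finally show ?thesis by (simp only: exp_of_nat_mult)
qed

lemma bounded_on_segment:
  assumes "continuous_on (strip J) f" "s \<in> J"
  obtains K where "\<And>x. x \<in> {0..1} \<Longrightarrow> norm (f (of_real x + \<i> * of_real s)) \<le> K"
proof -
  have "continuous_on {0..1} (\<lambda>x::real. f (of_real x + \<i> * of_real s))"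
    by (intro continuous_on_compose2[OF assms(1)] continuous_intros) (use assms(2) in \<open>auto simp: strip_def\<close>)
  hence "bounded ((\<lambda>x::real. f (of_real x + \<i> * of_real s)) ` {0..1})"
    by (intro compact_imp_bounded compact_continuous_image) auto
  then obtain K where K: "\<forall>x\<in>{0..1}. norm (f (of_real x + \<i> * of_real s)) \<le> K"
    unfolding bounded_iff by blast
  show ?thesis by (rule that) (use K in blast)
qed

lemma fcoeff_summable:
  assumes J: "open J" "convex J" and f: "f holomorphic_on strip J"
    and per: "\<And>z. z \<in> strip J \<Longrightarrow> f (z + 1) = f z" and s: "s \<in> J" and z: "z \<in> strip J"
  shows "(\<lambda>l. norm (fcoeff f s l * exp (tpi * of_int l * z))) summable_on UNIV"
proof -
  have "Im z \<in> J" using z by (simp add: strip_def)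
  then obtain \<epsilon> where \<epsilon>: "\<epsilon> > 0" "cball (Im z) \<epsilon> \<subseteq> J"
    using J(1) open_contains_cball by blast
  hence e: "Im z - \<epsilon> \<in> J" "Im z + \<epsilon> \<in> J" by (auto simp: subset_iff dist_real_def)
  note c = holomorphic_on_imp_continuous_on[OF f]
  obtain K1 where K1: "\<And>x. x \<in> {0..1} \<Longrightarrow> norm (f (of_real x + \<i> * of_real (Im z - \<epsilon>))) \<le> K1"
    using bounded_on_segment[OF c e(1)] by blast
  obtain K2 where K2: "\<And>x. x \<in> {0..1} \<Longrightarrow> norm (f (of_real x + \<i> * of_real (Im z + \<epsilon>))) \<le> K2"
    using bounded_on_segment[OF c e(2)] by blast
  define K where "K = max K1 K2"
  have "norm (fcoeff f s l * exp (tpi * of_int l * z)) \<le> K * exp (- 2 * pi * \<epsilon>) ^ nat \<bar>l\<bar>" for l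
  proof -
    have "norm (fcoeff f s l) \<le> K * exp (2 * pi * of_int l * (Im z - \<epsilon>))"
    proof -
      have "norm (fcoeff f (Im z - \<epsilon>) l) \<le> K * exp (2 * pi * of_int l * (Im z - \<epsilon>))"
      proof (rule norm_fcoeff_le[OF J f per e(1)])
        fix x :: real assume "x \<in> {0..1}"
        from K1[OF this] show "norm (f (of_real x + \<i> * of_real (Im z - \<epsilon>))) \<le> K"
          by (simp add: K_def)
      qed
      moreover have "fcoeff f s l = fcoeff f (Im z - \<epsilon>) l"
        by (rule fcoeff_has_integral(2)[OF J f per s e(1)])
      ultimately show ?thesis by simp
    qed
    moreover have "norm (fcoeff f s l) \<le> K * exp (2 * pi * of_int l * (Im z + \<epsilon>))"
    proof -
      have "norm (fcoeff f (Im z + \<epsilon>) l) \<le> K * exp (2 * pi * of_int l * (Im z + \<epsilon>))"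
      proof (rule norm_fcoeff_le[OF J f per e(2)])
        fix x :: real assume "x \<in> {0..1}"
        from K2[OF this] show "norm (f (of_real x + \<i> * of_real (Im z + \<epsilon>))) \<le> K"
          by (simp add: K_def)
      qed
      moreover have "fcoeff f s l = fcoeff f (Im z + \<epsilon>) l"
        by (rule fcoeff_has_integral(2)[OF J f per s e(2)])
      ultimately show ?thesis by simp
    qed
    ultimately show ?thesis
      using exp_two_sided_le[of "norm (fcoeff f s l)" K l "Im z" \<epsilon>] by (simp add: norm_mult norm_exp_eq_Re)
  qed
  moreover have "(\<lambda>l::int. K * exp (- 2 * pi * \<epsilon>) ^ nat \<bar>l\<bar>) summable_on UNIV"
    using \<epsilon> by (intro summable_on_cmult_right summable_on_int_geometric) auto
  ultimately show ?thesis by (intro Infinite_Sum.abs_summable_on_comparison_test') auto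
qed

lemma exp_quot_eq_0_iff: "exp_quot w = 0 \<longleftrightarrow> w \<in> \<int> \<and> w \<noteq> 0"
  using exp_2pi_i_eq_1_iff[of w] by (auto simp: exp_quot_def)

lemma periodic_difference_quotient:
  assumes J: "open J" and f: "f holomorphic_on strip J"
    and per: "\<And>z. z \<in> strip J \<Longrightarrow> f (z + 1) = f z" and z0: "z0 \<in> strip J"
  obtains quot where "quot holomorphic_on strip J" "\<And>z. z \<in> strip J \<Longrightarrow> quot (z + 1) = quot z"
    "\<And>z. z \<in> strip J \<Longrightarrow> f z = f z0 + quot z * (exp (tpi * (z - z0)) - 1)"
proof -
  note op = open_strip[OF J]
  let ?h = "\<lambda>z. if z = z0 then deriv f z0 else (f z - f z0) / (z - z0)"
  have h: "?h holomorphic_on strip J" by (rule pole_lemma_open[OF f op])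
  define quot where "quot = (\<lambda>z. if z - z0 \<in> \<int> then - deriv f z0 / exp_quot 0
      else (f z - f z0) / (exp (tpi * (z - z0)) - 1))"
  have shift: "z + 1 \<in> strip J \<longleftrightarrow> z \<in> strip J" for z
    by (simp add: strip_def)
  have eI: "exp (tpi * (z - z0)) = 1 \<longleftrightarrow> z - z0 \<in> \<int>" for z
    by (rule exp_2pi_i_eq_1_iff)
  have zI: "z + 1 - z0 \<in> \<int> \<longleftrightarrow> z - z0 \<in> \<int>" for z
    using Ints_add[of "z - z0" 1] Ints_diff[of "z + 1 - z0" 1] by (auto simp: algebra_simps)
  have quot1: "quot (z + 1) = quot z" if "z \<in> strip J" for z
  proof -
    have "exp (tpi * (z + 1 - z0)) = exp (tpi * (z - z0))"
      using exp_shift_1[of "z - z0"] by (simp add: algebra_simps)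
    thus ?thesis unfolding quot_def zI per[OF that] by simp
  qed
  have stm: "z + of_int m \<in> strip J \<longleftrightarrow> z \<in> strip J" for z m by (simp add: strip_def)
  have quotm: "quot (z + of_int m) = quot z" if z: "z \<in> strip J" for z m
  proof (induction m rule: int_induct[where k = 0])
    case (step1 i)
    thus ?case using quot1[of "z + of_int i"] z stm[of z i] by (simp add: add_ac)
  next
    case (step2 i)
    thus ?case using quot1[of "z + of_int (i - 1)"] z stm[of z "i - 1"] by simp
  qed auto
  have fm: "f (z + of_int m) = f z" if z: "z \<in> strip J" for z m
  proof (induction m rule: int_induct[where k = 0])
    case (step1 i)
    thus ?case using per[of "z + of_int i"] z stm[of z i] by (simp add: add_ac)
  next
    case (step2 i)
    thus ?case using per[of "z + of_int (i - 1)"] z stm[of z "i - 1"] by simp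
  qed auto
  have d0: "quot field_differentiable at z0"
  proof (rule field_differentiable_transform_nhds)
    have "?h field_differentiable at z0"
      using h op z0 holomorphic_on_imp_differentiable_at by blast
    moreover have eq: "(\<lambda>w. exp_quot (w - z0)) field_differentiable at z0"
      using field_differentiable_compose[OF field_differentiable_diff[OF field_differentiable_ident
            field_differentiable_const] exp_quot_field_differentiable, of z0 z0]
      by (simp add: o_def)
    moreover have nz: "exp_quot (z0 - z0) \<noteq> 0" by (simp add: exp_quot_def)
    ultimately show "(\<lambda>w. - ?h w / exp_quot (w - z0)) field_differentiable at z0"
      by (intro field_differentiable_divide field_differentiable_minus)
    have "eventually (\<lambda>w. exp_quot (w - z0) \<noteq> 0) (nhds z0)"
      by (intro eventually_nonzero_isCont field_differentiable_imp_continuous_at eq nz)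
    thus "eventually (\<lambda>w. - ?h w / exp_quot (w - z0) = quot w) (nhds z0)"
    proof eventually_elim
      case (elim w)
      show ?case
      proof (cases "w = z0")
        case True
        thus ?thesis by (simp add: quot_def)
      next
        case False
        hence "w - z0 \<notin> \<int>" using elim exp_quot_eq_0_iff by simp
        moreover from this have "exp (tpi * (w - z0)) \<noteq> 1" by (simp add: eI)
        ultimately show ?thesis using False
          by (simp add: quot_def exp_quot_def divide_simps) (simp add: ring_distribs)
      qed
    qed
  qed
  have "quot field_differentiable at z" if z: "z \<in> strip J" for z
  proof (cases "z - z0 \<in> \<int>")
    case True
    then obtain m where m: "z - z0 = of_int m" by (elim Ints_cases)
    hence z0z: "z0 = z + of_int (- m)" by (simp add: algebra_simps)
    show ?thesis
    proof (rule field_differentiable_transform_nhds)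
      show "(\<lambda>w. quot (w + of_int (- m))) field_differentiable at z"
        using field_differentiable_compose[OF field_differentiable_add[OF field_differentiable_ident
              field_differentiable_const], of quot z "of_int (- m)"] d0[unfolded z0z]
        by (simp only: o_def)
      have "eventually (\<lambda>w. w \<in> strip J) (nhds z)" using op z by (rule eventually_nhds_in_open)
      thus "eventually (\<lambda>w. quot (w + of_int (- m)) = quot w) (nhds z)"
        by eventually_elim (rule quotm)
    qed
  next
    case False
    have nz: "exp (tpi * (z - z0)) - 1 \<noteq> 0" using False by (simp add: eI)
    have ed: "(\<lambda>w. exp (tpi * (w - z0)) - 1) field_differentiable at z"
      by (intro holomorphic_on_imp_differentiable_at[of _ UNIV] holomorphic_intros) auto
    show ?thesis
    proof (rule field_differentiable_transform_nhds)
      have "f field_differentiable at z" using f op z holomorphic_on_imp_differentiable_at by blast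
      thus "(\<lambda>w. (f w - f z0) / (exp (tpi * (w - z0)) - 1)) field_differentiable at z"
        by (intro field_differentiable_divide field_differentiable_diff field_differentiable_const ed nz)
      have "eventually (\<lambda>w. exp (tpi * (w - z0)) - 1 \<noteq> 0) (nhds z)"
        by (intro eventually_nonzero_isCont field_differentiable_imp_continuous_at ed nz)
      thus "eventually (\<lambda>w. (f w - f z0) / (exp (tpi * (w - z0)) - 1) = quot w) (nhds z)"
        by eventually_elim (auto simp: quot_def eI)
    qed
  qed
  hence hol: "quot holomorphic_on strip J"
    by (auto simp: holomorphic_on_def field_differentiable_at_within)
  have eq: "f z = f z0 + quot z * (exp (tpi * (z - z0)) - 1)" if z: "z \<in> strip J" for z
  proof (cases "z - z0 \<in> \<int>")
    case True
    then obtain m where m: "z - z0 = of_int m" by (elim Ints_cases)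
    hence "f z = f (z0 + of_int m)" by (simp add: algebra_simps)
    thus ?thesis using fm[OF z0] True by (simp add: eI[THEN iffD2])
  next
    case False
    thus ?thesis using eI[of z] by (simp add: quot_def)
  qed
  show ?thesis by (rule that[OF hol quot1 eq])
qed

text \<open>Write \<open>f(z) - f(z\<^sub>0) = quot(z) (exp (2 \<pi> \<i> (z - z\<^sub>0)) - 1)\<close>. Up to the constant term \<open>f(z\<^sub>0)\<close>, the terms of
  the series of \<open>f\<close> at \<open>z\<^sub>0\<close> are then differences of consecutive terms of the summable series of
  \<open>quot\<close> at \<open>z\<^sub>0\<close>, so their sum telescopes to 0.\<close>
lemma has_sum_fcoeff:
  assumes J: "open J" "convex J" and f: "f holomorphic_on strip J"
    and per: "\<And>z. z \<in> strip J \<Longrightarrow> f (z + 1) = f z" and s: "s \<in> J" and z0: "z0 \<in> strip J"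
  shows "((\<lambda>l. fcoeff f s l * exp (tpi * of_int l * z0)) has_sum f z0) UNIV"
proof -
  obtain quot where quot: "quot holomorphic_on strip J" "\<And>z. z \<in> strip J \<Longrightarrow> quot (z + 1) = quot z"
    "\<And>z. z \<in> strip J \<Longrightarrow> f z = f z0 + quot z * (exp (tpi * (z - z0)) - 1)"
    using periodic_difference_quotient[OF J(1) f per z0] by blast
  define e where "e = (\<lambda>l::int. \<lambda>w. exp (tpi * of_int l * w))"
  define d where "d = (\<lambda>l. fcoeff quot s l * e l z0)"
  note I = fcoeff_has_integral(1)[OF J _ _ s]
  have rec: "fcoeff f s l = f z0 * fcoeff (\<lambda>_. 1) s l + exp (neg_tpi * z0) * fcoeff quot s (l - 1) - fcoeff quot s l" for l
  proof -
    let ?w = "\<lambda>x::real. of_real x + \<i> * of_real s :: complex"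
    let ?g = "\<lambda>x. f z0 * (1 * exp (neg_tpi * of_int l * ?w x)) +
        exp (neg_tpi * z0) * (quot (?w x) * exp (neg_tpi * of_int (l - 1) * ?w x)) -
        quot (?w x) * exp (neg_tpi * of_int l * ?w x)"
    have "(?g has_integral
        (f z0 * fcoeff (\<lambda>_. 1) s l + exp (neg_tpi * z0) * fcoeff quot s (l - 1) - fcoeff quot s l)) {0..1}"
      by (intro has_integral_diff has_integral_add has_integral_mult_right I quot) (auto intro: holomorphic_intros)
    also have "?g = (\<lambda>x. f (?w x) * exp (neg_tpi * of_int l * ?w x))"
    proof
      fix x
      have w: "?w x \<in> strip J" using s by (simp add: strip_def)
      have "exp (neg_tpi * z0) * exp (neg_tpi * of_int (l - 1) * ?w x) =
          exp (tpi * (?w x - z0)) * exp (neg_tpi * of_int l * ?w x)"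
        unfolding exp_add[symmetric] by (simp add: algebra_simps)
      thus "?g x = f (?w x) * exp (neg_tpi * of_int l * ?w x)"
        unfolding quot(3)[OF w] by (simp only: mult.left_commute[of _ "quot (?w x)"]) (simp add: algebra_simps)
    qed
    finally show ?thesis unfolding fcoeff_def[of f] by (rule integral_unique)
  qed
  have "(\<lambda>l. norm (d l)) summable_on UNIV"
    unfolding d_def e_def by (rule fcoeff_summable[OF J quot(1,2) s z0])
  hence "d summable_on UNIV"
    by (rule Infinite_Sum.abs_summable_summable[where f = d])
  then obtain D where D: "(d has_sum D) UNIV" by (auto simp: summable_on_def)
  have D': "((\<lambda>l. d (l - 1)) has_sum D) UNIV"
    using D by (subst has_sum_reindex_bij_betw[of "\<lambda>l. l - 1" UNIV UNIV d])
      (auto intro: bij_betwI[where g = "\<lambda>l. l + 1"])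
  have "((\<lambda>l. (if l = 0 then f z0 else 0) + (d (l - 1) - d l)) has_sum (f z0 + (D - D))) UNIV"
  proof (intro has_sum_add)
    show "((\<lambda>l::int. if l = 0 then f z0 else 0) has_sum f z0) UNIV"
      by (rule has_sum_finite_neutralI[of "{0}"]) auto
    show "((\<lambda>l. d (l - 1) - d l) has_sum (D - D)) UNIV"
      using has_sum_add[OF D' has_sum_cmult_right[OF D, of "-1"]] by simp
  qed
  also have "(\<lambda>l. (if l = 0 then f z0 else 0) + (d (l - 1) - d l)) =
      (\<lambda>l. fcoeff f s l * exp (tpi * of_int l * z0))"
  proof
    fix l
    have "exp (neg_tpi * z0) * e l z0 = e (l - 1) z0"
      unfolding e_def exp_add[symmetric] by (simp add: algebra_simps)
    hence "fcoeff f s l * e l z0 = (if l = 0 then f z0 else 0) + (d (l - 1) - d l)"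
      unfolding rec[of l] fcoeff_const_1 d_def by (simp add: ring_distribs e_def mult_ac)
    thus "(if l = 0 then f z0 else 0) + (d (l - 1) - d l) = fcoeff f s l * exp (tpi * of_int l * z0)"
      by (simp add: e_def)
  qed
  finally show ?thesis by simp
qed

text \<open>Expand in \<open>z\<close> first, then each coefficient \<open>C\<^sub>l(\<tau>)\<close> in \<open>\<tau>\<close>; the double series converges
  absolutely by the bounds of the coefficients at two heights in each variable.\<close>
lemma two_variable_fourier:
  fixes \<psi> :: "complex \<Rightarrow> complex \<Rightarrow> complex"
  assumes jh: "\<And>z \<tau>. Im \<tau> > 0 \<Longrightarrow> holo2 (\<lambda>(z, \<tau>). \<psi> z \<tau>) (z, \<tau>)"
    and p1: "\<And>z \<tau>. Im \<tau> > 0 \<Longrightarrow> \<psi> (z + 1) \<tau> = \<psi> z \<tau>"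
    and p2: "\<And>z \<tau>. Im \<tau> > 0 \<Longrightarrow> \<psi> z (\<tau> + 1) = \<psi> z \<tau>"
    and T0: "T0 > 0" and bd: "\<And>z \<tau>. Im \<tau> \<ge> T0 \<Longrightarrow> Im z = 1 \<Longrightarrow> norm (\<psi> z \<tau>) \<le> M"
  obtains a :: "int \<Rightarrow> int \<Rightarrow> complex" where "\<And>n l. n < 0 \<Longrightarrow> a n l = 0"
    "\<And>z \<tau>. Im \<tau> > 0 \<Longrightarrow> ((\<lambda>(n, l). a n l * exp (tpi * of_int n * \<tau>) *
        exp (tpi * of_int l * z)) has_sum \<psi> z \<tau>) UNIV"
proof -
  define H where "H = {t. Im t > 0}"
  have H_strip: "H = strip {0<..}" by (simp add: H_def strip_def)
  have U_strip: "UNIV = strip UNIV" by (simp add: strip_def)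
  have oH: "open H" unfolding H_strip by (intro open_strip) auto
  have J1: "open (UNIV :: real set)" "convex (UNIV :: real set)" by auto
  have J2: "open {0::real<..}" "convex {0::real<..}" by auto
  have cont: "continuous_on (UNIV \<times> H) (\<lambda>(z, \<tau>). \<psi> z \<tau>)"
    using holo2_isCont[OF jh] by (intro continuous_at_imp_continuous_on) (auto simp: H_def)
  have hol1: "(\<lambda>z. \<psi> z \<tau>) holomorphic_on strip UNIV" if "Im \<tau> > 0" for \<tau>
    using holo2_slice1[OF jh[OF that]] by (auto simp: holomorphic_on_def intro: field_differentiable_at_within)
  have hol2: "\<psi> z holomorphic_on H" for z
    using holo2_slice2[OF jh] by (auto simp: holomorphic_on_def H_def intro: field_differentiable_at_within)
  have per1: "\<psi> (z + 1) \<tau> = \<psi> z \<tau>" if "Im \<tau> > 0" "z \<in> strip UNIV" for z \<tau>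
    using p1 that by blast
  define C where "C = (\<lambda>l \<tau>. fcoeff (\<lambda>z. \<psi> z \<tau>) 0 l)"
  have C_eq: "C l \<tau> = fcoeff (\<lambda>z. \<psi> z \<tau>) s l" if "Im \<tau> > 0" for l \<tau> s
    unfolding C_def by (rule fcoeff_has_integral(2)[OF J1 hol1[OF that] per1[OF that]]) auto
  have C_per: "C l (\<tau> + 1) = C l \<tau>" if "\<tau> \<in> strip {0<..}" for l \<tau>
  proof -
    have "(\<lambda>z. \<psi> z (\<tau> + 1)) = (\<lambda>z. \<psi> z \<tau>)" using p2 that by (auto simp: strip_def)
    thus ?thesis by (simp add: C_def)
  qed
  have C_hol: "C l holomorphic_on strip {0<..}" for l
  proof -
    let ?e = "\<lambda>x::real. exp (neg_tpi * of_int l * (of_real x + \<i> * of_real 0))"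
    let ?w = "\<lambda>x::real. of_real x + \<i> * of_real 0 :: complex"
    have "(\<lambda>\<tau>. integral (cbox 0 1) (\<lambda>x. \<psi> (?w x) \<tau> * ?e x)) holomorphic_on H"
    proof (rule leibniz_rule_holomorphic)
      fix \<tau> and x :: real assume \<tau>: "\<tau> \<in> H"
      have "(\<psi> (?w x) has_field_derivative deriv (\<psi> (?w x)) \<tau>) (at \<tau>)"
        using hol2 oH \<tau> holomorphic_derivI by blast
      from DERIV_cmult_right[OF this, of "?e x"]
      show "((\<lambda>\<tau>. \<psi> (?w x) \<tau> * ?e x) has_field_derivative deriv (\<psi> (?w x)) \<tau> * ?e x) (at \<tau> within H)"
        by (rule has_field_derivative_at_within)
    next
      fix \<tau> assume \<tau>: "\<tau> \<in> H"
      hence "Im \<tau> > 0" by (simp add: H_def)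
      from fcoeff_has_integral(1)[OF J1 hol1[OF this] per1[OF this], of 0 l]
      show "(\<lambda>x. \<psi> (?w x) \<tau> * ?e x) integrable_on cbox 0 1"
        by (auto simp: integrable_on_def)
    next
      have "continuous_on (UNIV \<times> H) (\<lambda>(z, \<tau>). deriv (\<psi> z) \<tau>)"
        by (rule continuous_on_deriv_param[OF cont oH hol2])
      hence "continuous_on (H \<times> cbox 0 1) (\<lambda>p. (\<lambda>(z, \<tau>). deriv (\<psi> z) \<tau>) (?w (snd p), fst p))"
        by (rule continuous_on_compose2) (auto intro!: continuous_intros)
      hence "continuous_on (H \<times> cbox 0 1) (\<lambda>p. deriv (\<psi> (?w (snd p))) (fst p) * ?e (snd p))"
        by (intro continuous_intros) auto
      thus "continuous_on (H \<times> cbox 0 1) (\<lambda>(\<tau>, x). deriv (\<psi> (?w x)) \<tau> * ?e x)"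
        by (simp add: case_prod_unfold)
    next
      show "convex H" unfolding H_strip by (intro convex_strip) auto
    qed
    thus ?thesis unfolding H_strip C_def fcoeff_def by simp
  qed
  define a where "a = (\<lambda>n l. fcoeff (C l) 1 n)"
  have a_bound: "norm (a n l) \<le> K * exp (2 * pi * of_int l * s) * exp (2 * pi * of_int n * t)"
    if t: "t > 0" and K: "\<And>x x'. x \<in> {0..1} \<Longrightarrow> x' \<in> {0..1} \<Longrightarrow>
        norm (\<psi> (of_real x + \<i> * of_real s) (of_real x' + \<i> * of_real t)) \<le> K" for n l s t K
  proof -
    have tJ: "t \<in> {0<..}" using t by simp
    have 1: "(1::real) \<in> {0<..}" by simp
    have "norm (C l (of_real x' + \<i> * of_real t)) \<le> K * exp (2 * pi * of_int l * s)" if x': "x' \<in> {0..1}" for x' :: real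
    proof -
      have im: "Im (of_real x' + \<i> * of_real t) > 0" using t by simp
      show ?thesis unfolding C_eq[OF im, of l s]
        by (rule norm_fcoeff_le[OF J1 hol1[OF im] per1[OF im]]) (use K x' in auto)
    qed
    hence "norm (fcoeff (C l) t n) \<le> (K * exp (2 * pi * of_int l * s)) * exp (2 * pi * of_int n * t)"
      by (intro norm_fcoeff_le[OF J2 C_hol C_per tJ])
    thus ?thesis
      unfolding a_def using fcoeff_has_integral(2)[OF J2 C_hol C_per 1 tJ] by simp
  qed
  have a_neg: "a n l = 0" if n: "n < 0" for n l
  proof -
    have ev: "eventually (\<lambda>t. norm (a n l) \<le> M * exp (2 * pi * of_int l * 1) * exp (2 * pi * of_int n * t)) at_top"
      using eventually_ge_at_top[of T0]
    proof eventually_elim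
      case (elim t)
      show ?case by (rule a_bound) (use elim T0 bd in auto)
    qed
    have "filterlim (\<lambda>t::real. 2 * pi * of_int n * t) at_bot at_top"
      using n by (intro filterlim_tendsto_neg_mult_at_bot[OF tendsto_const _ filterlim_ident])
        (auto simp: mult_pos_neg)
    hence "((\<lambda>t::real. exp (2 * pi * of_int n * t)) \<longlongrightarrow> 0) at_top"
      by (rule filterlim_compose[OF exp_at_bot])
    hence "((\<lambda>t::real. M * exp (2 * pi * of_int l * 1) * exp (2 * pi * of_int n * t)) \<longlongrightarrow> 0) at_top"
      by (rule tendsto_mult_right_zero)
    from tendsto_lowerbound[OF this ev] show ?thesis by simp
  qed
  have sum: "((\<lambda>(n, l). a n l * exp (tpi * of_int n * \<tau>) *
        exp (tpi * of_int l * z)) has_sum \<psi> z \<tau>) UNIV" if \<tau>: "Im \<tau> > 0" for z \<tau>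
  proof -
    let ?f = "\<lambda>(l, n). a n l * exp (tpi * of_int n * \<tau>) * exp (tpi * of_int l * z)"
    \<comment> \<open>The heights around \<open>Im \<tau> = 2 t\<close> are \<open>t\<close> and \<open>3 t\<close>, both positive.\<close>
    define t where "t = Im \<tau> / 2"
    have t: "t > 0" "3 * t > 0" "Im \<tau> = 2 * t" using \<tau> by (simp_all add: t_def)
    have ex_K: "\<exists>K. \<forall>x\<in>{0..1}. \<forall>x'\<in>{0..1}. norm (\<psi> (of_real x + \<i> * of_real s) (of_real x' + \<i> * of_real t)) \<le> K"
      if t: "t > 0" for s t :: real
    proof -
      have "continuous_on ({0..1} \<times> {0..1}) (\<lambda>p. (\<lambda>(z, \<tau>). \<psi> z \<tau>) (of_real (fst p) + \<i> * of_real s, of_real (snd p) + \<i> * of_real t))"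
        by (rule continuous_on_compose2[OF cont]) (use t in \<open>auto intro!: continuous_intros simp: H_def\<close>)
      hence "compact ((\<lambda>p. (\<lambda>(z, \<tau>). \<psi> z \<tau>) (of_real (fst p) + \<i> * of_real s, of_real (snd p) + \<i> * of_real t)) ` ({0..1} \<times> {0..1::real}))"
        by (rule compact_continuous_image) (intro compact_Times compact_Icc)
      from compact_imp_bounded[OF this] show ?thesis
        by (auto simp: bounded_iff)
    qed
    define B where "B = (\<lambda>s t. SOME K. \<forall>x\<in>{0..1}. \<forall>x'\<in>{0..1}.
        norm (\<psi> (of_real x + \<i> * of_real s) (of_real x' + \<i> * of_real t)) \<le> K)"
    have B: "norm (\<psi> (of_real x + \<i> * of_real s) (of_real x' + \<i> * of_real t)) \<le> B s t"
      if "t > 0" "x \<in> {0..1}" "x' \<in> {0..1}" for s t x x' :: real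
      using someI_ex[OF ex_K[OF that(1)]] that(2,3) unfolding B_def by blast
    define K where "K = Max {B (Im z - 1) t, B (Im z + 1) t, B (Im z - 1) (3 * t), B (Im z + 1) (3 * t)}"
    have K: "B s t' \<le> K" if "s \<in> {Im z - 1, Im z + 1}" "t' \<in> {t, 3 * t}" for s t'
      unfolding K_def by (rule Max_ge) (use that in auto)
    have a_le: "norm (a n l) \<le> K * exp (2 * pi * of_int l * s) * exp (2 * pi * of_int n * t')"
      if "s \<in> {Im z - 1, Im z + 1}" "t' \<in> {t, 3 * t}" for s t' n l
    proof (rule a_bound)
      show "t' > 0" using that t by auto
      thus "norm (\<psi> (of_real x + \<i> * of_real s) (of_real x' + \<i> * of_real t')) \<le> K"
        if "x \<in> {0..1}" "x' \<in> {0..1}" for x x' :: real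
        using order_trans[OF B K] that \<open>s \<in> _\<close> \<open>t' \<in> _\<close> by blast
    qed
    define r1 where "r1 = exp (- 2 * pi * 1)"
    define r2 where "r2 = exp (- 2 * pi * t)"
    have term_le: "norm (?f (l, n)) \<le> K * r1 ^ nat \<bar>l\<bar> * r2 ^ nat \<bar>n\<bar>" for l n
    proof -
      have *: "norm (a n l) * exp (- 2 * pi * of_int l * Im z) \<le> K * r1 ^ nat \<bar>l\<bar> * exp (2 * pi * of_int n * t')"
        if t': "t' \<in> {t, 3 * t}" for t'
      proof -
        have "norm (a n l) * exp (- 2 * pi * of_int l * Im z) \<le> K * exp (2 * pi * of_int n * t') * r1 ^ nat \<bar>l\<bar>"
          unfolding r1_def
        proof (rule exp_two_sided_le)
          show "norm (a n l) \<le> K * exp (2 * pi * of_int n * t') * exp (2 * pi * of_int l * (Im z - 1))"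
            using a_le[OF _ t', of "Im z - 1" n l] by (simp only: mult_ac insert_iff simp_thms)
          show "norm (a n l) \<le> K * exp (2 * pi * of_int n * t') * exp (2 * pi * of_int l * (Im z + 1))"
            using a_le[OF _ t', of "Im z + 1" n l] by (simp only: mult_ac insert_iff simp_thms)
        qed
        thus ?thesis by (simp only: mult_ac)
      qed
      have "norm (a n l) * exp (- 2 * pi * of_int l * Im z) * exp (- 2 * pi * of_int n * (2 * t)) \<le>
          (K * r1 ^ nat \<bar>l\<bar>) * r2 ^ nat \<bar>n\<bar>"
        unfolding r2_def
      proof (rule exp_two_sided_le)
        have "2 * t - t = t" "2 * t + t = 3 * t" by simp_all
        thus "norm (a n l) * exp (- 2 * pi * of_int l * Im z) \<le> K * r1 ^ nat \<bar>l\<bar> * exp (2 * pi * of_int n * (2 * t - t))"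
          "norm (a n l) * exp (- 2 * pi * of_int l * Im z) \<le> K * r1 ^ nat \<bar>l\<bar> * exp (2 * pi * of_int n * (2 * t + t))"
          using *[of t] *[of "3 * t"] by simp_all
      qed
      thus ?thesis by (simp add: norm_mult norm_exp_eq_Re t(3) mult_ac)
    qed
    have r: "0 \<le> r1" "r1 < 1" "0 \<le> r2" "r2 < 1" using t by (auto simp: r1_def r2_def)
    then obtain S where S: "((\<lambda>n::int. r2 ^ nat \<bar>n\<bar>) has_sum S) UNIV"
        using summable_on_int_geometric by (auto simp: summable_on_def)
    have "(\<lambda>(l, n). K * r1 ^ nat \<bar>l\<bar> * r2 ^ nat \<bar>n\<bar>) summable_on (UNIV \<times> UNIV)"
    proof (rule summable_on_SigmaI)
      show "((\<lambda>n. (\<lambda>(l, n). K * r1 ^ nat \<bar>l\<bar> * r2 ^ nat \<bar>n\<bar>) (l, n)) has_sum (K * r1 ^ nat \<bar>l\<bar> * S)) UNIV" for l :: int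
        using has_sum_cmult_right[OF S] by simp
      show "(\<lambda>l::int. K * r1 ^ nat \<bar>l\<bar> * S) summable_on UNIV"
        using r by (intro summable_on_cmult_left summable_on_cmult_right summable_on_int_geometric)
      have "0 \<le> K"
        using order_trans[OF norm_ge_zero order_trans[OF B K], of t 0 0 "Im z - 1"] t by simp
      thus "0 \<le> (\<lambda>(l, n). K * r1 ^ nat \<bar>l\<bar> * r2 ^ nat \<bar>n\<bar>) (l, n)" for l n :: int
        using r by simp
    qed
    hence "(\<lambda>p. norm (?f p)) summable_on (UNIV \<times> UNIV)"
      by (rule Infinite_Sum.abs_summable_on_comparison_test') (use term_le in auto)
    hence summ: "?f summable_on (UNIV \<times> UNIV)"
      by (rule Infinite_Sum.abs_summable_summable[where f = ?f])
    have "(?f has_sum \<psi> z \<tau>) (UNIV \<times> UNIV)"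
    proof (rule has_sum_SigmaI[OF _ _ summ])
      fix l :: int
      have "((\<lambda>n. fcoeff (C l) 1 n * exp (tpi * of_int n * \<tau>)) has_sum C l \<tau>) UNIV"
        by (rule has_sum_fcoeff[OF J2 C_hol C_per]) (use \<tau> in \<open>auto simp: strip_def\<close>)
      from has_sum_cmult_left[OF this, of "exp (tpi * of_int l * z)"]
      show "((\<lambda>n. ?f (l, n)) has_sum (C l \<tau> * exp (tpi * of_int l * z))) UNIV"
        by (simp add: a_def)
    next
      show "((\<lambda>l. C l \<tau> * exp (tpi * of_int l * z)) has_sum \<psi> z \<tau>) UNIV"
        unfolding C_def by (rule has_sum_fcoeff[OF J1 hol1[OF \<tau>] per1[OF \<tau>]]) (auto simp: strip_def)
    qed
    hence "((\<lambda>(n, l). ?f (l, n)) has_sum \<psi> z \<tau>) (UNIV \<times> UNIV)"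
      by (subst (asm) has_sum_swap)
    thus ?thesis by simp
  qed
  show ?thesis by (rule that[OF a_neg sum])
qed


section \<open>The elliptic genus is a weak Jacobi form\<close>

context LG_orbifold
begin

theorem Ell_weak_jacobi_form: "weak_jacobi_form_wt0 chat (Ell q \<theta> G)"
proof (cases "\<exists>j. \<kappa> j = 1")
  case True
  then obtain j where j: "\<kappa> j = 1" by blast
  have E0: "Ell q \<theta> G z \<tau> = 0" if "Im \<tau> > 0" for z \<tau>
    using Ell_eq_0[OF j that] .
  have "holomorphic_CxH (Ell q \<theta> G)"
    unfolding holomorphic_CxH_def
  proof (intro allI impI)
    fix z \<tau> :: complex assume \<tau>: "Im \<tau> > 0"
    have "holo2 (\<lambda>(w, t). Ell q \<theta> G w t) (z, \<tau>)"
    proof (rule holo2_transform[OF holo2_const])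
      have "eventually (\<lambda>p. Im (snd p) > 0) (nhds (z, \<tau>))"
        by (rule eventually_Im_snd_pos) (use \<tau> in simp)
      thus "eventually (\<lambda>p. 0 = (case p of (w, t) \<Rightarrow> Ell q \<theta> G w t)) (nhds (z, \<tau>))"
        by eventually_elim (auto simp: E0)
    qed
    thus "\<exists>a b. ((\<lambda>(w, t). Ell q \<theta> G w t) has_derivative (\<lambda>(h, k). a * h + b * k)) (at (z, \<tau>))"
      by (simp add: holo2_def case_prod_unfold)
  qed
  moreover have "Im (- 1 / \<tau>) > 0" if "Im \<tau> > 0" for \<tau>
    using that by (rule Im_neg_inverse_pos)
  ultimately show ?thesis
    unfolding weak_jacobi_form_wt0_def by (auto simp: E0 case_prod_unfold intro!: exI[of _ "\<lambda>_ _. 0"])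
next
  case False
  hence ne1: "\<kappa> j \<noteq> 1" for j by blast
  note jh = Ell_local(1)[OF _ ne1] and tr = Ell_transformations[OF ne1]
  \<comment> \<open>The exponential removes the sign under \<open>z \<mapsto> z + 1\<close>.\<close>
  define \<psi> where "\<psi> = (\<lambda>z \<tau>. Ell q \<theta> G z \<tau> * exp (- \<i> * of_real pi * of_int chat * z))"
  obtain M T0 where MT: "T0 > 0" "\<And>z \<tau>. Im \<tau> \<ge> T0 \<Longrightarrow> Im z = 1 \<Longrightarrow> norm (Ell q \<theta> G z \<tau>) \<le> M"
    by (rule Ell_bounded[OF ne1], rule that) auto
  have "\<exists>a. (\<forall>n l. n < 0 \<longrightarrow> a n l = 0) \<and>
      (\<forall>z \<tau>. Im \<tau> > 0 \<longrightarrow> ((\<lambda>(n, l). a n l * exp (tpi * of_int n * \<tau>) *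
        exp (tpi * of_int l * z)) has_sum \<psi> z \<tau>) UNIV)"
  proof (rule two_variable_fourier[of \<psi>])
    fix z \<tau> :: complex assume \<tau>: "Im \<tau> > 0"
    have "holo2 (\<lambda>p. (\<lambda>(z, \<tau>). Ell q \<theta> G z \<tau>) p * exp (- \<i> * of_real pi * of_int chat * fst p)) (z, \<tau>)"
      by (intro holo2_intros jh \<tau>)
    thus "holo2 (\<lambda>(z, \<tau>). \<psi> z \<tau>) (z, \<tau>)"
      by (simp add: \<psi>_def case_prod_unfold)
    have "exp (- \<i> * of_real pi * of_int chat) = (- 1) powi chat"
    proof -
      have "exp (- \<i> * of_real pi) powi chat = exp (of_int chat * (- \<i> * of_real pi))"
        by (rule exp_power_int)
      moreover have "exp (- \<i> * of_real pi) = - 1" by (simp add: exp_minus)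
      ultimately show ?thesis by (simp add: mult_ac)
    qed
    hence e: "exp (- \<i> * of_real pi * of_int chat * (z + 1)) = exp (- \<i> * of_real pi * of_int chat * z) * (- 1) powi chat"
      by (simp only: ring_distribs exp_add mult_1_right)
    have "(- 1 :: complex) powi chat * (- 1) powi chat = 1"
      by (simp flip: power_int_mult_distrib)
    thus "\<psi> (z + 1) \<tau> = \<psi> z \<tau>"
      unfolding \<psi>_def tr(3)[OF \<tau>] e by (simp add: mult_ac)
    show "\<psi> z (\<tau> + 1) = \<psi> z \<tau>"
      unfolding \<psi>_def tr(1)[OF \<tau>] ..
  next
    show "T0 > 0" by fact
    fix z \<tau> :: complex assume "T0 \<le> Im \<tau>" "Im z = 1"
    thus "norm (\<psi> z \<tau>) \<le> M * exp (pi * of_int chat)"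
      using MT(2)[of \<tau> z] by (simp add: \<psi>_def norm_mult norm_exp_eq_Re)
  qed blast
  then obtain a where a: "\<And>n l. n < 0 \<Longrightarrow> a n l = 0"
    "\<And>z \<tau>. Im \<tau> > 0 \<Longrightarrow> ((\<lambda>(n, l). a n l * exp (tpi * of_int n * \<tau>) *
        exp (tpi * of_int l * z)) has_sum \<psi> z \<tau>) UNIV" by blast
  have fourier: "((\<lambda>(n, l). a n l * exp (tpi * of_int n * \<tau>) *
      exp (tpi * (of_int l + of_int chat / 2) * z)) has_sum Ell q \<theta> G z \<tau>) UNIV"
    (is "(?f has_sum _) _") if \<tau>: "Im \<tau> > 0" for z \<tau>
  proof -
    let ?c = "exp (\<i> * of_real pi * of_int chat * z)"
    have e: "?c * exp (tpi * of_int l * z) =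
        exp (tpi * (of_int l + of_int chat / 2) * z)" for l
      by (simp add: algebra_simps flip: exp_add)
    have "?c * (case p of (n, l) \<Rightarrow> a n l * exp (tpi * of_int n * \<tau>) *
        exp (tpi * of_int l * z)) = ?f p" for p
      unfolding e[symmetric] by (cases p) (simp only: prod.case mult_ac)
    moreover have "?c * \<psi> z \<tau> = Ell q \<theta> G z \<tau>" by (simp add: \<psi>_def exp_minus)
    ultimately show ?thesis
      using has_sum_cmult_right[OF a(2)[OF \<tau>, of z], of ?c] by (simp only:)
  qed
  show ?thesis
    unfolding weak_jacobi_form_wt0_def
  proof (intro conjI allI impI exI[of _ a])
    show "holomorphic_CxH (Ell q \<theta> G)"
      unfolding holomorphic_CxH_def using jh by (simp add: holo2_def case_prod_unfold)
  qed (use tr a(1) fourier in blast)+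
qed

end

theorem theorem4p3:
  fixes A :: "nat^'n^'n" and q :: "rat^'n" and G :: "(complex^'n) set"
    and \<theta> :: "complex^'n \<Rightarrow> rat^'n" and chat :: int
  assumes "invertible (\<chi> i j. of_nat (A $ i $ j) :: rat^'n^'n)"
    and "\<forall>j. q $ j > 0"
    and "\<forall>i. (\<Sum>j\<in>UNIV. of_nat (A $ i $ j) * q $ j) = 1"
    and "nondegenerate A"
    and "(\<Sum>j\<in>UNIV. q $ j) \<in> \<int>" and "(\<Sum>j\<in>UNIV. q $ j) > 0"
    and "subgroup G (Aut_W A)"
    and "generate (Aut_W A) {J_W q} \<subseteq> G" and "G \<subseteq> SL_W A"
    and "\<forall>n\<in>G. \<forall>j. n $ j = exp (2 * of_real pi * \<i> * of_rat (\<theta> n $ j))"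
    and "of_int chat = of_nat CARD('n) - 2 * (\<Sum>j\<in>UNIV. q $ j)"
  shows "weak_jacobi_form_wt0 chat (Ell q \<theta> G)"
proof -
  interpret LG_orbifold A q G \<theta> chat
    by (rule LG_orbifold.intro) (fact assms)+
  show ?thesis by (rule Ell_weak_jacobi_form)
qed

end
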